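(* Let $(k_1,\alpha_1),\dots,(k_n,\alpha_n)$ be an admissible sequence and let $\Sigma$ be the limiting covariance matrix $\Sigma=\lim_{t\to\infty}\big(\mathrm{Cov}(\widehat{\mathcal{V}}_{k_l}^{(\alpha_l)},\widehat{\mathcal{V}}_{k_j}^{(\alpha_j)})\big)_{l,j=1,\dots,n}$. (i) In the sparse regime $\lim_{t\to\infty}t\delta_t^d=0$, the rank of $\Sigma$ equals $n$. (ii) In the thermodynamic regime $\lim_{t\to\infty}t\delta_t^d=c\in(0,\infty)$, $\Sigma$ has rank $n$ except for finitely many values of $c$. (iii) In the dense regime $\lim_{t\to\infty}t\delta_t^d=\infty$, $\Sigma$ has rank one.
   Context: Fix $d\ge 1$ and a compact convex set $W\subset\mathbb{R}^d$ of volume $1$. For $t>0$ let $\eta_t$ be a Poisson point process on $W$ with constant intensity $t$ (intensity measure $t\,dx$ on $W$), and let $\delta_t>0$ be real numbers with $\delta_t\to0$ as $t\to\infty$. Let $B^d$ be the unit ball of $\mathbb{R}^d$ centered at the origin. For $s>0$ and points $x_0,\dots,x_k\in\mathbb{R}^d$, $\Delta_s[x_0,\dots,x_k]$ denotes the $k$-dimensional volume of the convex hull of $x_0,\dots,x_k$ if $\|x_i-x_j\|\le s$ for all $i,j$, and $0$ otherwise. The power $\Delta_s[x_0,\dots,x_k]^\alpha$ is understood as the $\alpha$-th power of this volume times the indicator that all pairwise distances are at most $s$ (so it is $0$ if some pairwise distance exceeds $s$, also for $\alpha\le 0$; for $\alpha=0$ it is this indicator). For $k>d$ only $\alpha=0$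 is used, and $\Delta_s[x_0,\dots,x_k]^0$ is the indicator that all pairwise distances are at most $s$. For $k=0$, $\Delta_s[x_0]=1$. The volume-power functional of the Vietoris-Rips complex is $$\mathcal{V}_k^{(\alpha)}=\frac1{(k+1)!}\sum_{(x_0,\dots,x_k)\in\eta_{t,\neq}^{k+1}}\Delta_{\delta_t}[x_0,\dots,x_k]^\alpha,$$ where $\eta_{t,\neq}^{k+1}$ is the set of $(k+1)$-tuples of distinct points of $\eta_t$. A sequence $(k_1,\alpha_1),\dots,(k_n,\alpha_n)$ (with $k_i$ integers, $\alpha_i$ real) is admissible if (i) $0\le k_1\le\dots\le k_n$; (ii) the pairs $(k_i,\alpha_i)$ are distinct; (iii) $\alpha_i=0$ for $k_i>d$; (iv) $\min\{\alpha_i,\alpha_j,\alpha_i+\alpha_j\}>-d$ for all $i,j\in\{1,\dots,n\}$. Normalization: $\widehat{\mathcal{V}}_{k_i}^{(\alpha_i)}=\mathcal{V}_{k_i}^{(\alpha_i)}/Q_i$ with $$Q_i=t^{1/2}\,\delta_t^{\alpha_ik_i}\max_{1\le m\le k_i+1}(t\delta_t^d)^{k_i-\frac{m-1}2}.$$ For integers $p\le q$, $1\le m\le p+1$ and reals $\alpha,\beta$, $$\mu_{p,q:m}^{(\alpha,\beta)}=\int_{(B^d)^{p+q+1-m}}\Delta_1[0,\{x_l\}_{l=1}^{p}]^{\alpha}\,\Delta_1[0,\{x_l\}_{l=p-m+2}^{p+q-m+1}]^{\beta}\,dx_1\cdots dx_{p+q-m+1},$$ where $\{x_l\}_{l=a}^{b}$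 stands for the points $x_a,\dots,x_b$ (no points if $b<a$; an integral over no variables equals the integrand), and $\mu_{q,p:m}^{(\beta,\alpha)}=\mu_{p,q:m}^{(\alpha,\beta)}$. The limiting covariance matrix is explicitly $$\Sigma=\begin{cases}A^{<1}_0 & \text{if }\lim t\delta_t^d=0,\\ \sum_{m=0}^{2k_n}A^{<1}_m\,c^{m/2} & \text{if }\lim t\delta_t^d=c\in(0,1],\\ \sum_{m=0}^{k_n}A^{>1}_m\,c^{-m} & \text{if }\lim t\delta_t^d=c\in[1,\infty),\\ A^{>1}_0 & \text{if }\lim t\delta_t^d=\infty,\end{cases}$$ with the $n\times n$ matrices, for $m=0,\dots,2k_n$, $$(A^{<1}_m)_{lj}=\mu_{k_l,k_j:\frac{k_l+k_j-m+2}2}^{(\alpha_l,\alpha_j)}\;\frac{\mathbf{1}\big(m-|k_l-k_j|\in\{0,2,4,\dots,2\min(k_l,k_j)\}\big)}{\big(\frac{k_l+k_j-m+2}2\big)!\,\big(\frac{m-k_l+k_j}2\big)!\,\big(\frac{m+k_l-k_j}2\big)!},$$ and for $m=0,\dots,k_n$, $$(A^{>1}_m)_{lj}=\mu_{k_l,k_j:m+1}^{(\alpha_l,\alpha_j)}\;\frac{\mathbf{1}(m\le\min(k_l,k_j))}{(m+1)!\,(k_l-m)!\,(k_j-m)!},$$ where an entry is $0$ whenever its indicator vanishes.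
   Formalization: Parts (i) and (ii) assume at most one k_i is 0, since e.g. (0,0),(0,1) is admissible but gives the same functional twice; the functionals are assumed square integrable for large t, since condition (iv) alone allows infinite variances, e.g. d=k=2, α=-0.6. *)

theory Defs
  imports "HOL-Probability.Probability"
begin

text \<open>
  Space is \<open>real^'d\<close>, so \<open>d = CARD('d)\<close>; the index set \<open>{1..n}\<close> is a finite linearly ordered
  type \<open>'n\<close>, so \<open>n = CARD('n)\<close>.
\<close>

text \<open>
  The \<open>k\<close>-dimensional volume of \<open>S\<close> is its Lebesgue measure in orthonormal coordinates on a
  \<open>k\<close>-dimensional affine plane containing it. The value does not depend on the chosen plane or
  coordinates. It is unspecified if there is no such plane (for instance if \<open>k > d\<close>).
\<close>

definition orthonormal_coords :: "nat \<Rightarrow> (real^'d) set \<Rightarrow> (real^'d) \<times> (nat \<Rightarrow> real^'d) \<Rightarrow> bool" where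
  "orthonormal_coords k S = (\<lambda>(p, e).
     (\<forall>i<k. \<forall>j<k. e i \<bullet> e j = (if i = j then 1 else 0)) \<and>
     (\<forall>x\<in>S. \<exists>c. x = p + (\<Sum>i<k. c i *\<^sub>R e i)))"

definition kvolume :: "nat \<Rightarrow> (real^'d) set \<Rightarrow> real" where
  "kvolume k S = (case SOME q. orthonormal_coords k S q of (p, e) \<Rightarrow>
     measure (\<Pi>\<^sub>M i\<in>{..<k}. lborel)
       {c \<in> space (\<Pi>\<^sub>M i\<in>{..<k}. lborel). p + (\<Sum>i<k. c i *\<^sub>R e i) \<in> S})"

text \<open>
  \<open>simplex_power s k \<alpha> x\<close> is the \<open>\<alpha>\<close>-th power of the truncated volume of the points
  \<open>x 0, \<dots>, x k\<close>. The case \<open>\<alpha> = 0\<close> is separate because \<open>0 powr 0 = 0\<close>, and because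
  it is the only one used for \<open>k > d\<close>.
\<close>

definition simplex_power :: "real \<Rightarrow> nat \<Rightarrow> real \<Rightarrow> (nat \<Rightarrow> real^'d) \<Rightarrow> real" where
  "simplex_power s k \<alpha> x =
     (if \<forall>i\<le>k. \<forall>j\<le>k. norm (x i - x j) \<le> s
      then (if \<alpha> = 0 then 1 else kvolume k (convex hull (x ` {..k})) powr \<alpha>)
      else 0)"

definition distinct_tuples :: "nat \<Rightarrow> 'a set \<Rightarrow> (nat \<Rightarrow> 'a) set" where
  "distinct_tuples k A = {x \<in> {..k} \<rightarrow>\<^sub>E A. inj_on x {..k}}"

definition volume_power :: "real \<Rightarrow> nat \<Rightarrow> real \<Rightarrow> (real^'d) set \<Rightarrow> real" where
  "volume_power s k \<alpha> A = (\<Sum>x\<in>distinct_tuples k A. simplex_power s k \<alpha> x) / fact (k + 1)"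

text \<open>\<open>normalizer d t s k \<alpha>\<close> is the normalizing factor for intensity \<open>t\<close> and distance \<open>s\<close>.\<close>

definition normalizer :: "nat \<Rightarrow> real \<Rightarrow> real \<Rightarrow> nat \<Rightarrow> real \<Rightarrow> real" where
  "normalizer d t s k \<alpha> = t powr (1/2) * s powr (\<alpha> * real k) *
     Max ((\<lambda>m. (t * s ^ d) powr (real k - (real m - 1) / 2)) ` {1..k+1})"

definition normalized_volume_power :: "real \<Rightarrow> real \<Rightarrow> nat \<Rightarrow> real \<Rightarrow> (real^'d) set \<Rightarrow> real" where
  "normalized_volume_power t s k \<alpha> A = volume_power s k \<alpha> A / normalizer CARD('d) t s k \<alpha>"

text \<open>
  Poisson point process on \<open>W\<close> with intensity measure \<open>t dx\<close>, for \<open>W\<close> of finite volume. It is a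
  simple process with finitely many points, hence represented by a random finite set; \<open>indep_vars\<close>
  includes the measurability of the counting variables.
\<close>

definition poisson_process :: "'w measure \<Rightarrow> (real^'d) set \<Rightarrow> real \<Rightarrow> ('w \<Rightarrow> (real^'d) set) \<Rightarrow> bool" where
  "poisson_process M W t \<eta> \<longleftrightarrow>
     prob_space M \<and>
     (\<forall>\<omega>\<in>space M. finite (\<eta> \<omega>) \<and> \<eta> \<omega> \<subseteq> W) \<and>
     (\<forall>B\<in>sets borel. \<forall>j::nat.
        measure M {\<omega> \<in> space M. card (\<eta> \<omega> \<inter> B) = j} =
          (t * measure lborel (W \<inter> B)) ^ j / fact j * exp (- (t * measure lborel (W \<inter> B)))) \<and>
     (\<forall>(I :: nat set) B. finite I \<longrightarrow> B ` I \<subseteq> sets borel \<longrightarrow> disjoint_family_on B I \<longrightarrow>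
        prob_space.indep_vars M (\<lambda>_. count_space UNIV) (\<lambda>i \<omega>. card (\<eta> \<omega> \<inter> B i)) I)"

definition covariance :: "'w measure \<Rightarrow> ('w \<Rightarrow> real) \<Rightarrow> ('w \<Rightarrow> real) \<Rightarrow> real" where
  "covariance M X Y = (\<integral>\<omega>. (X \<omega> - (\<integral>\<omega>'. X \<omega>' \<partial>M)) * (Y \<omega> - (\<integral>\<omega>'. Y \<omega>' \<partial>M)) \<partial>M)"

text \<open>
  The covariance matrices of \<open>X t\<close> exist for all large \<open>t\<close> and converge to \<open>\<Sigma>\<close>. Square
  integrability is required explicitly, since a Bochner integral that does not exist is \<open>0\<close>.
\<close>

definition limit_covariance ::
    "(real \<Rightarrow> 'w measure) \<Rightarrow> (real \<Rightarrow> 'n \<Rightarrow> 'w \<Rightarrow> real) \<Rightarrow> real^'n^'n \<Rightarrow> bool" where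
  "limit_covariance M X \<Sigma> \<longleftrightarrow>
     (\<forall>\<^sub>F t in at_top. \<forall>l. X t l \<in> borel_measurable (M t) \<and> integrable (M t) (\<lambda>\<omega>. (X t l \<omega>)\<^sup>2)) \<and>
     (\<forall>l j. ((\<lambda>t. covariance (M t) (X t l) (X t j)) \<longlongrightarrow> \<Sigma> $ l $ j) at_top)"

text \<open>
  \<open>\<Sigma>\<close> is the limiting covariance matrix of the normalized volume-power functionals of the
  Vietoris-Rips complexes with distance parameters \<open>\<delta> t\<close> over Poisson processes \<open>\<eta> t\<close> on \<open>W\<close>.
  The processes for different \<open>t\<close> may live on different probability spaces.
\<close>

definition rips_limit_covariance ::
    "(real^'d) set \<Rightarrow> ('n \<Rightarrow> nat) \<Rightarrow> ('n \<Rightarrow> real) \<Rightarrow> (real \<Rightarrow> 'w measure) \<Rightarrow>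
     (real \<Rightarrow> 'w \<Rightarrow> (real^'d) set) \<Rightarrow> (real \<Rightarrow> real) \<Rightarrow> real^'n^'n \<Rightarrow> bool" where
  "rips_limit_covariance W k \<alpha> M \<eta> \<delta> \<Sigma> \<longleftrightarrow>
     (\<forall>t>0. poisson_process (M t) W t (\<eta> t)) \<and>
     (\<forall>t>0. \<delta> t > 0) \<and> (\<delta> \<longlongrightarrow> 0) at_top \<and>
     limit_covariance M (\<lambda>t i \<omega>. normalized_volume_power t (\<delta> t) (k i) (\<alpha> i) (\<eta> t \<omega>)) \<Sigma>"

definition admissible :: "nat \<Rightarrow> ('n::linorder \<Rightarrow> nat) \<Rightarrow> ('n \<Rightarrow> real) \<Rightarrow> bool" where
  "admissible d k \<alpha> \<longleftrightarrow>
     mono k \<and>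
     inj (\<lambda>i. (k i, \<alpha> i)) \<and>
     (\<forall>i. k i > d \<longrightarrow> \<alpha> i = 0) \<and>
     (\<forall>i j. Min {\<alpha> i, \<alpha> j, \<alpha> i + \<alpha> j} > - real d)"

text \<open>
  For \<open>k = 0\<close> the functional is the number of points, whatever the exponent. So \<open>(0, \<alpha>)\<close> and
  \<open>(0, \<beta>)\<close> give the same functional, and full rank needs at most one index with \<open>k i = 0\<close>.
\<close>

definition no_repeated_vertex_count :: "('n \<Rightarrow> nat) \<Rightarrow> bool" where
  "no_repeated_vertex_count k \<longleftrightarrow> (\<forall>i j. k i = 0 \<and> k j = 0 \<longrightarrow> i = j)"

end

theory Submission
  imports Defs
begin

text \<open>
  Write \<open>X\<^sub>l\<close> for the normalized functionals, \<open>p\<^sub>l = k\<^sub>l + 1\<close> and \<open>\<tau> = t \<delta>^d\<close>. The rank of the limiting covariance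
  matrix is read off from an exact formula for the variance of \<open>F = \<Sum>\<^sub>l a\<^sub>l X\<^sub>l\<close> at finite \<open>t\<close>.

  A volume-power functional is a U-statistic: it sums a function of point sets over all
  \<open>p\<close>-element subsets of the process. Expanding the product of two such sums and sorting the pairs
  \<open>(S, T)\<close> of subsets by \<open>m = |S \<inter> T|\<close> gives sums over tuples of \<open>p + q - m\<close> distinct points. Their
  expectations are integrals, by the multivariate Mecke formula (\<open>poisson_tuple_sum\<close>), and the term
  \<open>m = 0\<close> is the product of the two expectations. Hence the covariance is a sum over \<open>m \<ge> 1\<close> of overlap
  integrals (\<open>poisson_ustatistic_covariance\<close>). By Fubini the overlap integral is the inner product, in
  the \<open>m\<close> shared points, of two functions that arise by integrating out the other points
  (\<open>overlap_integral_eq\<close>). So for each \<open>m\<close> the overlap integrals form a Gram matrix, and the variance of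
  \<open>F\<close> is a sum of squared norms; it is at least any one of them (\<open>quadratic_form_ge\<close>).

  Suppose first that \<open>\<tau>\<close> stays bounded. Let \<open>K\<close> be the largest \<open>k\<^sub>l\<close> with \<open>a\<^sub>l \<noteq> 0\<close>. The term \<open>m = K + 1\<close>
  only sees the indices with \<open>k\<^sub>l = K\<close>, for which no point is integrated out. Translation and
  scaling bound it below by a positive multiple of the integral of the square of
  \<open>\<Sum> a\<^sub>l \<Delta>\<^sub>1[0, y\<^sub>1, \<dots>, y\<^sub>K]^\<alpha>\<^sub>l\<close>. Under \<open>y \<mapsto> r y\<close> the summands are multiplied by the
  different factors \<open>r^(K \<alpha>\<^sub>l)\<close>, so they are linearly independent and the integral is positive
  (\<open>simplex_powers_independent\<close>). Therefore the limit is positive definite whenever \<open>\<tau>\<close> converges to some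
  \<open>c \<ge> 0\<close>: in the thermodynamic regime the exceptional set of \<open>c\<close> is empty.

  If \<open>\<tau> \<rightarrow> \<infinity>\<close>, the \<open>m\<close>-th term of each covariance is of order \<open>\<tau>^(1 - m)\<close>, so only \<open>m = 1\<close> survives. With
  one shared point \<open>x\<close>, the two integrated functions of \<open>x\<close> are constant as long as the ball of radius \<open>\<delta>\<close>
  around \<open>x\<close> stays in \<open>W\<close>. So the limit is \<open>v\<^sub>l v\<^sub>j\<close> with \<open>v\<^sub>l > 0\<close>, a matrix of rank one
  (\<open>covariance_dense\<close>).

  The points of \<open>W\<close> at distance less than \<open>\<delta>\<close> from the boundary are negligible because \<open>W\<close> is convex
  (\<open>erosion_volume_tendsto\<close>). All integrals are finite because the functionals are square
  integrable, and this passes from the finite-\<open>t\<close> integrals to the scaling limits. Measurability and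
  the scaling of simplex volumes come from their description by Gram determinants
  (\<open>kvolume_simplex\<close>).
\<close>

section \<open>Positive definite matrices and outer products\<close>

lemma rank_pos_def:
  fixes A :: "real^'n^'n"
  assumes "\<And>a. a \<noteq> 0 \<Longrightarrow> a \<bullet> (A *v a) > 0"
  shows "rank A = CARD('n)"
proof -
  have "inj ((*v) A)"
    unfolding linear_injective_0[OF matrix_vector_mul_linear]
    using assms by (metis inner_zero_right less_irrefl)
  then show ?thesis by (simp add: full_rank_injective)
qed

lemma rank_outer_product:
  fixes v :: "real^'n"
  assumes A: "\<And>i j. A $ i $ j = v $ i * v $ j" and v: "v \<noteq> 0"
  shows "rank A = 1"
proof -
  have mul: "A *v x = (v \<bullet> x) *\<^sub>R v" for x
    by (simp add: vec_eq_iff matrix_vector_mult_def A inner_vec_def sum_distrib_left sum_distrib_right mult_ac)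
  have "range ((*v) A) = span {v}"
  proof
    show "range ((*v) A) \<subseteq> span {v}" unfolding mul by (auto simp: span_singleton)
    show "span {v} \<subseteq> range ((*v) A)"
    proof
      fix y assume "y \<in> span {v}"
      then obtain c where "y = c *\<^sub>R v" by (auto simp: span_singleton)
      then have "y = A *v ((c / (v \<bullet> v)) *\<^sub>R v)" using v by (simp add: mul)
      then show "y \<in> range ((*v) A)" by blast
    qed
  qed
  moreover have "dim (span {v}) = 1" using v by (simp add: dim_span)
  ultimately show ?thesis by (simp add: rank_dim_range)
qed

section \<open>The volume of a simplex as a Gram determinant\<close>

lemma convex_hull_simplex_eq:
  fixes x :: "nat \<Rightarrow> 'a::real_vector"
  shows "convex hull (x ` {..k}) =
    {x 0 + (\<Sum>j<k. u j *\<^sub>R (x (Suc j) - x 0)) | u. (\<forall>j<k. 0 \<le> u j) \<and> (\<Sum>j<k. u j) \<le> 1}" (is "_ = ?R")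
proof
  show "convex hull (x ` {..k}) \<subseteq> ?R"
  proof (rule hull_minimal)
    show "x ` {..k} \<subseteq> ?R"
    proof safe
      fix i assume i: "i \<le> k"
      show "\<exists>u. x i = x 0 + (\<Sum>j<k. u j *\<^sub>R (x (Suc j) - x 0)) \<and> (\<forall>j<k. 0 \<le> u j) \<and> (\<Sum>j<k. u j) \<le> 1"
      proof (cases i)
        case 0
        then show ?thesis by (intro exI[of _ "\<lambda>_. 0"]) auto
      next
        case (Suc l)
        then have l: "l < k" using i by auto
        have "(\<Sum>j<k. (if j = l then 1 else 0) *\<^sub>R (x (Suc j) - x 0)) = x (Suc l) - x 0"
          using l by (simp add: if_distrib[where f="\<lambda>c. c *\<^sub>R _"] sum.delta cong: if_cong)
        then show ?thesis using l Suc
          by (intro exI[of _ "\<lambda>j. if j = l then 1 else 0"]) (auto simp: sum.delta)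
      qed
    qed
    show "convex ?R"
    proof (rule convexI, clarsimp)
      fix a b :: real and u v :: "nat \<Rightarrow> real"
      assume ab: "0 \<le> a" "0 \<le> b" "a + b = 1" and u: "\<forall>j<k. 0 \<le> u j" "(\<Sum>j<k. u j) \<le> 1"
        and v: "\<forall>j<k. 0 \<le> v j" "(\<Sum>j<k. v j) \<le> 1"
      let ?w = "\<lambda>j. a * u j + b * v j"
      have "a *\<^sub>R (x 0 + (\<Sum>j<k. u j *\<^sub>R (x (Suc j) - x 0))) + b *\<^sub>R (x 0 + (\<Sum>j<k. v j *\<^sub>R (x (Suc j) - x 0)))
         = (a + b) *\<^sub>R x 0 + (\<Sum>j<k. ?w j *\<^sub>R (x (Suc j) - x 0))"
        by (simp add: scaleR_add_right scaleR_add_left scaleR_sum_right sum.distrib)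
      moreover have "(\<Sum>j<k. ?w j) \<le> 1"
      proof -
        have "(\<Sum>j<k. ?w j) = a * (\<Sum>j<k. u j) + b * (\<Sum>j<k. v j)"
          by (simp add: sum.distrib sum_distrib_left)
        also have "\<dots> \<le> a * 1 + b * 1"
          using ab u v by (intro add_mono mult_left_mono) auto
        finally show ?thesis using ab by simp
      qed
      ultimately show "\<exists>w. a *\<^sub>R (x 0 + (\<Sum>j<k. u j *\<^sub>R (x (Suc j) - x 0))) + b *\<^sub>R (x 0 + (\<Sum>j<k. v j *\<^sub>R (x (Suc j) - x 0))) = x 0 + (\<Sum>j<k. w j *\<^sub>R (x (Suc j) - x 0)) \<and> (\<forall>j<k. 0 \<le> w j) \<and> (\<Sum>j<k. w j) \<le> 1"
        using ab u v by (intro exI[of _ ?w]) auto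
    qed
  qed
  show "?R \<subseteq> convex hull (x ` {..k})"
  proof safe
    fix u :: "nat \<Rightarrow> real" assume u: "\<forall>j<k. 0 \<le> u j" "(\<Sum>j<k. u j) \<le> 1"
    let ?w = "\<lambda>j. if j = 0 then 1 - (\<Sum>j<k. u j) else u (j - 1)"
    have split: "{..k} = insert 0 (Suc ` {..<k})"
      by (auto simp: image_iff) (metis Suc_le_eq not0_implies_Suc lessThan_iff)
    have "(\<Sum>j\<in>{..k}. ?w j *\<^sub>R x j) \<in> convex hull (x ` {..k})"
      by (rule convex_sum)
        (use u in \<open>auto simp: split sum.insert sum.reindex intro!: hull_inc\<close>)
    also have "(\<Sum>j\<in>{..k}. ?w j *\<^sub>R x j) = x 0 + (\<Sum>j<k. u j *\<^sub>R (x (Suc j) - x 0))"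
      by (simp add: split sum.insert sum.reindex scaleR_diff_left scaleR_diff_right sum_subtractf scaleR_sum_left)
    finally show "x 0 + (\<Sum>j<k. u j *\<^sub>R (x (Suc j) - x 0)) \<in> convex hull (x ` {..k})" .
  qed
qed

text \<open>
  The differences of \<open>k + 1\<close> points span a space of dimension at most \<open>k\<close>. It lies in a space of
  dimension exactly \<open>k\<close>, also when the points are affinely dependent, and an orthonormal basis of the
  latter gives the coordinates.
\<close>

lemma orthonormal_coords_exists:
  fixes x :: "nat \<Rightarrow> real^'d"
  assumes k: "k \<le> CARD('d)"
  shows "\<exists>q. orthonormal_coords k (convex hull (x ` {..k})) q"
proof -
  let ?D = "(\<lambda>j. x (Suc j) - x 0) ` {..<k}"
  have dD: "dim ?D \<le> k"
    using dim_le_card[of ?D ?D] card_image_le[of "{..<k}" "\<lambda>j. x (Suc j) - x 0"] by (simp add: span_superset)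
  obtain B where B: "B \<subseteq> ?D" "independent B" "?D \<subseteq> span B" "card B = dim ?D"
    using basis_exists[of ?D] by blast
  obtain C where C: "B \<subseteq> C" "independent C" "span C = UNIV"
    using maximal_independent_subset_extend[OF subset_UNIV B(2)] by (metis top.extremum_uniqueI)
  have cC: "card C = CARD('d)"
    using dim_eq_card[of C UNIV] C dim_UNIV[where 'a="real^'d"] by simp
  have "finite C" using C(2) independent_imp_finite by blast
  obtain C' where C': "B \<subseteq> C'" "C' \<subseteq> C" "card C' = k"
    using exists_subset_between[of B k C] B(4) dD k cC C(1) \<open>finite C\<close> by auto
  let ?T = "span C'"
  have dT: "dim ?T = k" using C'(3) dim_span_eq_card_independent[OF independent_mono[OF C(2) C'(2)]] by simp
  obtain E where E: "E \<subseteq> ?T" "pairwise orthogonal E" "\<And>b. b \<in> E \<Longrightarrow> norm b = 1" "independent E"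
     "card E = k" "span E = ?T"
    using orthonormal_basis_subspace[OF subspace_span, of C'] unfolding dT by blast
  have "finite E" using E(4) independent_imp_finite by blast
  then obtain e where e: "bij_betw e {..<k} E"
    using ex_bij_betw_nat_finite[of E] E(5) by (auto simp: atLeast0LessThan)
  have ortho: "e i \<bullet> e j = (if i = j then 1 else 0)" if "i < k" "j < k" for i j
  proof (cases "i = j")
    case True
    then show ?thesis using that e E(3) by (auto simp: bij_betw_def dot_square_norm)
  next
    case False
    then have "e i \<noteq> e j" "e i \<in> E" "e j \<in> E" using that e by (auto simp: bij_betw_def inj_on_def)
    then show ?thesis using E(2) False by (auto simp: pairwise_def orthogonal_def)
  qed
  have "\<exists>c. y = x 0 + (\<Sum>i<k. c i *\<^sub>R e i)" if "y \<in> convex hull (x ` {..k})" for y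
  proof -
    obtain u where u: "y = x 0 + (\<Sum>j<k. u j *\<^sub>R (x (Suc j) - x 0))"
      using \<open>y \<in> _\<close> unfolding convex_hull_simplex_eq by auto
    have "y - x 0 \<in> ?T"
    proof -
      have "x (Suc j) - x 0 \<in> ?T" if "j < k" for j
        using that B(3) span_mono[OF C'(1)] by auto
      then show ?thesis unfolding u by (auto intro!: span_sum span_scale)
    qed
    then have "y - x 0 \<in> span E" using E(6) by simp
    then obtain w where w: "y - x 0 = (\<Sum>v\<in>E. w v *\<^sub>R v)"
      using span_finite[OF \<open>finite E\<close>] by auto
    also have "\<dots> = (\<Sum>i<k. w (e i) *\<^sub>R e i)"
      using sum.reindex_bij_betw[OF e, of "\<lambda>v. w v *\<^sub>R v"] by simp
    finally show ?thesis by (intro exI[of _ "\<lambda>i. w (e i)"]) (simp add: algebra_simps)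
  qed
  then have "orthonormal_coords k (convex hull (x ` {..k})) (x 0, e)"
    using ortho by (auto simp: orthonormal_coords_def)
  then show ?thesis by blast
qed

text \<open>
  A numbering of the coordinates by \<open>0, 1, \<dots>\<close>. It lets a fixed matrix type hold \<open>k \<times> k\<close> data for every
  \<open>k \<le> CARD('e)\<close>.
\<close>

definition coord_index :: "'e::finite \<Rightarrow> nat" where
  "coord_index = (SOME f. bij_betw f UNIV {..<CARD('e)})"

lemma bij_coord_index: "bij_betw (coord_index :: 'e::finite \<Rightarrow> nat) UNIV {..<CARD('e)}"
proof -
  have "\<exists>f :: 'e \<Rightarrow> nat. bij_betw f UNIV {..<CARD('e)}"
    using ex_bij_betw_finite_nat[of "UNIV :: 'e set"] by (simp add: atLeast0LessThan)
  then show ?thesis unfolding coord_index_def by (rule someI_ex)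
qed

lemma sum_coord_index:
  assumes "k \<le> CARD('e)"
  shows "(\<Sum>i\<in>(UNIV::'e::finite set). if coord_index i < k then f (coord_index i) else 0) = (\<Sum>i<k. f i)"
proof -
  have "(\<Sum>i<k. f i) = (\<Sum>i<CARD('e). if i < k then f i else 0)"
    using assms by (intro sum.mono_neutral_cong_left) auto
  also have "\<dots> = (\<Sum>i\<in>(UNIV::'e set). if coord_index i < k then f (coord_index i) else 0)"
    using sum.reindex_bij_betw[OF bij_coord_index[where 'e='e], of "\<lambda>i. if i < k then f i else 0"] by simp
  finally show ?thesis by simp
qed

lemma prod_coord_index:
  assumes "k \<le> CARD('e)"
  shows "(\<Prod>i\<in>(UNIV::'e::finite set). if coord_index i < k then f (coord_index i) else 1) = (\<Prod>i<k. f i)"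
proof -
  have "(\<Prod>i<k. f i) = (\<Prod>i<CARD('e). if i < k then f i else 1)"
    using assms by (intro prod.mono_neutral_cong_left) auto
  also have "\<dots> = (\<Prod>i\<in>(UNIV::'e set). if coord_index i < k then f (coord_index i) else 1)"
    using prod.reindex_bij_betw[OF bij_coord_index[where 'e='e], of "\<lambda>i. if i < k then f i else 1"] by simp
  finally show ?thesis by simp
qed

lemma emeasure_lborel_vec_box:
  fixes A :: "'e::finite \<Rightarrow> real set"
  assumes [measurable]: "\<And>i. A i \<in> sets borel"
  shows "emeasure lborel {v::real^'e. \<forall>i. v $ i \<in> A i} = (\<Prod>i\<in>UNIV. emeasure lborel (A i))"
proof -
  have Basis: "(Basis :: (real^'e) set) = (\<lambda>i. axis i 1) ` UNIV"
    by (auto simp: Basis_vec_def)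
  have inj: "inj (\<lambda>i. axis i (1::real) :: real^'e)" by (auto simp: inj_on_def axis_eq_axis)
  let ?f = "\<lambda>b x. indicator (A (THE i. b = axis i (1::real))) x :: ennreal"
  have the: "(THE j. axis i (1::real) = (axis j 1 :: real^'e)) = i" for i
    by (auto simp: axis_eq_axis)
  have "emeasure lborel {v::real^'e. \<forall>i. v $ i \<in> A i} = (\<integral>\<^sup>+v. indicator {v::real^'e. \<forall>i. v $ i \<in> A i} v \<partial>lborel)"
    by (subst nn_integral_indicator) (auto)
  also have "\<dots> = (\<integral>\<^sup>+v. (\<Prod>b\<in>Basis. ?f b (v \<bullet> b)) \<partial>lborel)"
    by (intro nn_integral_cong, simp add: Basis prod.reindex[OF inj] the inner_axis)
       (auto simp: indicator_def prod_zero_iff)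
  also have "\<dots> = (\<Prod>b\<in>Basis. \<integral>\<^sup>+x. ?f b x \<partial>lborel)"
    by (rule nn_integral_lborel_prod) auto
  also have "\<dots> = (\<Prod>i\<in>UNIV. emeasure lborel (A i))"
    by (simp add: Basis prod.reindex[OF inj] the)
  finally show ?thesis .
qed

abbreviation coord_of :: "nat \<Rightarrow> 'e::finite" where
  "coord_of \<equiv> inv_into UNIV coord_index"

lemma coord_of_index [simp]: "coord_of (coord_index i) = i"
  by (rule inv_into_f_f[OF bij_betw_imp_inj_on[OF bij_coord_index] UNIV_I])

lemma index_coord_of: "i < CARD('e) \<Longrightarrow> coord_index (coord_of i :: 'e::finite) = i"
  by (rule f_inv_into_f) (simp add: bij_betw_imp_surj_on[OF bij_coord_index])

text \<open>
  The product measure on \<open>k\<close> coordinates is Lebesgue measure on \<open>real^'e\<close> after multiplying by the unit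
  cube in the remaining coordinates. This moves the \<open>k\<close>-dimensional volume to a Euclidean space, where
  linear maps scale volume by their determinant.
\<close>

lemma emeasure_PiM_eq_prism:
  fixes C :: "(nat \<Rightarrow> real) set"
  assumes k: "k \<le> CARD('e::finite)" and C[measurable]: "C \<in> sets (\<Pi>\<^sub>M i\<in>{..<k}. lborel)"
  shows "emeasure (\<Pi>\<^sub>M i\<in>{..<k}. lborel) C =
    emeasure lborel {v::real^'e. (\<lambda>i\<in>{..<k}. v $ coord_of i) \<in> C \<and> (\<forall>i. k \<le> coord_index i \<longrightarrow> v $ i \<in> {0..1})}"
proof -
  interpret product_sigma_finite "\<lambda>_::nat. lborel :: real measure" by standard
  let ?P = "\<Pi>\<^sub>M i\<in>{..<k}. lborel :: real measure"
  let ?g = "\<lambda>v::real^'e. \<lambda>i\<in>{..<k}. v $ coord_of i"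
  let ?Q = "{v::real^'e. \<forall>i. k \<le> coord_index i \<longrightarrow> v $ i \<in> {0..1}}"
  have Q[measurable]: "?Q \<in> sets lborel" by measurable
  have g[measurable]: "?g \<in> measurable lborel ?P"
    by (rule measurable_restrict) simp
  let ?N = "distr (density lborel (indicator ?Q)) ?P ?g"
  have N: "emeasure ?N X = emeasure lborel {v. ?g v \<in> X \<and> v \<in> ?Q}" if X[measurable]: "X \<in> sets ?P" for X
  proof -
    have gX: "{v. ?g v \<in> X} \<in> sets borel"
      using measurable_sets[OF g X] by (simp add: vimage_def)
    have "emeasure ?N X = emeasure (density lborel (indicator ?Q)) {v. ?g v \<in> X}"
      by (subst emeasure_distr) (use X g in \<open>auto simp: vimage_def\<close>)
    also have "\<dots> = (\<integral>\<^sup>+v. indicator ?Q v * indicator {v. ?g v \<in> X} v \<partial>lborel)"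
      by (rule emeasure_density) (use Q gX in auto)
    also have "\<dots> = (\<integral>\<^sup>+v. indicator ({v. ?g v \<in> X} \<inter> ?Q) v \<partial>lborel)"
      by (intro nn_integral_cong) (auto simp: indicator_def)
    also have "\<dots> = emeasure lborel ({v. ?g v \<in> X} \<inter> ?Q)"
      by (rule nn_integral_indicator) (use Q gX in auto)
    also have "{v. ?g v \<in> X} \<inter> ?Q = {v. ?g v \<in> X \<and> v \<in> ?Q}" by auto
    finally show ?thesis .
  qed
  have "?N = ?P"
  proof (rule PiM_eqI)
    fix A :: "nat \<Rightarrow> real set" assume A: "\<And>i. i \<in> {..<k} \<Longrightarrow> A i \<in> sets lborel"
    have "emeasure ?N (Pi\<^sub>E {..<k} A) = emeasure lborel {v. ?g v \<in> Pi\<^sub>E {..<k} A \<and> v \<in> ?Q}"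
      by (rule N) (use A in auto)
    also have "{v. ?g v \<in> Pi\<^sub>E {..<k} A \<and> v \<in> ?Q} =
      {v. \<forall>i. v $ i \<in> (if coord_index i < k then A (coord_index i) else {0..1})}"
    proof (intro set_eqI iffI)
      fix v assume "v \<in> {v. ?g v \<in> Pi\<^sub>E {..<k} A \<and> v \<in> ?Q}"
      then have a: "\<And>i. i < k \<Longrightarrow> v $ coord_of i \<in> A i" and b: "\<And>i. k \<le> coord_index i \<Longrightarrow> v $ i \<in> {0..1}" by (auto simp: PiE_iff)
      show "v \<in> {v. \<forall>i. v $ i \<in> (if coord_index i < k then A (coord_index i) else {0..1})}"
        using a[of "coord_index (_ :: 'e)"] b by (auto simp: not_less)
    next
      fix v assume v: "v \<in> {v::real^'e. \<forall>i. v $ i \<in> (if coord_index i < k then A (coord_index i) else {0..1})}"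
      then have "v $ coord_of i \<in> A i" if "i < k" for i
        using that k index_coord_of[where 'e='e, of i] by (auto dest: spec[of _ "coord_of i"])
      moreover have "v $ i \<in> {0..1}" if "k \<le> coord_index i" for i
        using v that by (auto dest: spec[of _ i])
      ultimately show "v \<in> {v. ?g v \<in> Pi\<^sub>E {..<k} A \<and> v \<in> ?Q}" by (auto simp: PiE_iff)
    qed
    also have "emeasure lborel \<dots> = (\<Prod>i\<in>(UNIV::'e set). emeasure lborel (if coord_index i < k then A (coord_index i) else {0..1}))"
      by (rule emeasure_lborel_vec_box) (use A in auto)
    also have "\<dots> = (\<Prod>i\<in>(UNIV::'e set). if coord_index i < k then emeasure lborel (A (coord_index i)) else 1)"
      by (intro prod.cong) auto
    also have "\<dots> = (\<Prod>i<k. emeasure lborel (A i))"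
      by (rule prod_coord_index[OF k])
    finally show "emeasure ?N (Pi\<^sub>E {..<k} A) = (\<Prod>i<k. emeasure lborel (A i))" .
  qed auto
  then show ?thesis using N[OF C] by simp
qed

text \<open>
  The Gram matrix of the edge vectors \<open>x\<^sub>1 - x\<^sub>0, \<dots>, x\<^sub>k - x\<^sub>0\<close>, extended by an identity block that
  leaves the determinant unchanged.
\<close>

definition gram_matrix :: "nat \<Rightarrow> (nat \<Rightarrow> 'a::real_inner) \<Rightarrow> real^'e^'e" where
  "gram_matrix k x = (\<chi> i j. if coord_index i < k \<and> coord_index j < k
      then (x (Suc (coord_index i)) - x 0) \<bullet> (x (Suc (coord_index j)) - x 0)
      else if i = j then 1 else 0)"

text \<open>
  The product of the standard simplex in the first \<open>k\<close> coordinates and the unit cube in the others.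
\<close>

definition simplex_prism :: "nat \<Rightarrow> (real^'e) set" where
  "simplex_prism k = {u. (\<forall>i. 0 \<le> u $ i) \<and> (\<forall>i. k \<le> coord_index i \<longrightarrow> u $ i \<le> 1) \<and>
     (\<Sum>i\<in>UNIV. if coord_index i < k then u $ i else 0) \<le> 1}"

lemma simplex_prism_lmeasurable: "simplex_prism k \<in> lmeasurable"
proof (rule measurable_convex)
  show "convex (simplex_prism k :: (real^'e) set)"
  proof (rule convexI)
    fix u v :: "real^'e" and a b :: real
    assume uv: "u \<in> simplex_prism k" "v \<in> simplex_prism k" and ab: "0 \<le> a" "0 \<le> b" "a + b = 1"
    have "(\<Sum>i\<in>UNIV. if coord_index i < k then (a *\<^sub>R u + b *\<^sub>R v) $ i else 0) =
      a * (\<Sum>i\<in>UNIV. if coord_index i < k then u $ i else 0) + b * (\<Sum>i\<in>UNIV. if coord_index i < k then v $ i else 0)"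
      by (simp add: sum_distrib_left flip: sum.distrib) (intro sum.cong, auto)
    also have "\<dots> \<le> a * 1 + b * 1"
      using uv ab by (intro add_mono mult_left_mono) (auto simp: simplex_prism_def)
    finally show "a *\<^sub>R u + b *\<^sub>R v \<in> simplex_prism k"
      using uv ab unfolding simplex_prism_def by (auto intro: convex_bound_le)
  qed
  have "simplex_prism k \<subseteq> cbox 0 (1::real^'e)"
  proof
    fix u :: "real^'e" assume u: "u \<in> simplex_prism k"
    have "u $ i \<le> 1" for i
    proof (cases "coord_index i < k")
      case True
      have "(if coord_index i < k then u $ i else 0) \<le> (\<Sum>i\<in>UNIV. if coord_index i < k then u $ i else 0)"
        by (rule member_le_sum) (use u in \<open>auto simp: simplex_prism_def\<close>)
      then show ?thesis using u True by (auto simp: simplex_prism_def)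
    qed (use u in \<open>auto simp: simplex_prism_def\<close>)
    then show "u \<in> cbox 0 1" using u by (auto simp: mem_box_cart simplex_prism_def)
  qed
  then show "bounded (simplex_prism k :: (real^'e) set)" using bounded_cbox bounded_subset by blast
qed

lemma simplex_prism_measure_pos: "measure lebesgue (simplex_prism k :: (real^'e) set) > 0"
proof -
  let ?c = "1 / real CARD('e)"
  have sub: "box 0 (\<chi> i. ?c) \<subseteq> (simplex_prism k :: (real^'e) set)"
  proof
    fix u :: "real^'e" assume "u \<in> box 0 (\<chi> i. ?c)"
    then have u: "0 < u $ i" "u $ i < ?c" for i by (auto simp: mem_box_cart)
    have "u $ i \<le> 1" for i
  proof -
    have "?c \<le> 1" by (simp add: Suc_leI)
    then show ?thesis using u(2)[of i] by linarith
  qed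
    moreover have "(\<Sum>i\<in>UNIV. if coord_index i < k then u $ i else 0) \<le> (\<Sum>i\<in>(UNIV::'e set). ?c)"
      by (intro sum_mono) (use u in \<open>auto intro: less_imp_le\<close>)
    ultimately show "u \<in> simplex_prism k" using u by (auto simp: simplex_prism_def less_imp_le)
  qed
  have "0 < measure lebesgue (box 0 (\<chi> i. ?c) :: (real^'e) set)"
    by (subst measure_completion) (auto simp: measure_lborel_box_eq Basis_vec_def inner_axis intro!: prod_pos)
  also have "\<dots> \<le> measure lebesgue (simplex_prism k :: (real^'e) set)"
    by (rule measure_mono_fmeasurable[OF sub]) (auto simp: simplex_prism_lmeasurable)
  finally show ?thesis .
qed

lemma inner_orthonormal_sums:
  fixes e :: "nat \<Rightarrow> 'a::real_inner"
  assumes "\<And>i j. i < k \<Longrightarrow> j < k \<Longrightarrow> e i \<bullet> e j = (if i = j then 1 else 0)"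
  shows "(\<Sum>i<k. a i *\<^sub>R e i) \<bullet> (\<Sum>i<k. b i *\<^sub>R e i) = (\<Sum>i<k. a i * b i)"
proof -
  have "(\<Sum>i<k. a i *\<^sub>R e i) \<bullet> (\<Sum>i<k. b i *\<^sub>R e i) = (\<Sum>i<k. \<Sum>j<k. a i * b j * (e i \<bullet> e j))"
    by (simp only: inner_sum_left) (intro sum.cong refl, simp add: inner_sum_right mult_ac)
  also have "\<dots> = (\<Sum>i<k. \<Sum>j<k. if i = j then a i * b j else 0)"
    by (intro sum.cong refl) (auto simp: assms)
  also have "\<dots> = (\<Sum>i<k. a i * b i)"
    by (intro sum.cong refl) (simp add: sum.delta)
  finally show ?thesis .
qed

text \<open>
  In orthonormal coordinates the prism over the simplex is the image of the standard prism under an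
  affine map. The linear part has the edge vectors as its first \<open>k\<close> columns and unit vectors as
  the others, so its product with its transpose is the Gram matrix of the edges. The formula holds for
  every choice of coordinates, and for degenerate simplices as well.
\<close>

lemma measure_PiM_simplex:
  fixes x :: "nat \<Rightarrow> real^'d"
  assumes k: "k \<le> CARD('e::{finite,wellorder})"
    and q: "orthonormal_coords k (convex hull (x ` {..k})) (p, e)"
  shows "measure (\<Pi>\<^sub>M i\<in>{..<k}. lborel)
       {c \<in> space (\<Pi>\<^sub>M i\<in>{..<k}. lborel). p + (\<Sum>i<k. c i *\<^sub>R e i) \<in> convex hull (x ` {..k})}
     = sqrt (det (gram_matrix k x :: ((real,'e) vec,'e) vec)) * measure lebesgue (simplex_prism k :: (real,'e) vec set)"
proof -
  let ?P = "\<Pi>\<^sub>M i\<in>{..<k}. lborel :: real measure"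
  let ?H = "convex hull (x ` {..k})"
  have ortho: "e i \<bullet> e j = (if i = j then 1 else 0)" if "i < k" "j < k" for i j
    using q that by (auto simp: orthonormal_coords_def)
  have inj: "a i = b i" if "(\<Sum>i<k. a i *\<^sub>R e i) = (\<Sum>i<k. b i *\<^sub>R e i)" "i < k" for a b i
  proof -
    have "(\<Sum>j<k. g j *\<^sub>R e j) \<bullet> e i = g i" for g
    proof -
      have "(\<Sum>j<k. g j *\<^sub>R e j) \<bullet> e i = (\<Sum>j<k. if j = i then g j else 0)"
        unfolding inner_sum_left using \<open>i < k\<close> by (intro sum.cong) (auto simp: ortho)
      then show ?thesis using \<open>i < k\<close> by simp
    qed
    then show ?thesis using that(1) by metis
  qed
  have "\<forall>j\<in>{..k}. \<exists>c. x j = p + (\<Sum>i<k. c i *\<^sub>R e i)"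
    using q by (auto simp: orthonormal_coords_def hull_inc)
  from bchoice[OF this] obtain cc where cc: "\<And>j. j \<le> k \<Longrightarrow> x j = p + (\<Sum>i<k. cc j i *\<^sub>R e i)"
    by auto
  let ?C = "{c \<in> space ?P. p + (\<Sum>i<k. c i *\<^sub>R e i) \<in> ?H}"
  have "?H \<in> sets borel" by (intro borel_compact finite_imp_compact_convex_hull) auto
  then have C: "?C \<in> sets ?P" by measurable
  \<comment> \<open>The vertex \<open>x\<^sub>0\<close>, the edges \<open>d\<close> and the edge matrix \<open>A\<close> in the coordinates \<open>e\<close>.\<close>
  define b :: "(real,'e) vec" where "b = (\<chi> i. if coord_index i < k then cc 0 (coord_index i) else 0)"
  define d where "d j i = cc (Suc j) i - cc 0 i" for j i
  define A :: "((real,'e) vec,'e) vec" where "A = (\<chi> i j. if coord_index j < k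
      then (if coord_index i < k then d (coord_index j) (coord_index i) else 0) else if i = j then 1 else 0)"
  have xd: "x (Suc j) - x 0 = (\<Sum>i<k. d j i *\<^sub>R e i)" if "j < k" for j
    using cc[of 0] cc[of "Suc j"] that by (simp add: d_def scaleR_diff_left sum_subtractf)
  \<comment> \<open>The prism over the simplex.\<close>
  let ?S = "{v::(real,'e) vec. (\<lambda>i\<in>{..<k}. v $ coord_of i) \<in> ?C \<and> (\<forall>i. k \<le> coord_index i \<longrightarrow> v $ i \<in> {0..1})}"
  have Au: "(A *v u) $ i = (if coord_index i < k then (\<Sum>j\<in>UNIV. if coord_index j < k then u $ j * d (coord_index j) (coord_index i) else 0) else u $ i)" for u i
  proof (cases "coord_index i < k")
    case True
    then show ?thesis unfolding A_def matrix_vector_mult_def by (auto intro!: sum.cong)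
  next
    case False
    have "(A *v u) $ i = (\<Sum>j\<in>UNIV. if i = j then u $ j else 0)"
      unfolding A_def matrix_vector_mult_def vec_lambda_beta by (intro sum.cong refl) (use False in auto)
    then show ?thesis using False by simp
  qed
  have S: "?S = (+) b ` (*v) A ` simplex_prism k"
  proof (intro set_eqI iffI)
    fix v assume v: "v \<in> ?S"
    let ?w = "\<lambda>i. v $ coord_of i"
    have "p + (\<Sum>i<k. ?w i *\<^sub>R e i) \<in> ?H" using v by simp
    then obtain u where u: "p + (\<Sum>i<k. ?w i *\<^sub>R e i) = x 0 + (\<Sum>j<k. u j *\<^sub>R (x (Suc j) - x 0))"
      "\<forall>j<k. 0 \<le> u j" "(\<Sum>j<k. u j) \<le> 1"
      unfolding convex_hull_simplex_eq by auto
    have "(\<Sum>j<k. u j *\<^sub>R (x (Suc j) - x 0)) = (\<Sum>j<k. \<Sum>i<k. (u j * d j i) *\<^sub>R e i)"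
      by (simp add: xd scaleR_sum_right)
    also have "\<dots> = (\<Sum>i<k. (\<Sum>j<k. u j * d j i) *\<^sub>R e i)"
      by (subst sum.swap) (simp add: scaleR_sum_left)
    finally have eqw: "(\<Sum>i<k. ?w i *\<^sub>R e i) = (\<Sum>i<k. (cc 0 i + (\<Sum>j<k. u j * d j i)) *\<^sub>R e i)"
      using u(1) cc[of 0] by (simp add: scaleR_add_left sum.distrib)
    have w: "?w i = cc 0 i + (\<Sum>j<k. u j * d j i)" if "i < k" for i
      by (rule inj[of ?w "\<lambda>i. cc 0 i + (\<Sum>j<k. u j * d j i)", OF eqw that])
    define y :: "(real,'e) vec" where "y = (\<chi> i. if coord_index i < k then u (coord_index i) else v $ i)"
    have "y \<in> simplex_prism k"
      using u(2,3) v sum_coord_index[OF k, of u] by (auto simp: simplex_prism_def y_def not_less cong: if_cong)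
    moreover have "v = b + A *v y"
    proof (rule vec_eq_iff[THEN iffD2], rule allI)
      fix i
      show "v $ i = (b + A *v y) $ i"
      proof (cases "coord_index i < k")
        case True
        have "v $ i = cc 0 (coord_index i) + (\<Sum>j<k. u j * d j (coord_index i))"
          using w[OF True] by simp
        also have "(\<Sum>j<k. u j * d j (coord_index i)) = (\<Sum>j\<in>(UNIV::'e set). if coord_index j < k then u (coord_index j) * d (coord_index j) (coord_index i) else 0)"
          by (rule sum_coord_index[OF k, symmetric])
        finally show ?thesis using True by (simp add: Au b_def y_def cong: if_cong)
      qed (simp add: Au b_def y_def)
    qed
    ultimately show "v \<in> (+) b ` (*v) A ` simplex_prism k" by blast
  next
    fix v assume "v \<in> (+) b ` (*v) A ` simplex_prism k"
    then obtain y where y: "y \<in> simplex_prism k" "v = b + A *v y" by blast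
    define u where "u j = y $ coord_of j" for j
    have yu: "y $ j = u (coord_index j)" for j by (simp add: u_def)
    have vi: "v $ coord_of i = cc 0 i + (\<Sum>j<k. u j * d j i)" if "i < k" for i
    proof -
      have ci: "coord_index (coord_of i :: 'e) = i" using that k by (intro index_coord_of) simp
      have "v $ coord_of i = cc 0 i + (\<Sum>j\<in>(UNIV::'e set). if coord_index j < k then u (coord_index j) * d (coord_index j) i else 0)"
        using that by (simp add: y(2) Au ci b_def yu cong: if_cong)
      also have "(\<Sum>j\<in>(UNIV::'e set). if coord_index j < k then u (coord_index j) * d (coord_index j) i else 0) = (\<Sum>j<k. u j * d j i)"
        by (rule sum_coord_index[OF k])
      finally show ?thesis .
    qed
    have "p + (\<Sum>i<k. v $ coord_of i *\<^sub>R e i) = p + (\<Sum>i<k. cc 0 i *\<^sub>R e i) + (\<Sum>i<k. \<Sum>j<k. (u j * d j i) *\<^sub>R e i)"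
      by (simp add: vi scaleR_add_left sum.distrib scaleR_sum_left)
    also have "(\<Sum>i<k. \<Sum>j<k. (u j * d j i) *\<^sub>R e i) = (\<Sum>j<k. u j *\<^sub>R (x (Suc j) - x 0))"
      by (subst sum.swap) (simp add: xd scaleR_sum_right)
    also have "p + (\<Sum>i<k. cc 0 i *\<^sub>R e i) = x 0" using cc[of 0] by simp
    also have "x 0 + (\<Sum>j<k. u j *\<^sub>R (x (Suc j) - x 0)) \<in> ?H"
    proof -
      have "\<forall>j<k. 0 \<le> u j" using y(1) by (auto simp: simplex_prism_def u_def)
      moreover have "(\<Sum>j<k. u j) \<le> 1"
        using y(1) sum_coord_index[OF k, of u] by (simp add: simplex_prism_def yu cong: if_cong)
      ultimately show ?thesis unfolding convex_hull_simplex_eq by blast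
    qed
    finally have "p + (\<Sum>i<k. v $ coord_of i *\<^sub>R e i) \<in> ?H" .
    moreover have "(\<Sum>i<k. (\<lambda>i\<in>{..<k}. v $ coord_of i) i *\<^sub>R e i) = (\<Sum>i<k. v $ coord_of i *\<^sub>R e i)"
      by (intro sum.cong refl) simp
    moreover have "(\<lambda>i\<in>{..<k}. v $ coord_of i) \<in> space ?P" by (simp add: space_PiM)
    ultimately have "(\<lambda>i\<in>{..<k}. v $ coord_of i) \<in> ?C" by (simp only: mem_Collect_eq simp_thms)
    moreover have "v $ i \<in> {0..1}" if "k \<le> coord_index i" for i
      using that y(1) by (simp add: y(2) Au b_def simplex_prism_def)
    ultimately show "v \<in> ?S" by blast
  qed
  have "emeasure ?P ?C = emeasure lborel ?S"
    by (rule emeasure_PiM_eq_prism[OF k C])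
  then have "measure ?P ?C = measure lborel ?S" by (simp add: measure_def)
  also have "\<dots> = measure lebesgue ?S"
  proof -
    have "(\<lambda>v::(real,'e) vec. \<lambda>i\<in>{..<k}. v $ coord_of i) \<in> measurable borel ?P"
      by (rule measurable_restrict) simp
    from measurable_sets[OF this C] have "{v::(real,'e) vec. (\<lambda>i\<in>{..<k}. v $ coord_of i) \<in> ?C} \<in> sets borel"
      by (simp add: vimage_def)
    moreover have "{v::(real,'e) vec. \<forall>i. k \<le> coord_index i \<longrightarrow> v $ i \<in> {0..1}} \<in> sets borel" by measurable
    ultimately have "{v::(real,'e) vec. (\<lambda>i\<in>{..<k}. v $ coord_of i) \<in> ?C} \<inter> {v. \<forall>i. k \<le> coord_index i \<longrightarrow> v $ i \<in> {0..1}} \<in> sets borel"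
      by (rule sets.Int)
    then show ?thesis by (subst measure_completion) (simp_all add: Collect_conj_eq Int_assoc)
  qed
  also have "\<dots> = measure lebesgue ((*v) A ` simplex_prism k)" unfolding S by (rule measure_translation)
  also have "\<dots> = \<bar>det A\<bar> * measure lebesgue (simplex_prism k :: (real,'e) vec set)"
    using measure_linear_image[OF matrix_vector_mul_linear simplex_prism_lmeasurable, of A] by simp
  also have "\<bar>det A\<bar> = sqrt (det (gram_matrix k x :: ((real,'e) vec,'e) vec))"
  proof -
    have "transpose A ** A = gram_matrix k x"
    proof (intro vec_eq_iff[THEN iffD2] allI)
      fix i j
      have e: "(transpose A ** A) $ i $ j = (\<Sum>l\<in>UNIV. A $ l $ i * A $ l $ j)"
        by (simp add: matrix_matrix_mult_def transpose_def)
      show "(transpose A ** A) $ i $ j = gram_matrix k x $ i $ j"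
      proof (cases "coord_index i < k \<and> coord_index j < k")
        case True
        have "(\<Sum>l\<in>UNIV. A $ l $ i * A $ l $ j) = (\<Sum>l\<in>(UNIV::'e set). if coord_index l < k then d (coord_index i) (coord_index l) * d (coord_index j) (coord_index l) else 0)"
          using True by (intro sum.cong) (auto simp: A_def)
        also have "\<dots> = (\<Sum>l<k. d (coord_index i) l * d (coord_index j) l)"
          by (rule sum_coord_index[OF k])
        also have "\<dots> = (x (Suc (coord_index i)) - x 0) \<bullet> (x (Suc (coord_index j)) - x 0)"
          using True by (simp add: xd inner_orthonormal_sums ortho)
        finally show ?thesis using True unfolding e by (simp add: gram_matrix_def)
      next
        case False
        have "(\<Sum>l\<in>UNIV. A $ l $ i * A $ l $ j) = (\<Sum>l\<in>UNIV. if l = i then (if i = j then 1 else 0) else 0)"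
          using False by (intro sum.cong) (auto simp: A_def)
        then show ?thesis using False unfolding e by (auto simp: gram_matrix_def)
      qed
    qed
    then have "det (gram_matrix k x :: ((real,'e) vec,'e) vec) = det A * det A"
      by (metis det_mul det_transpose)
    then show ?thesis by simp
  qed
  finally show ?thesis .
qed

text \<open>
  The index type only has to have at least \<open>k\<close> elements for all \<open>k \<le> CARD('d)\<close>. The type \<open>'d bit0\<close> has
  \<open>2 CARD('d)\<close> elements and, unlike \<open>'d\<close>, carries the well-order that the transformation
  formula for linear images requires.
\<close>

definition gram_det :: "nat \<Rightarrow> (nat \<Rightarrow> real^'d) \<Rightarrow> real" where
  "gram_det k x = det (gram_matrix k x :: ((real, 'd bit0) vec, 'd bit0) vec)"

text \<open>
  For \<open>k \<le> CARD('d)\<close> this is \<open>1 / k!\<close>.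
\<close>

definition simplex_const :: "'d::finite itself \<Rightarrow> nat \<Rightarrow> real" where
  "simplex_const _ k = measure lebesgue (simplex_prism k :: ((real, 'd bit0) vec) set)"

lemma kvolume_simplex:
  fixes x :: "nat \<Rightarrow> real^'d"
  assumes k: "k \<le> CARD('d)"
  shows "kvolume k (convex hull (x ` {..k})) = sqrt (gram_det k x) * simplex_const TYPE('d) k"
proof -
  let ?q = "SOME q. orthonormal_coords k (convex hull (x ` {..k})) q"
  obtain p e where pe: "?q = (p, e)" by (cases ?q)
  have "orthonormal_coords k (convex hull (x ` {..k})) ?q"
    by (rule someI_ex) (rule orthonormal_coords_exists[OF k])
  then have "orthonormal_coords k (convex hull (x ` {..k})) (p, e)" by (simp only: pe)
  from measure_PiM_simplex[OF _ this, where 'e="'d bit0"] k show ?thesis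
    unfolding kvolume_def pe gram_det_def simplex_const_def by simp
qed

section \<open>Powers of truncated simplex volumes\<close>

lemma prod_if_coord_index:
  assumes "k \<le> CARD('e)"
  shows "(\<Prod>i\<in>(UNIV::'e::finite set). if coord_index i < k then r else 1) = (r::real) ^ k"
  using prod_coord_index[OF assms, of "\<lambda>_. r"] by simp

text \<open>
  Translations do not change the edges; scaling by \<open>r\<close> multiplies the first \<open>k\<close> rows and the first \<open>k\<close>
  columns of the Gram matrix by \<open>r\<close>.
\<close>

lemma gram_det_affine:
  fixes x :: "nat \<Rightarrow> real^'d"
  assumes k: "k \<le> CARD('d)"
  shows "gram_det k (\<lambda>i. v + r *\<^sub>R x i) = (r ^ k)\<^sup>2 * gram_det k x"
proof -
  let ?c = "\<lambda>i::'d bit0. if coord_index i < k then r else 1"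
  let ?G = "gram_matrix k x :: ((real, 'd bit0) vec, 'd bit0) vec"
  have entry: "gram_matrix k (\<lambda>i. v + r *\<^sub>R x i) $ i $ j = ?c i * ?c j * ?G $ i $ j" for i j
    by (auto simp: gram_matrix_def scaleR_diff_right[symmetric])
  have c: "prod ?c UNIV = r ^ k" by (rule prod_if_coord_index) (use k in simp)
  have "gram_det k (\<lambda>i. v + r *\<^sub>R x i) =
    (\<Sum>p | p permutes UNIV. of_int (sign p) * (\<Prod>i\<in>UNIV. ?c i * ?c (p i) * ?G $ i $ p i))"
    by (simp only: gram_det_def det_def entry)
  also have "\<dots> = (\<Sum>p | p permutes UNIV. (r ^ k)\<^sup>2 * (of_int (sign p) * (\<Prod>i\<in>UNIV. ?G $ i $ p i)))"
  proof (intro sum.cong refl)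
    fix p :: "'d bit0 \<Rightarrow> 'd bit0" assume "p \<in> {p. p permutes UNIV}"
    then have "(\<Prod>i\<in>UNIV. ?c (p i)) = prod ?c UNIV"
      using prod.permute[of p UNIV ?c] by (simp add: o_def)
    then have "(\<Prod>i\<in>UNIV. ?c i * ?c (p i) * ?G $ i $ p i) = (r ^ k)\<^sup>2 * (\<Prod>i\<in>UNIV. ?G $ i $ p i)"
      by (simp only: prod.distrib c power2_eq_square)
    then show "of_int (sign p) * (\<Prod>i\<in>UNIV. ?c i * ?c (p i) * ?G $ i $ p i) = (r ^ k)\<^sup>2 * (of_int (sign p) * (\<Prod>i\<in>UNIV. ?G $ i $ p i))"
      by simp
  qed
  also have "\<dots> = (r ^ k)\<^sup>2 * gram_det k x"
    by (simp only: gram_det_def det_def sum_distrib_left)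
  finally show ?thesis .
qed

lemma gram_matrix_nth_measurable:
  assumes "{..k} \<subseteq> I"
  shows "(\<lambda>x. gram_matrix k x $ i $ j) \<in> borel_measurable (\<Pi>\<^sub>M i\<in>I. (borel :: (real^'d) measure))"
proof (cases "coord_index i < k \<and> coord_index j < k")
  case True
  then have I: "Suc (coord_index i) \<in> I" "Suc (coord_index j) \<in> I" "0 \<in> I" using assms by auto
  have "(\<lambda>x. (x (Suc (coord_index i)) - x 0) \<bullet> (x (Suc (coord_index j)) - x 0)) \<in> borel_measurable (\<Pi>\<^sub>M i\<in>I. (borel :: (real^'d) measure))"
    using I by measurable
  then show ?thesis using True by (simp add: gram_matrix_def)
qed (auto simp: gram_matrix_def)

lemma gram_det_measurable:
  assumes "{..k} \<subseteq> I"
  shows "gram_det k \<in> borel_measurable (\<Pi>\<^sub>M i\<in>I. (borel :: (real^'d) measure))"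
proof -
  note [measurable] = gram_matrix_nth_measurable[OF assms]
  show ?thesis unfolding gram_det_def det_def by measurable
qed

definition simplex_volume :: "nat \<Rightarrow> (nat \<Rightarrow> real^'d) \<Rightarrow> real" where
  "simplex_volume k x = sqrt (gram_det k x) * simplex_const TYPE('d) k"

definition small_diameter :: "real \<Rightarrow> nat \<Rightarrow> (nat \<Rightarrow> 'a::real_normed_vector) \<Rightarrow> bool" where
  "small_diameter s k x \<longleftrightarrow> (\<forall>i\<le>k. \<forall>j\<le>k. norm (x i - x j) \<le> s)"

lemma simplex_power_alt:
  fixes x :: "nat \<Rightarrow> real^'d"
  assumes "k \<le> CARD('d) \<or> \<alpha> = 0"
  shows "simplex_power s k \<alpha> x =
    (if small_diameter s k x then (if \<alpha> = 0 then 1 else simplex_volume k x powr \<alpha>) else 0)"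
  using assms kvolume_simplex[of k x] by (auto simp: simplex_power_def small_diameter_def simplex_volume_def)

lemma simplex_power_nonneg: "0 \<le> simplex_power s k \<alpha> x"
  by (simp add: simplex_power_def)

lemma simplex_power_image_cong:
  fixes x y :: "nat \<Rightarrow> real^'d"
  assumes "x ` {..k} = y ` {..k}"
  shows "simplex_power s k \<alpha> x = simplex_power s k \<alpha> y"
proof -
  have "(\<forall>i\<le>k. \<forall>j\<le>k. norm (z i - z j) \<le> s) \<longleftrightarrow> (\<forall>a\<in>z ` {..k}. \<forall>b\<in>z ` {..k}. norm (a - b) \<le> s)" for z :: "nat \<Rightarrow> real^'d"
    by auto
  then show ?thesis unfolding simplex_power_def assms by (simp only: assms)
qed

lemma small_diameter_measurable:
  assumes "{..k} \<subseteq> I"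
  shows "Measurable.pred (\<Pi>\<^sub>M i\<in>I. (borel :: (real^'d) measure)) (small_diameter s k)"
proof -
  have [measurable]: "Measurable.pred (\<Pi>\<^sub>M i\<in>I. (borel :: (real^'d) measure)) (\<lambda>x. norm (x i - x j) \<le> s)" if "i \<in> {..k}" "j \<in> {..k}" for i j
  proof -
    have "i \<in> I" "j \<in> I" using that assms by auto
    then show ?thesis by measurable
  qed
  have "small_diameter s k = (\<lambda>x. \<forall>i\<in>{..k}. \<forall>j\<in>{..k}. norm (x i - x j :: real^'d) \<le> s)"
    by (auto simp: small_diameter_def fun_eq_iff)
  then show ?thesis by simp
qed

lemma simplex_power_measurable:
  assumes k: "k \<le> CARD('d) \<or> \<alpha> = 0" and I: "{..k} \<subseteq> I"
  shows "simplex_power s k \<alpha> \<in> borel_measurable (\<Pi>\<^sub>M i\<in>I. (borel :: (real^'d) measure))"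
proof -
  note [measurable] = small_diameter_measurable[OF I] gram_det_measurable[OF I]
  have [measurable]: "simplex_volume k \<in> borel_measurable (\<Pi>\<^sub>M i\<in>I. (borel :: (real^'d) measure))"
    unfolding simplex_volume_def by measurable
  have "simplex_power s k \<alpha> = (\<lambda>x::nat\<Rightarrow>real^'d. if small_diameter s k x then (if \<alpha> = 0 then 1 else simplex_volume k x powr \<alpha>) else 0)"
    using simplex_power_alt[OF k] by blast
  then show ?thesis by (cases "\<alpha> = 0") simp_all
qed

lemma small_diameter_affine:
  fixes x :: "nat \<Rightarrow> 'a::real_normed_vector"
  assumes "r > 0"
  shows "small_diameter (r * s) k (\<lambda>i. v + r *\<^sub>R x i) \<longleftrightarrow> small_diameter s k x"
proof -
  have "norm ((v + r *\<^sub>R x i) - (v + r *\<^sub>R x j)) = r * norm (x i - x j)" for i j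
    using assms by (simp add: scaleR_diff_right[symmetric])
  then show ?thesis using assms by (simp add: small_diameter_def)
qed

lemma simplex_volume_affine:
  fixes x :: "nat \<Rightarrow> real^'d"
  assumes "k \<le> CARD('d)" "r > 0"
  shows "simplex_volume k (\<lambda>i. v + r *\<^sub>R x i) = r ^ k * simplex_volume k x"
  using assms by (simp add: simplex_volume_def gram_det_affine real_sqrt_mult)

lemma simplex_power_affine:
  fixes x :: "nat \<Rightarrow> real^'d"
  assumes k: "k \<le> CARD('d) \<or> \<alpha> = 0" and r: "r > 0"
  shows "simplex_power (r * s) k \<alpha> (\<lambda>i. v + r *\<^sub>R x i) = r powr (\<alpha> * real k) * simplex_power s k \<alpha> x"
proof (cases "\<alpha> = 0")
  case True
  then show ?thesis using r by (simp add: simplex_power_alt small_diameter_affine)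
next
  case False
  then have k': "k \<le> CARD('d)" using k by simp
  have V: "0 \<le> simplex_volume k x"
  proof -
    have "0 \<le> kvolume k (convex hull (x ` {..k}))" by (simp add: kvolume_def split_def)
    then show ?thesis using kvolume_simplex[OF k', of x] by (simp add: simplex_volume_def)
  qed
  have "(r ^ k * simplex_volume k x) powr \<alpha> = r powr (\<alpha> * real k) * simplex_volume k x powr \<alpha>"
    using r V by (simp add: powr_mult powr_realpow[symmetric] powr_powr mult.commute)
  then show ?thesis using r k' False
    by (simp add: simplex_power_alt small_diameter_affine simplex_volume_affine)
qed

text \<open>
  Scaling also changes the truncation radius. For \<open>r \<le> 1\<close> and points at mutual distance at
  most \<open>1\<close> the truncation at \<open>1\<close> stays inactive, so the homogeneity is visible at a fixed radius.
\<close>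

lemma simplex_power_shrink:
  fixes x :: "nat \<Rightarrow> real^'d"
  assumes k: "k \<le> CARD('d) \<or> \<alpha> = 0" and r: "0 < r" "r \<le> 1" and x: "small_diameter 1 k x"
  shows "simplex_power 1 k \<alpha> (\<lambda>i. r *\<^sub>R x i) = r powr (\<alpha> * real k) * simplex_power 1 k \<alpha> x"
proof -
  have "small_diameter r k (\<lambda>i. r *\<^sub>R x i)"
    using small_diameter_affine[of r 1 k 0 x] r x by simp
  then have "small_diameter 1 k (\<lambda>i. r *\<^sub>R x i)"
    using r unfolding small_diameter_def by (meson order_trans)
  then have "simplex_power 1 k \<alpha> (\<lambda>i. r *\<^sub>R x i) = simplex_power r k \<alpha> (\<lambda>i. r *\<^sub>R x i)"
    using \<open>small_diameter r k _\<close> by (simp add: simplex_power_alt[OF k])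
  then show ?thesis using simplex_power_affine[OF k r(1), of 1 0 x] by simp
qed

text \<open>
  For \<open>k \<le> d\<close> the edges of a small corner of a cube are orthogonal, so the Gram determinant is positive
  there, and by continuity it stays positive nearby.
\<close>

lemma exists_regular_box:
  "\<exists>b \<epsilon>. 0 < \<epsilon> \<and> b 0 = 0 \<and> (\<forall>x :: nat \<Rightarrow> real^'d. (\<forall>i\<le>k. norm (x i - b i) < \<epsilon>) \<longrightarrow>
     small_diameter 1 k x \<and> (k \<le> CARD('d) \<longrightarrow> 0 < simplex_volume k x))"
proof -
  \<comment> \<open>The origin and the points at distance \<open>1/4\<close> on the coordinate axes. For \<open>k > d\<close> the vertices beyond the \<open>d\<close>-th are placed at the origin, since only their distances matter.\<close>
  define b :: "nat \<Rightarrow> real^'d" where "b i = (if i = 0 \<or> CARD('d) < i then 0 else (1/4) *\<^sub>R axis (coord_of (i - 1)) 1)" for i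
  have nb: "norm (b i) \<le> 1/4" for i by (simp add: b_def)
  have small: "small_diameter 1 k x" if "\<forall>i\<le>k. norm (x i - b i) < \<epsilon>" "\<epsilon> \<le> 1/4" for x \<epsilon>
    unfolding small_diameter_def
  proof (intro allI impI)
    fix i j assume ij: "i \<le> k" "j \<le> k"
    have "x i - x j = (x i - b i) + b i - (x j - b j) - b j" by simp
    also have "norm \<dots> \<le> norm (x i - b i) + norm (b i) + norm (x j - b j) + norm (b j)"
      by (smt (verit) norm_triangle_ineq norm_triangle_ineq4)
    also have "\<dots> \<le> 1"
    proof -
      have "norm (x i - b i) < \<epsilon>" "norm (x j - b j) < \<epsilon>" using that(1) ij by auto
      then show ?thesis using that(2) nb[of i] nb[of j] by linarith
    qed
    finally show "norm (x i - x j) \<le> 1" .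
  qed
  show ?thesis
  proof (cases "k \<le> CARD('d)")
    case False
    then show ?thesis using small[of _ "1/4"] by (intro exI[of _ b] exI[of _ "1/4"]) (auto simp: b_def)
  next
    case True
    have "\<exists>\<epsilon>>0. \<epsilon> \<le> 1/4 \<and> (\<forall>x. (\<forall>i\<le>k. norm (x i - b i) < \<epsilon>) \<longrightarrow> 0 < gram_det k x)"
    proof (rule ccontr)
      assume neg: "\<not> ?thesis"
      have "\<exists>x. (\<forall>i\<le>k. norm (x i - b i) < 1 / real (n + 4)) \<and> gram_det k x \<le> 0" for n
      proof -
        have "1 / real (n + 4) > 0" "1 / real (n + 4) \<le> 1/4" by (auto simp: field_simps)
        then show ?thesis using neg by (meson not_le)
      qed
      then obtain X where X: "\<And>n i. i \<le> k \<Longrightarrow> norm (X n i - b i) < 1 / real (n + 4)" "\<And>n. gram_det k (X n) \<le> 0"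
        by metis
      have lim: "(\<lambda>n. X n i) \<longlonglongrightarrow> b i" if "i \<le> k" for i
      proof (rule Lim_null[THEN iffD2], rule Lim_null_comparison)
        show "\<forall>\<^sub>F n in sequentially. norm (X n i - b i) \<le> 1 / real (n + 4)"
          using X(1)[OF that] by (auto intro!: always_eventually less_imp_le)
        show "(\<lambda>n. 1 / real (n + 4)) \<longlonglongrightarrow> 0"
          using LIMSEQ_ignore_initial_segment[OF lim_1_over_n, of 4] by simp
      qed
      have entry: "(\<lambda>n. gram_matrix k (X n) $ i $ j) \<longlonglongrightarrow> gram_matrix k b $ i $ j" for i j :: "'d bit0"
        by (cases "coord_index i < k \<and> coord_index j < k") (auto simp: gram_matrix_def intro!: tendsto_intros lim)
      have "(\<lambda>n. gram_det k (X n)) \<longlonglongrightarrow> gram_det k b"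
        unfolding gram_det_def det_def by (intro tendsto_intros entry)
      then have "gram_det k b \<le> 0" using X(2) by (intro LIMSEQ_le_const2) auto
      moreover have "gram_det k b > 0"
      proof -
        let ?G = "gram_matrix k b :: ((real, 'd bit0) vec, 'd bit0) vec"
        have "?G $ i $ j = (if i = j then (if coord_index i < k then 1/16 else 1) else 0)" for i j
        proof (cases "coord_index i < k \<and> coord_index j < k")
          case c: True
          then have d: "coord_index i < CARD('d)" "coord_index j < CARD('d)" using True by auto
          have "(coord_of (coord_index i) :: 'd) = coord_of (coord_index j) \<longleftrightarrow> coord_index i = coord_index j"
            using index_coord_of[OF d(1)] index_coord_of[OF d(2)] by metis
          also have "\<dots> \<longleftrightarrow> i = j" using coord_of_index by metis
          finally show ?thesis using c d by (auto simp: gram_matrix_def b_def inner_axis_axis)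
        qed (auto simp: gram_matrix_def)
        then have "det ?G = (\<Prod>i\<in>UNIV. ?G $ i $ i)" by (intro det_diagonal) simp
        also have "\<dots> > 0" using \<open>\<And>i j. ?G $ i $ j = _\<close> by (intro prod_pos) auto
        finally show ?thesis by (simp add: gram_det_def)
      qed
      ultimately show False by simp
    qed
    then obtain \<epsilon> where \<epsilon>: "0 < \<epsilon>" "\<epsilon> \<le> 1/4" "\<And>x. (\<forall>i\<le>k. norm (x i - b i) < \<epsilon>) \<Longrightarrow> 0 < gram_det k x" by blast
    have "0 < simplex_const TYPE('d) k" unfolding simplex_const_def by (rule simplex_prism_measure_pos)
    then show ?thesis using \<epsilon> small
      by (intro exI[of _ b] exI[of _ \<epsilon>]) (auto simp: b_def simplex_volume_def)
  qed
qed

section \<open>Tuples of distinct points of a Poisson process\<close>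

text \<open>
  The factorial moments of a Poisson variable are the powers of its mean, since
  \<open>j (j - 1) \<cdots> (j - n + 1) / j! = 1 / (j - n)!\<close> shifts the exponential series by \<open>n\<close>.
\<close>

lemma nn_integral_poisson_ffact:
  assumes X[measurable]: "X \<in> measurable M (count_space UNIV)" and "prob_space M" and l: "0 \<le> l"
    and dist: "\<And>j::nat. measure M {\<omega> \<in> space M. X \<omega> = j} = l ^ j / fact j * exp (- l)"
  shows "(\<integral>\<^sup>+\<omega>. ennreal (\<Prod>i<n. real (X \<omega>) - real i) \<partial>M) = ennreal (l ^ n)"
proof -
  interpret prob_space M by fact
  let ?f = "\<lambda>j. \<Prod>i<n. real j - real i"
  have f0: "?f j = 0" if "j < n" for j using that by (auto intro!: prod_zero bexI[of _ j])
  have fge: "?f (j + n) = fact (j + n) / fact j" for j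
  proof (induction n)
    case (Suc n)
    have "(\<Prod>i<Suc n. real (j + Suc n) - real i) = real (j + Suc n) * (\<Prod>i<n. real (j + n) - real i)"
      by (subst prod.lessThan_Suc_shift) simp
    also have "\<dots> = real (j + Suc n) * (fact (j + n) / fact j)" using Suc by (simp only:)
    also have "\<dots> = fact (j + Suc n) / fact j" by simp
    finally show ?case .
  qed simp
  have fpos: "0 \<le> ?f j" for j
  proof (cases "j < n")
    case False
    then have "j = (j - n) + n" by simp
    then show ?thesis using fge[of "j - n"] by (metis fact_ge_zero divide_nonneg_nonneg)
  qed (simp add: f0)
  have "(\<integral>\<^sup>+\<omega>. ennreal (?f (X \<omega>)) \<partial>M) = (\<integral>\<^sup>+j. ennreal (?f j) \<partial>distr M (count_space UNIV) X)"
    by (subst nn_integral_distr) auto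
  also have "\<dots> = (\<Sum>j. ennreal (?f j) * emeasure (distr M (count_space UNIV) X) {j})"
  proof -
    have "(\<integral>\<^sup>+j. ennreal (?f j) \<partial>distr M (count_space UNIV) X) = (\<integral>\<^sup>+j. (\<Sum>i. ennreal (?f i) * indicator {i} j) \<partial>distr M (count_space UNIV) X)"
      by (intro nn_integral_cong) (subst suminf_finite[of "{_}"], auto simp: indicator_def)
    also have "\<dots> = (\<Sum>i. ennreal (?f i) * emeasure (distr M (count_space UNIV) X) {i})"
      by (subst nn_integral_suminf) (auto simp: nn_integral_cmult_indicator)
    finally show ?thesis .
  qed
  also have "\<dots> = (\<Sum>j. ennreal (?f j * (l ^ j / fact j * exp (- l))))"
  proof (intro suminf_cong)
    fix j
    have "emeasure (distr M (count_space UNIV) X) {j} = emeasure M {\<omega> \<in> space M. X \<omega> = j}"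
      by (subst emeasure_distr) (auto intro!: arg_cong[where f="emeasure M"])
    also have "\<dots> = ennreal (l ^ j / fact j * exp (- l))"
      by (subst emeasure_eq_measure) (simp add: dist)
    finally have eq: "emeasure (distr M (count_space UNIV) X) {j} = ennreal (l ^ j / fact j * exp (- l))" .
    show "ennreal (?f j) * emeasure (distr M (count_space UNIV) X) {j} = ennreal (?f j * (l ^ j / fact j * exp (- l)))"
      unfolding eq using fpos l by (intro ennreal_mult[symmetric]) auto
  qed
  also have "\<dots> = ennreal (l ^ n)"
  proof (rule suminf_ennreal_eq)
    show "0 \<le> ?f j * (l ^ j / fact j * exp (- l))" for j using fpos l by simp
    have "(\<lambda>j. l ^ n * exp (- l) * (l ^ j /\<^sub>R fact j)) sums (l ^ n * exp (- l) * exp l)"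
      by (intro sums_mult exp_converges)
    also have "(\<lambda>j. l ^ n * exp (- l) * (l ^ j /\<^sub>R fact j)) = (\<lambda>j. ?f (j + n) * (l ^ (j + n) / fact (j + n) * exp (- l)))"
      unfolding fge by (simp add: power_add field_simps)
    also have "l ^ n * exp (- l) * exp l = l ^ n" by (simp add: exp_minus)
    finally have "(\<lambda>j. ?f (j + n) * (l ^ (j + n) / fact (j + n) * exp (- l))) sums (l ^ n)" .
    then show "(\<lambda>j. ?f j * (l ^ j / fact j * exp (- l))) sums (l ^ n)"
      by (subst (asm) sums_iff_shift) (simp add: f0)
  qed
  finally show ?thesis .
qed

text \<open>
  Tuples of distinct points are handled on the complement of the diagonals. There the boxes with
  pairwise disjoint sides are an intersection-stable generator, and on such a box a tuple of points
  of the process is automatically injective, so that the number of tuples is a product of independent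
  Poisson counts.
\<close>

definition off_diagonal :: "nat \<Rightarrow> (nat \<Rightarrow> 'a) set" where
  "off_diagonal N = {z \<in> {..<N} \<rightarrow>\<^sub>E UNIV. inj_on z {..<N}}"

definition disjoint_boxes :: "nat \<Rightarrow> (nat \<Rightarrow> 'a::topological_space) set set" where
  "disjoint_boxes N = {Pi\<^sub>E {..<N} B | B. range B \<subseteq> sets borel \<and> disjoint_family_on B {..<N}}"

lemma inj_on_disjoint_box:
  assumes "disjoint_family_on B I" "z \<in> Pi\<^sub>E I B"
  shows "inj_on z I"
proof (rule inj_onI, rule ccontr)
  fix i j assume ij: "i \<in> I" "j \<in> I" "z i = z j" "i \<noteq> j"
  then have "z i \<in> B i \<inter> B j" using assms(2) by (metis IntI PiE_mem)
  then show False using assms(1) ij by (auto simp: disjoint_family_on_def)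
qed

lemma disjoint_boxes_off_diagonal: "disjoint_boxes N \<subseteq> Pow (off_diagonal N)"
proof -
  have "Pi\<^sub>E {..<N} B \<subseteq> off_diagonal N" if "disjoint_family_on B {..<N}" for B :: "nat \<Rightarrow> 'a set"
    using inj_on_disjoint_box[OF that] by (auto simp: off_diagonal_def PiE_iff)
  then show ?thesis by (auto simp: disjoint_boxes_def)
qed

lemma Int_stable_disjoint_boxes: "Int_stable (disjoint_boxes N)"
proof (rule Int_stableI)
  fix a b :: "(nat \<Rightarrow> 'a) set" assume "a \<in> disjoint_boxes N" "b \<in> disjoint_boxes N"
  then obtain A B where AB: "a = Pi\<^sub>E {..<N} A" "range A \<subseteq> sets borel" "disjoint_family_on A {..<N}"
    "b = Pi\<^sub>E {..<N} B" "range B \<subseteq> sets borel" "disjoint_family_on B {..<N}"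
    by (auto simp: disjoint_boxes_def)
  then have "a \<inter> b = Pi\<^sub>E {..<N} (\<lambda>i. A i \<inter> B i)" by (auto simp: PiE_Int)
  moreover have "range (\<lambda>i. A i \<inter> B i) \<subseteq> sets borel" using AB by (auto simp: image_subset_iff)
  moreover have "disjoint_family_on (\<lambda>i. A i \<inter> B i) {..<N}"
    using AB by (auto simp: disjoint_family_on_def)
  ultimately show "a \<inter> b \<in> disjoint_boxes N" unfolding disjoint_boxes_def by blast
qed

text \<open>
  Distinct points have disjoint neighbourhoods in a given basis, namely inside balls of half
  the minimal distance.
\<close>

lemma off_diagonal_separated:
  fixes z :: "nat \<Rightarrow> 'a::metric_space"
  assumes "inj_on z {..<N}" and basis: "topological_basis \<B>"
  shows "\<exists>U. (\<forall>i<N. U i \<in> \<B> \<and> z i \<in> U i) \<and> disjoint_family_on U {..<N}"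
proof -
  have "\<exists>e>0. \<forall>i<N. \<forall>j<N. i \<noteq> j \<longrightarrow> e \<le> dist (z i) (z j)"
  proof -
    let ?D = "insert 1 ((\<lambda>(i,j). dist (z i) (z j)) ` {(i,j). i < N \<and> j < N \<and> i \<noteq> j})"
    have "finite {(i,j). i < N \<and> j < N \<and> i \<noteq> j}"
      by (rule finite_subset[of _ "{..<N} \<times> {..<N}"]) auto
    then have fin: "finite ?D" by simp
    have "Min ?D > 0" using fin assms(1) by (subst Min_gr_iff) (auto simp: inj_on_def)
    moreover have "Min ?D \<le> dist (z i) (z j)" if "i < N" "j < N" "i \<noteq> j" for i j
      using fin that by (intro Min_le) auto
    ultimately show ?thesis by blast
  qed
  then obtain e where e: "e > 0" "\<And>i j. i < N \<Longrightarrow> j < N \<Longrightarrow> i \<noteq> j \<Longrightarrow> e \<le> dist (z i) (z j)" by blast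
  have "\<exists>V. V \<in> \<B> \<and> z i \<in> V \<and> V \<subseteq> ball (z i) (e/2)" for i
    using topological_basisE[OF basis open_ball, of "z i" "z i" "e/2"] e(1) by auto
  then obtain U where U: "\<And>i. U i \<in> \<B>" "\<And>i. z i \<in> U i" "\<And>i. U i \<subseteq> ball (z i) (e/2)" by metis
  have "disjoint_family_on U {..<N}"
    unfolding disjoint_family_on_def
  proof (intro ballI impI)
    fix i j assume ij: "i \<in> {..<N}" "j \<in> {..<N}" "i \<noteq> j"
    have "False" if "y \<in> U i" "y \<in> U j" for y
    proof -
      have "dist (z i) y < e/2" "dist (z j) y < e/2" using subsetD[OF U(3) that(1)] subsetD[OF U(3) that(2)] by auto
      then have "dist (z i) (z j) < e" using dist_triangle_half_r[of y "z i" e "z j"] by (simp add: dist_commute)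
      then show False using e(2)[of i j] ij by auto
    qed
    then show "U i \<inter> U j = {}" by blast
  qed
  then show ?thesis using U by blast
qed

text \<open>
  Off the diagonals a box is a countable union of boxes with disjoint sides: intersect its sides with
  disjoint sets from a countable basis.
\<close>

lemma off_diagonal_generated:
  fixes A :: "(nat \<Rightarrow> 'a::{metric_space,second_countable_topology}) set"
  assumes "A \<in> sets (\<Pi>\<^sub>M i\<in>{..<N}. borel)"
  shows "A \<inter> off_diagonal N \<in> sigma_sets (off_diagonal N) (disjoint_boxes N)"
proof -
  obtain \<B> :: "'a set set" where \<B>: "countable \<B>" "topological_basis \<B>"
    using ex_countable_basis by blast
  let ?O = "off_diagonal N :: (nat \<Rightarrow> 'a) set" and ?S = "sigma_sets (off_diagonal N) (disjoint_boxes N)"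
  interpret sigma_algebra ?O ?S by (rule sigma_algebra_sigma_sets[OF disjoint_boxes_off_diagonal])
  have "A \<in> sigma_sets (\<Pi>\<^sub>E i\<in>{..<N}. UNIV) {(\<Pi>\<^sub>E i\<in>{..<N}. X i) |X. (\<forall>i. X i \<in> sets borel) \<and> finite {i. X i \<noteq> UNIV}}"
    using assms unfolding sets_PiM_finite by simp
  then show ?thesis
  proof induction
    case (Basic a)
    then obtain X where X: "a = Pi\<^sub>E {..<N} X" "\<And>i. X i \<in> sets borel" by blast
    let ?F = "{U \<in> {..<N} \<rightarrow>\<^sub>E \<B>. disjoint_family_on U {..<N}}"
    have cF: "countable ?F"
      by (rule countable_subset[OF _ countable_PiE[of "{..<N}" "\<lambda>_. \<B>"]]) (use \<B> in auto)
    have "a \<inter> ?O = (\<Union>U\<in>?F. Pi\<^sub>E {..<N} (\<lambda>i. X i \<inter> U i))"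
    proof (intro set_eqI iffI)
      fix z assume z: "z \<in> a \<inter> ?O"
      then have "inj_on z {..<N}" by (auto simp: off_diagonal_def)
      from off_diagonal_separated[OF this \<B>(2)] obtain U where
        U: "\<forall>i<N. U i \<in> \<B> \<and> z i \<in> U i" "disjoint_family_on U {..<N}" by blast
      then have "restrict U {..<N} \<in> ?F" by (simp add: disjoint_family_on_def)
      moreover have "z \<in> Pi\<^sub>E {..<N} (\<lambda>i. X i \<inter> restrict U {..<N} i)"
        using z U(1) X(1) by (simp add: PiE_iff)
      ultimately show "z \<in> (\<Union>U\<in>?F. Pi\<^sub>E {..<N} (\<lambda>i. X i \<inter> U i))" by blast
    next
      fix z assume "z \<in> (\<Union>U\<in>?F. Pi\<^sub>E {..<N} (\<lambda>i. X i \<inter> U i))"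
      then obtain U where U: "disjoint_family_on U {..<N}" "z \<in> Pi\<^sub>E {..<N} (\<lambda>i. X i \<inter> U i)" by auto
      then have "z \<in> Pi\<^sub>E {..<N} U" by (auto simp: PiE_iff)
      then have "inj_on z {..<N}" by (rule inj_on_disjoint_box[OF U(1)])
      then show "z \<in> a \<inter> ?O" using U(2) X(1) by (simp add: off_diagonal_def PiE_iff)
    qed
    moreover have "Pi\<^sub>E {..<N} (\<lambda>i. X i \<inter> U i) \<in> ?S" if "U \<in> ?F" for U
    proof (rule sigma_sets.Basic)
      let ?B = "\<lambda>i. if i < N then X i \<inter> U i else {}"
      have "Pi\<^sub>E {..<N} (\<lambda>i. X i \<inter> U i) = Pi\<^sub>E {..<N} ?B" by (intro PiE_cong) auto
      moreover have "range ?B \<subseteq> sets borel"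
        using X \<B>(2) that topological_basis_open by (fastforce simp: image_subset_iff PiE_iff)
      moreover have "disjoint_family_on ?B {..<N}" using that by (auto simp: disjoint_family_on_def)
      ultimately show "Pi\<^sub>E {..<N} (\<lambda>i. X i \<inter> U i) \<in> disjoint_boxes N"
        unfolding disjoint_boxes_def by blast
    qed
    ultimately show ?case using countable_UN'[OF cF, of "\<lambda>U. Pi\<^sub>E {..<N} (\<lambda>i. X i \<inter> U i)"] by (simp add: image_subset_iff)
  next
    case Empty
    then show ?case by simp
  next
    case (Compl a)
    have "(Pi\<^sub>E {..<N} (\<lambda>_. UNIV) - a) \<inter> ?O = ?O - (a \<inter> ?O)" by (auto simp: off_diagonal_def)
    then show ?case using Compl by auto
  next
    case (Union a)
    have "(\<Union>i. a i \<inter> ?O) \<in> ?S" using Union.IH by (rule sigma_sets.Union)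
    then show ?case by (simp only: UN_extend_simps)
  qed
qed

definition inj_tuples :: "nat \<Rightarrow> 'a set \<Rightarrow> (nat \<Rightarrow> 'a) set" where
  "inj_tuples N A = {z \<in> {..<N} \<rightarrow>\<^sub>E A. inj_on z {..<N}}"

lemma finite_inj_tuples: "finite A \<Longrightarrow> finite (inj_tuples N A)"
  unfolding inj_tuples_def by (rule finite_subset[OF _ finite_PiE[of "{..<N}" "\<lambda>_. A"]]) auto

lemma card_inj_tuples:
  assumes "finite A"
  shows "real (card (inj_tuples N A)) = (\<Prod>i<N. real (card A) - real i)"
proof -
  have "card (inj_tuples N A) = (\<Prod>i<N. card A - i)"
    unfolding inj_tuples_def using card_inj_on_subset_funcset[of "{..<N}" A "{..<N}"] assms by (simp add: atLeast0LessThan)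
  also have "real (\<Prod>i<N. card A - i) = (\<Prod>i<N. real (card A) - real i)"
  proof (cases "N \<le> card A")
    case True
    then show ?thesis by (auto simp: of_nat_diff intro!: prod.cong)
  next
    case False
    then have "(\<Prod>i<N. card A - i) = 0" "(\<Prod>i<N. real (card A) - real i) = 0"
      by (auto intro!: prod_zero bexI[of _ "card A"])
    then show ?thesis by (simp only: of_nat_0)
  qed
  finally show ?thesis .
qed

abbreviation uniform_on :: "'a::euclidean_space set \<Rightarrow> 'a measure" where
  "uniform_on W \<equiv> uniform_measure lborel W"

lemma emeasure_uniform_on:
  assumes "W \<in> sets borel" "emeasure lborel W = 1" "B \<in> sets borel"
  shows "emeasure (uniform_on W) B = emeasure lborel (W \<inter> B)"
  using assms by (simp add: divide_ennreal_def)

lemma prob_space_uniform_on: "emeasure lborel W = 1 \<Longrightarrow> prob_space (uniform_on W)"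
  by (rule prob_space_uniform_measure) auto

text \<open>
  Once the other coordinates are fixed, a coincidence confines one coordinate to a single point.
\<close>

lemma AE_PiM_inj_on:
  fixes W :: "'a::euclidean_space set" and N :: nat
  assumes W: "W \<in> sets borel" "emeasure lborel W = 1"
  shows "AE z in \<Pi>\<^sub>M i\<in>{..<N}. uniform_on W. inj_on z {..<N}"
proof -
  interpret U: prob_space "uniform_on W" by (rule prob_space_uniform_on[OF W(2)])
  interpret PP: product_sigma_finite "\<lambda>_::nat. uniform_on W" by standard
  have "AE z in \<Pi>\<^sub>M i\<in>{..<N}. uniform_on W. z i \<noteq> z j" if ij: "i < N" "j < N" "i \<noteq> j" for i j
  proof -
    let ?I = "{..<N} - {i}"
    have I: "insert i ?I = {..<N}" using ij by auto
    let ?A = "{z \<in> space (\<Pi>\<^sub>M i\<in>{..<N}. uniform_on W). dist (z i) (z j) \<le> 0}"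
    have [measurable]: "(\<lambda>z. z i) \<in> borel_measurable (\<Pi>\<^sub>M i\<in>{..<N}. uniform_on W)" if "i < N" for i
      using measurable_component_singleton[where i=i and I="{..<N}" and M="\<lambda>_. uniform_on W"] that by (simp cong: measurable_cong_sets)
    have A: "?A \<in> sets (\<Pi>\<^sub>M i\<in>{..<N}. uniform_on W)" using ij by measurable
    have "emeasure (\<Pi>\<^sub>M i\<in>{..<N}. uniform_on W) ?A = (\<integral>\<^sup>+z. indicator ?A z \<partial>(\<Pi>\<^sub>M i\<in>{..<N}. uniform_on W))"
      using A by simp
    also have "\<dots> = (\<integral>\<^sup>+x. (\<integral>\<^sup>+y. indicator ?A (x(i := y)) \<partial>uniform_on W) \<partial>(\<Pi>\<^sub>M i\<in>?I. uniform_on W))"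
      using PP.product_nn_integral_insert[of ?I i "indicator ?A"] A unfolding I by simp
    also have "\<dots> = (\<integral>\<^sup>+x. 0 \<partial>(\<Pi>\<^sub>M i\<in>?I. uniform_on W))"
    proof (intro nn_integral_cong)
      fix x
      have "(\<integral>\<^sup>+y. indicator ?A (x(i := y)) \<partial>uniform_on W) \<le> (\<integral>\<^sup>+y. indicator {x j} y \<partial>uniform_on W)"
        using ij by (intro nn_integral_mono) (auto simp: indicator_def)
      also have "\<dots> = emeasure lborel (W \<inter> {x j})" using W by (simp add: divide_ennreal_def)
      also have "\<dots> \<le> emeasure lborel {x j}" by (intro emeasure_mono) auto
      finally show "(\<integral>\<^sup>+y. indicator ?A (x(i := y)) \<partial>uniform_on W) = 0" by simp
    qed
    finally have "emeasure (\<Pi>\<^sub>M i\<in>{..<N}. uniform_on W) ?A = 0" by simp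
    then show ?thesis using A by (intro AE_I'[of ?A]) (auto simp: null_sets_def)
  qed
  then have "AE z in \<Pi>\<^sub>M i\<in>{..<N}. uniform_on W. \<forall>i\<in>{..<N}. \<forall>j\<in>{..<N}. i \<noteq> j \<longrightarrow> z i \<noteq> z j"
    by (intro AE_finite_allI) auto
  then show ?thesis by eventually_elim (auto simp: inj_on_def)
qed

lemma poisson_process_count_measurable:
  assumes "poisson_process M W t \<eta>" "B \<in> sets borel"
  shows "(\<lambda>\<omega>. card (\<eta> \<omega> \<inter> B)) \<in> measurable M (count_space UNIV)"
proof -
  have p: "prob_space M" using assms(1) by (simp add: poisson_process_def)
  have "prob_space.indep_vars M (\<lambda>_. count_space UNIV) (\<lambda>i \<omega>. card (\<eta> \<omega> \<inter> (\<lambda>_. B) i)) {0::nat}"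
    using assms unfolding poisson_process_def by (elim conjE allE[of _ "{0}"] allE[of _ "\<lambda>_. B"]) (auto simp: disjoint_family_on_def)
  then show ?thesis by (auto simp: prob_space.indep_vars_def[OF p])
qed

lemma measurable_off_diagonal:
  "off_diagonal N \<in> sets (\<Pi>\<^sub>M i\<in>{..<N}. (borel :: 'a::{second_countable_topology,metric_space} measure))"
proof -
  have "off_diagonal N = {z \<in> space (\<Pi>\<^sub>M i\<in>{..<N}. (borel :: 'a measure)). \<forall>i\<in>{..<N}. \<forall>j\<in>{..<N}. dist (z i) (z j) = 0 \<longrightarrow> i = j}"
    by (auto simp: off_diagonal_def inj_on_def space_PiM)
  also have "\<dots> \<in> sets (\<Pi>\<^sub>M i\<in>{..<N}. (borel :: 'a measure))" by measurable
  finally show ?thesis .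
qed

text \<open>
  The multivariate Mecke formula for indicators. Dynkin's lemma extends it from boxes with disjoint
  sides to all measurable sets off the diagonals; measurability and the formula for the expectation
  are carried along together. The complement step needs the total number of tuples to have
  a finite expectation, which is a factorial moment of the number of points. The diagonals contribute
  nothing on either side.
\<close>

lemma poisson_tuple_count:
  fixes W :: "(real^'d) set"
  assumes pp: "poisson_process M W t \<eta>" and t: "0 \<le> t"
    and W: "W \<in> sets borel" "emeasure lborel W = 1"
    and A: "A \<in> sets (\<Pi>\<^sub>M i\<in>{..<N}. borel)"
  shows "(\<lambda>\<omega>. \<Sum>z\<in>inj_tuples N (\<eta> \<omega>). indicator A z :: ennreal) \<in> borel_measurable M \<and>
    (\<integral>\<^sup>+\<omega>. (\<Sum>z\<in>inj_tuples N (\<eta> \<omega>). indicator A z) \<partial>M) = ennreal (t ^ N) * emeasure (\<Pi>\<^sub>M i\<in>{..<N}. uniform_on W) A"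
proof -
  interpret M: prob_space M using pp by (simp add: poisson_process_def)
  interpret U: prob_space "uniform_on W" by (rule prob_space_uniform_on[OF W(2)])
  interpret PP: product_sigma_finite "\<lambda>_::nat. uniform_on W" by standard
  let ?\<mu> = "\<Pi>\<^sub>M i\<in>{..<N}. uniform_on W"
  interpret \<mu>: prob_space ?\<mu> by (rule prob_space_PiM) (rule prob_space_uniform_on[OF W(2)])
  let ?O = "off_diagonal N :: (nat \<Rightarrow> real^'d) set"
  let ?c = "\<lambda>A \<omega>. \<Sum>z\<in>inj_tuples N (\<eta> \<omega>). indicator A z :: ennreal"
  let ?Q = "\<lambda>A. ?c A \<in> borel_measurable M \<and> (\<integral>\<^sup>+\<omega>. ?c A \<omega> \<partial>M) = ennreal (t ^ N) * emeasure ?\<mu> A"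
  have fin: "finite (\<eta> \<omega>)" "\<eta> \<omega> \<subseteq> W" if "\<omega> \<in> space M" for \<omega>
    using pp that by (auto simp: poisson_process_def)
  have sets_\<mu>: "sets ?\<mu> = sets (\<Pi>\<^sub>M i\<in>{..<N}. borel)" by (intro sets_PiM_cong) auto
  have O: "?O \<in> sets ?\<mu>" unfolding sets_\<mu> by (rule measurable_off_diagonal)
  have sub: "sigma_sets ?O (disjoint_boxes N) \<subseteq> sets ?\<mu>"
  proof
    fix X assume "X \<in> sigma_sets ?O (disjoint_boxes N)"
    then show "X \<in> sets ?\<mu>"
    proof induction
      case (Basic a)
      then show ?case by (auto simp: disjoint_boxes_def intro!: sets_PiM_I_finite)
    qed (use O in auto)
  qed
  have AE_O: "AE z in ?\<mu>. z \<in> ?O"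
  proof -
    have "AE z in ?\<mu>. z \<in> space ?\<mu>" by simp
    then show ?thesis using AE_PiM_inj_on[OF W, of N]
      by eventually_elim (auto simp: off_diagonal_def space_PiM)
  qed
  have dist: "measure M {\<omega> \<in> space M. card (\<eta> \<omega> \<inter> B) = j} =
       (t * measure lborel (W \<inter> B)) ^ j / fact j * exp (- (t * measure lborel (W \<inter> B)))" if "B \<in> sets borel" for B j
    using pp that by (simp add: poisson_process_def)
  have box: "?Q X" if X: "X \<in> disjoint_boxes N" for X
  proof -
    obtain B where B: "X = Pi\<^sub>E {..<N} B" "range B \<subseteq> sets borel" "disjoint_family_on B {..<N}"
      using X by (auto simp: disjoint_boxes_def)
    have Bs: "B i \<in> sets borel" for i using B(2) by auto
    let ?X = "\<lambda>i \<omega>. card (\<eta> \<omega> \<inter> B i)"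
    have Xm[measurable]: "?X i \<in> measurable M (count_space UNIV)" for i
      by (rule poisson_process_count_measurable[OF pp Bs])
    have ind: "M.indep_vars (\<lambda>_. count_space UNIV) ?X {..<N}"
      using pp B unfolding poisson_process_def by (elim conjE allE[of _ "{..<N}"] allE[of _ B]) auto
    then have ind': "M.indep_vars (\<lambda>_. borel) (\<lambda>i \<omega>. real (?X i \<omega>)) {..<N}"
      by (rule M.indep_vars_compose2) auto
    have c: "?c X \<omega> = (\<Prod>i<N. ennreal (real (?X i \<omega>)))" if "\<omega> \<in> space M" for \<omega>
    proof -
      have "?c X \<omega> = (\<Sum>z\<in>inj_tuples N (\<eta> \<omega>) \<inter> X. 1)"
        by (intro sum.mono_neutral_cong_right) (auto simp: finite_inj_tuples fin[OF that] indicator_def)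
      also have "inj_tuples N (\<eta> \<omega>) \<inter> X = Pi\<^sub>E {..<N} (\<lambda>i. \<eta> \<omega> \<inter> B i)"
        unfolding inj_tuples_def B(1) using inj_on_disjoint_box[OF B(3)] by (auto simp: PiE_iff)
      also have "(\<Sum>z\<in>\<dots>. 1::ennreal) = of_nat (\<Prod>i<N. ?X i \<omega>)" by (simp add: card_PiE)
      also have "\<dots> = (\<Prod>i<N. ennreal (real (?X i \<omega>)))"
        by (simp add: ennreal_of_nat_eq_real_of_nat prod_ennreal)
      finally show ?thesis .
    qed
    have meas: "(\<lambda>\<omega>. \<Prod>i<N. ennreal (real (?X i \<omega>))) \<in> borel_measurable M" by measurable
    then have 1: "?c X \<in> borel_measurable M" by (subst measurable_cong[OF c])
    have "(\<integral>\<^sup>+\<omega>. ?c X \<omega> \<partial>M) = (\<integral>\<^sup>+\<omega>. (\<Prod>i<N. ennreal (real (?X i \<omega>))) \<partial>M)"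
      by (intro nn_integral_cong c)
    also have "\<dots> = (\<Prod>i<N. \<integral>\<^sup>+\<omega>. ennreal (real (?X i \<omega>)) \<partial>M)"
    proof (rule M.indep_vars_nn_integral)
      show "M.indep_vars (\<lambda>_. borel) (\<lambda>i \<omega>. ennreal (real (?X i \<omega>))) {..<N}"
        by (rule M.indep_vars_compose2[OF ind]) auto
    qed auto
    also have "\<dots> = (\<Prod>i<N. ennreal (t * measure lborel (W \<inter> B i)))"
    proof (intro prod.cong refl)
      fix i
      show "(\<integral>\<^sup>+\<omega>. ennreal (real (?X i \<omega>)) \<partial>M) = ennreal (t * measure lborel (W \<inter> B i))"
        using nn_integral_poisson_ffact[where n=1, OF Xm M.prob_space_axioms _ dist[OF Bs], of i] t by simp
    qed
    also have "\<dots> = (\<Prod>i<N. ennreal t * emeasure (uniform_on W) (B i))"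
    proof (intro prod.cong refl)
      fix i
      have "emeasure lborel (W \<inter> B i) \<le> 1" using W Bs by (metis emeasure_mono inf_le1 sets_lborel)
      then have "emeasure lborel (W \<inter> B i) = ennreal (measure lborel (W \<inter> B i))"
        by (intro emeasure_eq_ennreal_measure) (auto simp: top_unique)
      then show "ennreal (t * measure lborel (W \<inter> B i)) = ennreal t * emeasure (uniform_on W) (B i)"
        using t by (simp add: emeasure_uniform_on[OF W Bs] ennreal_mult del: emeasure_uniform_measure)
    qed
    also have "\<dots> = ennreal (t ^ N) * emeasure ?\<mu> X"
      unfolding B(1) using t Bs by (subst PP.emeasure_PiM) (auto simp: prod.distrib ennreal_power)
    finally show ?thesis using 1 by simp
  qed
  have total: "?Q ?O"
  proof -
    let ?f = "\<lambda>\<omega>. ennreal (\<Prod>i<N. real (card (\<eta> \<omega> \<inter> UNIV)) - real i)"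
    have c: "?c ?O \<omega> = ?f \<omega>" if "\<omega> \<in> space M" for \<omega>
    proof -
      have "?c ?O \<omega> = (\<Sum>z\<in>inj_tuples N (\<eta> \<omega>). 1)"
        by (intro sum.cong refl) (auto simp: inj_tuples_def off_diagonal_def indicator_def)
      also have "\<dots> = ennreal (real (card (inj_tuples N (\<eta> \<omega>))))" by (simp add: ennreal_of_nat_eq_real_of_nat)
      finally show ?thesis by (simp add: card_inj_tuples fin[OF that])
    qed
    have cm[measurable]: "(\<lambda>\<omega>. card (\<eta> \<omega> \<inter> UNIV)) \<in> measurable M (count_space UNIV)"
      by (rule poisson_process_count_measurable[OF pp]) simp
    have m: "?f \<in> borel_measurable M" by measurable
    have vol: "measure lborel (W \<inter> UNIV) = 1" using W(2) by (simp add: measure_def)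
    have "(\<integral>\<^sup>+\<omega>. ?c ?O \<omega> \<partial>M) = (\<integral>\<^sup>+\<omega>. ?f \<omega> \<partial>M)" by (intro nn_integral_cong c)
    also have "\<dots> = ennreal (t ^ N)"
      using nn_integral_poisson_ffact[OF cm M.prob_space_axioms _ dist[of UNIV]] t unfolding vol by simp
    finally have "(\<integral>\<^sup>+\<omega>. ?c ?O \<omega> \<partial>M) = ennreal (t ^ N)" .
    moreover have "emeasure ?\<mu> ?O = 1" using AE_O O by (subst \<mu>.emeasure_eq_1_AE) auto
    moreover have "?c ?O \<in> borel_measurable M" using m by (subst measurable_cong[OF c])
    ultimately show ?thesis by simp
  qed
  have Q: "?Q X" if "X \<in> sigma_sets ?O (disjoint_boxes N)" for X
    using Int_stable_disjoint_boxes disjoint_boxes_off_diagonal that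
  proof (induction rule: sigma_sets_induct_disjoint)
    case (basic A)
    then show ?case by (rule box)
  next
    case empty
    then show ?case by simp
  next
    case (compl A)
    have AO: "A \<subseteq> ?O" by (rule sigma_sets_into_sp[OF disjoint_boxes_off_diagonal compl(1)])
    have As: "A \<in> sets ?\<mu>" using compl(1) sub by auto
    have le: "?c A \<omega> \<le> ?c ?O \<omega>" for \<omega> using AO by (intro sum_mono) (auto simp: indicator_def)
    have finA: "?c A \<omega> \<noteq> \<top>" for \<omega>
      by (cases "finite (inj_tuples N (\<eta> \<omega>))") (auto simp: indicator_def of_bool_def)
    have c: "?c (?O - A) \<omega> = ?c ?O \<omega> - ?c A \<omega>" for \<omega>
    proof -
      have "?c ?O \<omega> = ?c (?O - A) \<omega> + ?c A \<omega>"
        unfolding sum.distrib[symmetric] using AO by (intro sum.cong refl) (auto simp: indicator_def)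
      then show ?thesis using finA by (simp add: ennreal_add_diff_cancel_right)
    qed
    have "(\<integral>\<^sup>+\<omega>. ?c (?O - A) \<omega> \<partial>M) = (\<integral>\<^sup>+\<omega>. ?c ?O \<omega> \<partial>M) - (\<integral>\<^sup>+\<omega>. ?c A \<omega> \<partial>M)"
      unfolding c
    proof (rule nn_integral_diff)
      show "(\<integral>\<^sup>+\<omega>. ?c A \<omega> \<partial>M) \<noteq> \<infinity>"
        using compl(2) \<mu>.emeasure_finite[of A] by (simp add: ennreal_mult_eq_top_iff)
    qed (use compl(2) total le in auto)
    also have "\<dots> = ennreal (t ^ N) * (emeasure ?\<mu> ?O - emeasure ?\<mu> A)"
      using compl(2) total by (simp add: ennreal_right_diff_distrib)
    also have "emeasure ?\<mu> ?O - emeasure ?\<mu> A = emeasure ?\<mu> (?O - A)"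
      using As O AO \<mu>.emeasure_finite[of A] by (subst emeasure_Diff) auto
    finally show ?case using compl(2) total unfolding c by (auto intro!: borel_measurable_minus_ennreal)
  next
    case (union A)
    have c: "?c (\<Union>i. A i) \<omega> = (\<Sum>i. ?c (A i) \<omega>)" for \<omega>
      using union(1) by (subst suminf_sum) (auto simp: suminf_indicator)
    have "(\<integral>\<^sup>+\<omega>. ?c (\<Union>i. A i) \<omega> \<partial>M) = (\<Sum>i. \<integral>\<^sup>+\<omega>. ?c (A i) \<omega> \<partial>M)"
      unfolding c by (rule nn_integral_suminf) (use union(3) in auto)
    also have "\<dots> = (\<Sum>i. ennreal (t ^ N) * emeasure ?\<mu> (A i))" using union(3) by simp
    also have "\<dots> = ennreal (t ^ N) * emeasure ?\<mu> (\<Union>i. A i)"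
      using union(1,2) sub by (subst ennreal_suminf_cmult, subst suminf_emeasure) auto
    moreover have "?c (\<Union>i. A i) \<in> borel_measurable M" unfolding c by (intro borel_measurable_suminf_order) (use union(3) in auto)
    ultimately show ?case by simp
  qed
  have "?c A \<omega> = ?c (A \<inter> ?O) \<omega>" for \<omega>
    by (intro sum.cong refl) (auto simp: inj_tuples_def off_diagonal_def indicator_def)
  moreover have "emeasure ?\<mu> (A \<inter> ?O) = emeasure ?\<mu> A"
    using AE_O A O by (intro emeasure_eq_AE) (auto simp: sets_\<mu>)
  ultimately show ?thesis using Q[OF off_diagonal_generated[OF A]] by simp
qed

lemma poisson_tuple_sum:
  fixes W :: "(real^'d) set"
  assumes pp: "poisson_process M W t \<eta>" and t: "0 \<le> t"
    and W: "W \<in> sets borel" "emeasure lborel W = 1"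
    and f: "f \<in> borel_measurable (\<Pi>\<^sub>M i\<in>{..<N}. borel)"
  shows "(\<lambda>\<omega>. \<Sum>z\<in>inj_tuples N (\<eta> \<omega>). f z :: ennreal) \<in> borel_measurable M \<and>
    (\<integral>\<^sup>+\<omega>. (\<Sum>z\<in>inj_tuples N (\<eta> \<omega>). f z) \<partial>M) = ennreal (t ^ N) * (\<integral>\<^sup>+z. f z \<partial>(\<Pi>\<^sub>M i\<in>{..<N}. uniform_on W))"
  using f
proof (induction rule: borel_measurable_induct)
  case (cong f g)
  have "(\<Sum>z\<in>inj_tuples N (\<eta> \<omega>). f z) = (\<Sum>z\<in>inj_tuples N (\<eta> \<omega>). g z)" for \<omega>
    by (intro sum.cong refl cong(3)) (auto simp: inj_tuples_def space_PiM)
  moreover have "(\<integral>\<^sup>+z. f z \<partial>(\<Pi>\<^sub>M i\<in>{..<N}. uniform_on W)) = (\<integral>\<^sup>+z. g z \<partial>(\<Pi>\<^sub>M i\<in>{..<N}. uniform_on W))"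
    by (intro nn_integral_cong cong(3)) (auto simp: space_PiM)
  ultimately show ?case using cong(4) by simp
next
  case (set A)
  then show ?case using poisson_tuple_count[OF pp t W set] by simp
next
  case (mult u c)
  have u: "u \<in> borel_measurable (\<Pi>\<^sub>M i\<in>{..<N}. uniform_on W)"
    using mult(2) by (subst measurable_cong_sets[OF sets_PiM_cong[OF refl]]) auto
  show ?case using mult(4) u by (auto simp: sum_distrib_left[symmetric] nn_integral_cmult mult_ac)
next
  case (add u v)
  have u: "u \<in> borel_measurable (\<Pi>\<^sub>M i\<in>{..<N}. uniform_on W)" "v \<in> borel_measurable (\<Pi>\<^sub>M i\<in>{..<N}. uniform_on W)"
    using add by (simp_all cong: measurable_cong_sets sets_PiM_cong)
  show ?case using add u by (auto simp: sum.distrib nn_integral_add distrib_left)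
next
  case (seq U)
  have U: "U i \<in> borel_measurable (\<Pi>\<^sub>M i\<in>{..<N}. uniform_on W)" for i
    using seq by (simp cong: measurable_cong_sets sets_PiM_cong)
  have sup: "(\<Sum>z\<in>inj_tuples N (\<eta> \<omega>). (SUP i. U i) z) = (SUP i. \<Sum>z\<in>inj_tuples N (\<eta> \<omega>). U i z)" for \<omega>
    unfolding SUP_apply using seq(3) by (subst ennreal_SUP_sum) (auto simp: incseq_def le_fun_def image_comp)
  have "(\<integral>\<^sup>+\<omega>. (\<Sum>z\<in>inj_tuples N (\<eta> \<omega>). (SUP i. U i) z) \<partial>M) = (SUP i. \<integral>\<^sup>+\<omega>. (\<Sum>z\<in>inj_tuples N (\<eta> \<omega>). U i z) \<partial>M)"
    unfolding sup using seq by (intro nn_integral_monotone_convergence_SUP) (auto simp: incseq_def le_fun_def intro!: sum_mono)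
  also have "\<dots> = (SUP i. ennreal (t ^ N) * (\<integral>\<^sup>+z. U i z \<partial>(\<Pi>\<^sub>M i\<in>{..<N}. uniform_on W)))"
    using seq by simp
  also have "\<dots> = ennreal (t ^ N) * (SUP i. \<integral>\<^sup>+z. U i z \<partial>(\<Pi>\<^sub>M i\<in>{..<N}. uniform_on W))"
    by (rule SUP_mult_left_ennreal[symmetric])
  also have "(SUP i. \<integral>\<^sup>+z. U i z \<partial>(\<Pi>\<^sub>M i\<in>{..<N}. uniform_on W)) = (\<integral>\<^sup>+z. (SUP i. U i z) \<partial>(\<Pi>\<^sub>M i\<in>{..<N}. uniform_on W))"
    using seq(3) U by (intro nn_integral_monotone_convergence_SUP[symmetric]) auto
  also have "\<dots> = (\<integral>\<^sup>+z. (SUP i. U i) z \<partial>(\<Pi>\<^sub>M i\<in>{..<N}. uniform_on W))"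
    by (simp add: SUP_apply image_comp)
  finally have eq: "(\<integral>\<^sup>+\<omega>. (\<Sum>z\<in>inj_tuples N (\<eta> \<omega>). (SUP i. U i) z) \<partial>M) = ennreal (t ^ N) * (\<integral>\<^sup>+z. (SUP i. U i) z \<partial>(\<Pi>\<^sub>M i\<in>{..<N}. uniform_on W))" .
  have m: "(\<lambda>\<omega>. SUP i. \<Sum>z\<in>inj_tuples N (\<eta> \<omega>). U i z) \<in> borel_measurable M"
    using seq by (intro borel_measurable_SUP) auto
  show ?case by (intro conjI eq) (simp only: sup m)
qed

section \<open>Pairs of subsets and overlapping tuples\<close>

lemma card_injections_onto:
  assumes "finite I" "finite S" "card I = card S"
  shows "card {z \<in> I \<rightarrow>\<^sub>E S. inj_on z I} = fact (card S)"
proof -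
  have "card {z \<in> I \<rightarrow>\<^sub>E S. inj_on z I} = (\<Prod>i = 0..<card S. card S - i)"
    using card_inj_on_subset_funcset[OF assms(1,2) subset_refl] assms(3) by simp
  also have "\<dots> = fact (card S)" by (simp add: fact_prod_rev)
  finally show ?thesis .
qed

lemma card_onto_tuples:
  assumes "finite I" "finite S" "card I = card S"
  shows "card {z \<in> I \<rightarrow>\<^sub>E A. inj_on z I \<and> z ` I = S} = (if S \<subseteq> A then fact (card S) else 0)"
proof (cases "S \<subseteq> A")
  case True
  have "{z \<in> I \<rightarrow>\<^sub>E A. inj_on z I \<and> z ` I = S} = {z \<in> I \<rightarrow>\<^sub>E S. inj_on z I}"
  proof (intro set_eqI iffI)
    fix z assume "z \<in> {z \<in> I \<rightarrow>\<^sub>E S. inj_on z I}"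
    then have z: "z \<in> I \<rightarrow>\<^sub>E S" "inj_on z I" by auto
    then have "z ` I \<subseteq> S" by auto
    with z assms have "z ` I = S" by (intro card_subset_eq) (auto simp: card_image)
    then show "z \<in> {z \<in> I \<rightarrow>\<^sub>E A. inj_on z I \<and> z ` I = S}"
      using z True by (auto simp: PiE_iff)
  qed (auto simp: PiE_iff)
  then show ?thesis using card_injections_onto[OF assms] True by simp
next
  case False
  then have e: "{z \<in> I \<rightarrow>\<^sub>E A. inj_on z I \<and> z ` I = S} = {}" by (auto simp: PiE_iff)
  show ?thesis unfolding e using False by simp
qed

lemma card_onto_tuples_Un:
  fixes S T :: "'a set"
  assumes "finite I" "finite J" "I \<inter> J = {}"
    and S: "finite S" "finite T" "S \<inter> T = {}"
  shows "card {z \<in> I \<union> J \<rightarrow>\<^sub>E A. inj_on z (I \<union> J) \<and> z ` I = S \<and> z ` J = T \<and> P (restrict z I)} =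
     card {z \<in> I \<rightarrow>\<^sub>E A. inj_on z I \<and> z ` I = S \<and> P z} * card {z \<in> J \<rightarrow>\<^sub>E A. inj_on z J \<and> z ` J = T}"
proof -
  have "bij_betw (\<lambda>z. (restrict z I, restrict z J))
     {z \<in> I \<union> J \<rightarrow>\<^sub>E A. inj_on z (I \<union> J) \<and> z ` I = S \<and> z ` J = T \<and> P (restrict z I)}
     ({z \<in> I \<rightarrow>\<^sub>E A. inj_on z I \<and> z ` I = S \<and> P z} \<times> {z \<in> J \<rightarrow>\<^sub>E A. inj_on z J \<and> z ` J = T})" (is "bij_betw _ ?X (?Y \<times> ?Z)")
  proof (rule bij_betw_byWitness[where f'="merge I J"])
    show "\<forall>z\<in>?X. merge I J (restrict z I, restrict z J) = z"
      by (auto simp: merge_def fun_eq_iff PiE_iff extensional_def)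
    show "\<forall>w\<in>?Y \<times> ?Z. (restrict (merge I J w) I, restrict (merge I J w) J) = w"
      using assms(3) by (auto simp: merge_def fun_eq_iff PiE_iff extensional_def)
    show "(\<lambda>z. (restrict z I, restrict z J)) ` ?X \<subseteq> ?Y \<times> ?Z"
      by (auto simp: inj_on_def)
    show "merge I J ` (?Y \<times> ?Z) \<subseteq> ?X"
    proof (clarsimp, intro conjI)
      fix u v assume u: "u \<in> I \<rightarrow>\<^sub>E A" "inj_on u I" "S = u ` I" "P u"
        and v: "v \<in> J \<rightarrow>\<^sub>E A" "inj_on v J" "T = v ` J"
      have I: "merge I J (u, v) i = u i" if "i \<in> I" for i using that by (simp add: merge_def)
      have J: "merge I J (u, v) j = v j" if "j \<in> J" for j using that assms(3) by (auto simp: merge_def)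
      show "merge I J (u, v) \<in> I \<union> J \<rightarrow>\<^sub>E A" using u v I J by (auto simp: PiE_iff)
      show "inj_on (merge I J (u, v)) (I \<union> J)"
        using u v S(3) I J unfolding inj_on_def by (metis IntI UnE empty_iff imageI)
      show "merge I J (u, v) ` I = u ` I" using I by auto
      show "merge I J (u, v) ` J = v ` J" using J by auto
      have "restrict (merge I J (u, v)) I = u" using I u by (auto simp: PiE_iff extensional_def fun_eq_iff)
      then show "P (restrict (merge I J (u, v)) I)" using u by simp
    qed
  qed
  from bij_betw_same_card[OF this] show ?thesis by (simp only: card_cartesian_product)
qed

text \<open>
  A tuple of \<open>p + q - m\<close> distinct points determines the pair of sets \<open>S\<close>, formed by the first \<open>p\<close> entries,
  and \<open>T\<close>, formed by the first \<open>m\<close> and the last \<open>q - m\<close> entries. A pair with \<open>|S \<inter> T| = m\<close> comes from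
  the orderings of \<open>S \<inter> T\<close>, of \<open>S - T\<close> and of \<open>T - S\<close>.
\<close>

lemma sum_tuples_eq_sum_pairs:
  fixes \<phi> \<psi> :: "'a set \<Rightarrow> ennreal"
  assumes A: "finite A" and m: "m \<le> p" "m \<le> q"
  shows "(\<Sum>z\<in>{z \<in> {..<p+q-m} \<rightarrow>\<^sub>E A. inj_on z {..<p+q-m}}. \<phi> (z ` {..<p}) * \<psi> (z ` ({..<m} \<union> {p..<p+q-m}))) =
    of_nat (fact m * fact (p - m) * fact (q - m)) *
    (\<Sum>(S,T) | S \<subseteq> A \<and> T \<subseteq> A \<and> card S = p \<and> card T = q \<and> card (S \<inter> T) = m. \<phi> S * \<psi> T)"
proof -
  let ?N = "p + q - m"
  let ?Z = "{z \<in> {..<?N} \<rightarrow>\<^sub>E A. inj_on z {..<?N}}"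
  let ?R = "{(S,T). S \<subseteq> A \<and> T \<subseteq> A \<and> card S = p \<and> card T = q \<and> card (S \<inter> T) = m}"
  let ?h = "\<lambda>z. (z ` {..<p}, z ` ({..<m} \<union> {p..<?N}))"
  have finZ: "finite ?Z" by (rule finite_subset[OF _ finite_PiE[of "{..<?N}" "\<lambda>_. A"]]) (use A in auto)
  have finR: "finite ?R" by (rule finite_subset[of _ "Pow A \<times> Pow A"]) (use A in auto)
  have hZ: "?h ` ?Z \<subseteq> ?R"
  proof (rule image_subsetI)
    fix z assume "z \<in> ?Z"
    then have zA: "z \<in> {..<?N} \<rightarrow>\<^sub>E A" and inj: "inj_on z {..<?N}" by auto
    have sub: "{..<p} \<subseteq> {..<?N}" "{..<m} \<union> {p..<?N} \<subseteq> {..<?N}" using m by auto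
    have "card (z ` {..<p}) = p" using inj_on_subset[OF inj sub(1)] by (simp add: card_image)
    moreover have "card (z ` ({..<m} \<union> {p..<?N})) = q"
    proof -
      have "card ({..<m} \<union> {p..<?N}) = q" using m by (subst card_Un_disjoint) auto
      then show ?thesis using inj_on_subset[OF inj sub(2)] by (simp add: card_image)
    qed
    moreover have "card (z ` {..<p} \<inter> z ` ({..<m} \<union> {p..<?N})) = m"
    proof -
      have "z ` {..<p} \<inter> z ` ({..<m} \<union> {p..<?N}) = z ` ({..<p} \<inter> ({..<m} \<union> {p..<?N}))"
        using inj_on_image_Int[OF inj sub] by simp
      also have "{..<p} \<inter> ({..<m} \<union> {p..<?N}) = {..<m}" using m by auto
      finally show ?thesis using inj_on_subset[OF inj, of "{..<m}"] m by (simp add: card_image)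
    qed
    moreover have "z ` {..<p} \<subseteq> A" "z ` ({..<m} \<union> {p..<?N}) \<subseteq> A" using zA sub by auto
    ultimately show "?h z \<in> ?R" by auto
  qed
  have fiber: "card {z \<in> ?Z. ?h z = (S, T)} = fact m * fact (p - m) * fact (q - m)"
    if "(S, T) \<in> ?R" for S T
  proof -
    let ?I = "{..<m}" and ?J = "{m..<p}" and ?K = "{p..<?N}"
    let ?U = "S \<inter> T" and ?S = "S - T" and ?T = "T - S"
    have ST: "S \<subseteq> A" "T \<subseteq> A" "card S = p" "card T = q" "card ?U = m" using that by auto
    have fin: "finite S" "finite T" using ST A finite_subset by auto
    have cS: "card ?S = p - m" "card ?T = q - m"
      using ST fin by (auto simp: card_Diff_subset_Int Int_commute)
    have un: "?I \<union> ?J = {..<p}" "{..<p} \<union> ?K = {..<?N}" using m by auto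
    have eqY: "{z \<in> ?Z. ?h z = (S, T)} =
      {z \<in> {..<p} \<union> ?K \<rightarrow>\<^sub>E A. inj_on z ({..<p} \<union> ?K) \<and> z ` {..<p} = S \<and> z ` ?K = ?T \<and> restrict z {..<p} ` ?I = ?U \<and> restrict z {..<p} ` ?J = ?S}"
      (is "_ = ?Y")
    proof (intro set_eqI iffI)
      fix z assume "z \<in> {z \<in> ?Z. ?h z = (S, T)}"
      then have z: "z \<in> {..<?N} \<rightarrow>\<^sub>E A" "inj_on z {..<?N}" "z ` {..<p} = S" "z ` ?I \<union> z ` ?K = T"
        by (auto simp: image_Un)
      have im: "z ` ?I \<union> z ` ?J = S" using z(3) un(1) by (metis image_Un)
      have d: "z ` X \<inter> z ` Y = {}" if "X \<subseteq> {..<?N}" "Y \<subseteq> {..<?N}" "X \<inter> Y = {}" for X Y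
        using inj_on_image_Int[OF z(2) that(1,2)] that(3) by simp
      have "z ` {..<p} \<inter> z ` ?K = {}" "z ` ?I \<inter> z ` ?J = {}" "z ` ?J \<inter> z ` ?K = {}" "z ` ?I \<inter> z ` ?K = {}"
        by (rule d; use m in force)+
      then have "z ` ?K = ?T" "z ` ?I = ?U" "z ` ?J = ?S" using im z(3,4) by blast+
      moreover have "restrict z {..<p} ` ?I = z ` ?I" "restrict z {..<p} ` ?J = z ` ?J"
        using m by (auto simp: image_iff)
      ultimately show "z \<in> ?Y" using z(1-3) unfolding un by simp
    next
      fix z assume "z \<in> ?Y"
      moreover have "restrict z {..<p} ` ?I = z ` ?I" "restrict z {..<p} ` ?J = z ` ?J"
        using m by (auto simp: image_iff)
      ultimately have z: "z \<in> {..<?N} \<rightarrow>\<^sub>E A" "inj_on z {..<?N}" "z ` {..<p} = S" "z ` ?K = ?T" "z ` ?I = ?U"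
        unfolding un by simp_all
      then have "z ` (?I \<union> ?K) = T" unfolding image_Un by blast
      with z(1-3) show "z \<in> {z \<in> ?Z. ?h z = (S, T)}" by simp
    qed
    have "card {z \<in> ?Z. ?h z = (S, T)} = card ?Y" by (simp only: eqY)
    also have "\<dots> = card {z \<in> {..<p} \<rightarrow>\<^sub>E A. inj_on z {..<p} \<and> z ` {..<p} = S \<and> z ` ?I = ?U \<and> z ` ?J = ?S} *
        card {z \<in> ?K \<rightarrow>\<^sub>E A. inj_on z ?K \<and> z ` ?K = ?T}"
      by (rule card_onto_tuples_Un[where P="\<lambda>w. w ` ?I = ?U \<and> w ` ?J = ?S"]) (use fin in auto)
    also have "card {z \<in> {..<p} \<rightarrow>\<^sub>E A. inj_on z {..<p} \<and> z ` {..<p} = S \<and> z ` ?I = ?U \<and> z ` ?J = ?S} =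
       card {z \<in> ?I \<union> ?J \<rightarrow>\<^sub>E A. inj_on z (?I \<union> ?J) \<and> z ` ?I = ?U \<and> z ` ?J = ?S \<and> True}"
    proof -
      have "z ` {..<p} = z ` ?I \<union> z ` ?J" for z :: "nat \<Rightarrow> 'a" using un(1) by (metis image_Un)
      then show ?thesis unfolding un by (intro arg_cong[where f=card]) auto
    qed
    also have "\<dots> = card {z \<in> ?I \<rightarrow>\<^sub>E A. inj_on z ?I \<and> z ` ?I = ?U \<and> True} * card {z \<in> ?J \<rightarrow>\<^sub>E A. inj_on z ?J \<and> z ` ?J = ?S}"
      by (rule card_onto_tuples_Un[where P="\<lambda>_. True"]) (use fin in auto)
    also have "card {z \<in> ?I \<rightarrow>\<^sub>E A. inj_on z ?I \<and> z ` ?I = ?U \<and> True} = fact m"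
      using card_onto_tuples[of ?I ?U A] fin ST m by (simp add: le_infI1)
    also have "card {z \<in> ?J \<rightarrow>\<^sub>E A. inj_on z ?J \<and> z ` ?J = ?S} = fact (p - m)"
      using card_onto_tuples[of ?J ?S A] fin cS ST(1,2) m by (simp add: Diff_subset_conv le_supI2)
    also have "card {z \<in> ?K \<rightarrow>\<^sub>E A. inj_on z ?K \<and> z ` ?K = ?T} = fact (q - m)"
      using card_onto_tuples[of ?K ?T A] fin cS ST(1,2) m by (simp add: Diff_subset_conv le_supI2)
    finally show ?thesis .
  qed
  have "(\<Sum>z\<in>?Z. \<phi> (z ` {..<p}) * \<psi> (z ` ({..<m} \<union> {p..<?N}))) =
     (\<Sum>y\<in>?R. \<Sum>z\<in>{z\<in>?Z. ?h z = y}. \<phi> (z ` {..<p}) * \<psi> (z ` ({..<m} \<union> {p..<?N})))"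
    using sum.group[OF finZ finR hZ, of "\<lambda>z. \<phi> (z ` {..<p}) * \<psi> (z ` ({..<m} \<union> {p..<?N}))"] by simp
  also have "\<dots> = (\<Sum>y\<in>?R. \<Sum>z\<in>{z\<in>?Z. ?h z = y}. \<phi> (fst y) * \<psi> (snd y))"
    by (intro sum.cong refl) auto
  also have "\<dots> = (\<Sum>y\<in>?R. of_nat (fact m * fact (p - m) * fact (q - m)) * (\<phi> (fst y) * \<psi> (snd y)))"
  proof (intro sum.cong refl)
    fix y assume "y \<in> ?R"
    then show "(\<Sum>z\<in>{z\<in>?Z. ?h z = y}. \<phi> (fst y) * \<psi> (snd y)) =
       of_nat (fact m * fact (p - m) * fact (q - m)) * (\<phi> (fst y) * \<psi> (snd y))"
      using fiber[of "fst y" "snd y"] by (cases y) simp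
  qed
  also have "\<dots> = of_nat (fact m * fact (p - m) * fact (q - m)) *
    (\<Sum>(S,T) \<in> ?R. \<phi> S * \<psi> T)"
    by (simp add: sum_distrib_left split_def)
  finally show ?thesis .
qed

section \<open>Overlap integrals as inner products\<close>

text \<open>
  Two overlapping tuples are stored in one tuple of \<open>p + q - m\<close> points: first the \<open>m\<close> shared points, then
  the other \<open>p - m\<close> points of the first tuple, then the other \<open>q - m\<close> points of the second tuple. So the
  first tuple is an initial segment, and \<open>second_block\<close> recovers the second one.
\<close>

definition second_block :: "nat \<Rightarrow> nat \<Rightarrow> (nat \<Rightarrow> 'a) \<Rightarrow> nat \<Rightarrow> 'a" where
  "second_block p m z i = (if i < m then z i else z (i + p - m))"

lemma image_second_block:
  assumes "m \<le> p" "m \<le> q"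
  shows "second_block p m z ` {..<q} = z ` ({..<m} \<union> {p..<p+q-m})"
proof -
  have "{..<q} = {..<m} \<union> {m..<q}" using assms by auto
  moreover have "second_block p m z ` {..<m} = z ` {..<m}" by (auto simp: second_block_def)
  moreover have "second_block p m z ` {m..<q} = z ` {p..<p+q-m}"
  proof -
    have "(\<lambda>i. i + p - m) ` {m..<q} = {p..<p+q-m}"
    proof (intro set_eqI iffI)
      fix x assume "x \<in> {p..<p+q-m}"
      then show "x \<in> (\<lambda>i. i + p - m) ` {m..<q}" using assms by (intro image_eqI[of _ _ "x + m - p"]) auto
    qed (use assms in auto)
    then have "z ` {p..<p+q-m} = (\<lambda>i. z (i + p - m)) ` {m..<q}" by (metis image_image)
    also have "\<dots> = second_block p m z ` {m..<q}" by (intro image_cong) (auto simp: second_block_def)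
    finally show ?thesis by simp
  qed
  ultimately show ?thesis by (simp add: image_Un)
qed

lemma restrict_measurable_second_block:
  assumes "m \<le> p" "m \<le> q"
  shows "(\<lambda>z. restrict (second_block p m z) {..<q}) \<in> measurable (\<Pi>\<^sub>M i\<in>{..<p+q-m}. M) (\<Pi>\<^sub>M i\<in>{..<q}. M)"
proof (rule measurable_restrict)
  fix i assume "i \<in> {..<q}"
  then show "(\<lambda>z. second_block p m z i) \<in> measurable (\<Pi>\<^sub>M i\<in>{..<p+q-m}. M) M"
    using assms unfolding second_block_def by (cases "i < m") (auto intro!: measurable_component_singleton)
qed

definition depends_below :: "nat \<Rightarrow> ((nat \<Rightarrow> 'a) \<Rightarrow> 'b) \<Rightarrow> bool" where
  "depends_below p f \<longleftrightarrow> (\<forall>x. f (restrict x {..<p}) = f x)"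

lemma depends_belowD: "depends_below p f \<Longrightarrow> f (restrict x {..<p}) = f x"
  by (simp add: depends_below_def)

lemma depends_below_cong: "depends_below p f \<Longrightarrow> (\<And>i. i < p \<Longrightarrow> x i = y i) \<Longrightarrow> f x = f y"
  unfolding depends_below_def by (metis lessThan_iff restrict_ext)

lemma depends_below_measurable:
  assumes "depends_below p f" "f \<in> borel_measurable (\<Pi>\<^sub>M i\<in>{..<p}. M)" "{..<p} \<subseteq> I"
  shows "f \<in> borel_measurable (\<Pi>\<^sub>M i\<in>I. M)"
proof -
  have "(\<lambda>x. f (restrict x {..<p})) \<in> borel_measurable (\<Pi>\<^sub>M i\<in>I. M)"
    using assms by (intro measurable_compose[OF measurable_restrict_subset]) auto
  then show ?thesis by (simp add: depends_belowD[OF assms(1)])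
qed

text \<open>
  For uniform \<open>P\<close> on \<open>W\<close>, and \<open>f\<close>, \<open>g\<close> powers of simplex volumes, this is the finite-volume version of the
  constants \<open>\<mu>\<close> of the limiting covariance.
\<close>

definition overlap_integral :: "'a measure \<Rightarrow> nat \<Rightarrow> nat \<Rightarrow> nat \<Rightarrow> ((nat \<Rightarrow> 'a) \<Rightarrow> ennreal) \<Rightarrow> ((nat \<Rightarrow> 'a) \<Rightarrow> ennreal) \<Rightarrow> ennreal" where
  "overlap_integral P p q m f g = (\<integral>\<^sup>+z. f z * g (second_block p m z) \<partial>(\<Pi>\<^sub>M i\<in>{..<p+q-m}. P))"

definition section_integral :: "'a measure \<Rightarrow> nat \<Rightarrow> nat \<Rightarrow> ((nat \<Rightarrow> 'a) \<Rightarrow> ennreal) \<Rightarrow> (nat \<Rightarrow> 'a) \<Rightarrow> ennreal" where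
  "section_integral P m p f z = (\<integral>\<^sup>+u. f (merge {..<m} {m..<p} (z, u)) \<partial>(\<Pi>\<^sub>M i\<in>{m..<p}. P))"

lemma measurable_second_block_comp:
  assumes g: "depends_below q g" "g \<in> borel_measurable (\<Pi>\<^sub>M i\<in>{..<q}. M)" and m: "m \<le> p" "m \<le> q"
  shows "(\<lambda>z. g (second_block p m z)) \<in> borel_measurable (\<Pi>\<^sub>M i\<in>{..<p+q-m}. M)"
proof -
  have "(\<lambda>z. g (restrict (second_block p m z) {..<q})) \<in> borel_measurable (\<Pi>\<^sub>M i\<in>{..<p+q-m}. M)"
    by (rule measurable_compose[OF restrict_measurable_second_block[OF m] g(2)])
  then show ?thesis by (simp add: depends_belowD[OF g(1)])
qed

lemma section_integral_measurable:
  assumes "prob_space P" "f \<in> borel_measurable (\<Pi>\<^sub>M i\<in>{..<p}. P)" "m \<le> p"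
  shows "section_integral P m p f \<in> borel_measurable (\<Pi>\<^sub>M i\<in>{..<m}. P)"
proof -
  interpret P: prob_space P by fact
  interpret K: prob_space "\<Pi>\<^sub>M i\<in>{m..<p}. P" by (rule prob_space_PiM) (rule assms(1))
  have "{..<m} \<union> {m..<p} = {..<p}" using assms(3) by auto
  then have "(\<lambda>w. f (merge {..<m} {m..<p} w)) \<in> borel_measurable ((\<Pi>\<^sub>M i\<in>{..<m}. P) \<Otimes>\<^sub>M (\<Pi>\<^sub>M i\<in>{m..<p}. P))"
    using assms(2) measurable_merge[of "{..<m}" "{m..<p}" "\<lambda>_. P"] by (auto intro: measurable_compose)
  then have "(\<lambda>(z, u). f (merge {..<m} {m..<p} (z, u))) \<in> borel_measurable ((\<Pi>\<^sub>M i\<in>{..<m}. P) \<Otimes>\<^sub>M (\<Pi>\<^sub>M i\<in>{m..<p}. P))"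
    by (simp add: split_def)
  then show ?thesis unfolding section_integral_def by (intro K.borel_measurable_nn_integral) auto
qed

text \<open>
  Given the \<open>m\<close> shared points, the remaining points of the two tuples are integrated independently. The
  last \<open>q - m\<close> coordinates are renumbered from \<open>p, \<dots>\<close> to \<open>m, \<dots>\<close>.
\<close>

lemma overlap_integral_eq:
  assumes P: "prob_space P"
    and f: "depends_below p f" "f \<in> borel_measurable (\<Pi>\<^sub>M i\<in>{..<p}. P)"
    and g: "depends_below q g" "g \<in> borel_measurable (\<Pi>\<^sub>M i\<in>{..<q}. P)"
    and m: "m \<le> p" "m \<le> q"
  shows "overlap_integral P p q m f g =
    (\<integral>\<^sup>+z. section_integral P m p f z * section_integral P m q g z \<partial>(\<Pi>\<^sub>M i\<in>{..<m}. P))"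
proof -
  interpret P: prob_space P by fact
  interpret PP: product_sigma_finite "\<lambda>_::nat. P" by standard
  let ?N = "p + q - m"
  let ?I = "{..<m}" and ?J = "{m..<p}" and ?K = "{p..<?N}" and ?L = "{m..<q}"
  let ?G = "\<lambda>z. f z * g (second_block p m z)"
  have un: "{..<p} \<union> ?K = {..<?N}" "?I \<union> ?J = {..<p}" "?I \<union> ?L = {..<q}" using m by auto
  have disj: "{..<p} \<inter> ?K = {}" "?I \<inter> ?J = {}" by auto
  have fN: "f \<in> borel_measurable (\<Pi>\<^sub>M i\<in>{..<?N}. P)"
    by (rule depends_below_measurable[OF f]) (use m in auto)
  have gN: "(\<lambda>z. g (second_block p m z)) \<in> borel_measurable (\<Pi>\<^sub>M i\<in>{..<?N}. P)"
    by (rule measurable_second_block_comp[OF g m])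
  have G: "?G \<in> borel_measurable (\<Pi>\<^sub>M i\<in>{..<?N}. P)" using fN gN by measurable
  have reindex: "distr (Pi\<^sub>M ?K (\<lambda>_. P)) (\<Pi>\<^sub>M i\<in>?L. P) (\<lambda>w. \<lambda>i\<in>?L. w (i + p - m)) = (\<Pi>\<^sub>M i\<in>?L. P)"
    by (rule distr_PiM_reindex[where M="\<lambda>_. P"]) (use m P in \<open>auto simp: inj_on_def\<close>)
  have gm: "(\<lambda>u. g (merge ?I ?L (z, u))) \<in> borel_measurable (\<Pi>\<^sub>M i\<in>?L. P)" if "z \<in> space (\<Pi>\<^sub>M i\<in>?I. P)" for z
  proof -
    have "merge ?I ?L \<in> measurable ((\<Pi>\<^sub>M i\<in>?I. P) \<Otimes>\<^sub>M (\<Pi>\<^sub>M i\<in>?L. P)) (\<Pi>\<^sub>M i\<in>{..<q}. P)"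
      using measurable_merge[of ?I ?L "\<lambda>_. P"] un by simp
    then have "(\<lambda>w. g (merge ?I ?L w)) \<in> borel_measurable ((\<Pi>\<^sub>M i\<in>?I. P) \<Otimes>\<^sub>M (\<Pi>\<^sub>M i\<in>?L. P))"
      using g(2) by (rule measurable_compose)
    from measurable_Pair2[OF this that] show ?thesis by simp
  qed
  have inner: "(\<integral>\<^sup>+w. ?G (merge {..<p} ?K (x, w)) \<partial>(\<Pi>\<^sub>M i\<in>?K. P)) = f x * section_integral P m q g (restrict x ?I)"
    if "x \<in> space (\<Pi>\<^sub>M i\<in>{..<p}. P)" for x
  proof -
    have z: "restrict x ?I \<in> space (\<Pi>\<^sub>M i\<in>?I. P)" using that m by (auto simp: space_PiM PiE_iff)
    have "(\<integral>\<^sup>+w. ?G (merge {..<p} ?K (x, w)) \<partial>(\<Pi>\<^sub>M i\<in>?K. P)) =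
      (\<integral>\<^sup>+w. f x * g (merge ?I ?L (restrict x ?I, \<lambda>i\<in>?L. w (i + p - m))) \<partial>(\<Pi>\<^sub>M i\<in>?K. P))"
    proof (intro nn_integral_cong arg_cong2[where f="(*)"])
      fix w
      show "f (merge {..<p} ?K (x, w)) = f x"
        by (rule depends_below_cong[OF f(1)]) (simp add: merge_def)
      show "g (second_block p m (merge {..<p} ?K (x, w))) = g (merge ?I ?L (restrict x ?I, \<lambda>i\<in>?L. w (i + p - m)))"
        by (rule depends_below_cong[OF g(1)]) (use m in \<open>auto simp: merge_def second_block_def\<close>)
    qed
    also have "\<dots> = (\<integral>\<^sup>+u. f x * g (merge ?I ?L (restrict x ?I, u)) \<partial>distr (Pi\<^sub>M ?K (\<lambda>_. P)) (\<Pi>\<^sub>M i\<in>?L. P) (\<lambda>w. \<lambda>i\<in>?L. w (i + p - m)))"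
    proof -
      have T: "(\<lambda>w. \<lambda>i\<in>?L. w (i + p - m)) \<in> measurable (Pi\<^sub>M ?K (\<lambda>_. P)) (\<Pi>\<^sub>M i\<in>?L. P)"
        by (rule measurable_restrict) (use m in \<open>auto intro!: measurable_component_singleton\<close>)
      have F: "(\<lambda>u. f x * g (merge ?I ?L (restrict x ?I, u))) \<in> borel_measurable (\<Pi>\<^sub>M i\<in>?L. P)"
        using gm[OF z] by measurable
      show ?thesis using nn_integral_distr[OF T, of "\<lambda>u. f x * g (merge ?I ?L (restrict x ?I, u))"] F by simp
    qed
    also have "\<dots> = f x * section_integral P m q g (restrict x ?I)"
      unfolding reindex section_integral_def using gm[OF z] by (rule nn_integral_cmult)
    finally show ?thesis .
  qed
  have "overlap_integral P p q m f g = (\<integral>\<^sup>+x. (\<integral>\<^sup>+w. ?G (merge {..<p} ?K (x, w)) \<partial>(\<Pi>\<^sub>M i\<in>?K. P)) \<partial>(\<Pi>\<^sub>M i\<in>{..<p}. P))"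
    unfolding overlap_integral_def using PP.product_nn_integral_fold[of "{..<p}" ?K ?G] G disj unfolding un by simp
  also have "\<dots> = (\<integral>\<^sup>+x. f x * section_integral P m q g (restrict x ?I) \<partial>(\<Pi>\<^sub>M i\<in>{..<p}. P))"
    by (intro nn_integral_cong inner)
  also have "\<dots> = (\<integral>\<^sup>+z. (\<integral>\<^sup>+u. f (merge ?I ?J (z, u)) * section_integral P m q g (restrict (merge ?I ?J (z, u)) ?I) \<partial>(\<Pi>\<^sub>M i\<in>?J. P)) \<partial>(\<Pi>\<^sub>M i\<in>?I. P))"
  proof -
    have "(\<lambda>x. section_integral P m q g (restrict x ?I)) \<in> borel_measurable (\<Pi>\<^sub>M i\<in>{..<p}. P)"
      by (rule measurable_compose[OF measurable_restrict_subset section_integral_measurable[OF P g(2) m(2)]]) (use m in auto)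
    then have "(\<lambda>x. f x * section_integral P m q g (restrict x ?I)) \<in> borel_measurable (\<Pi>\<^sub>M i\<in>{..<p}. P)"
      using f(2) by measurable
    then show ?thesis using PP.product_nn_integral_fold[of ?I ?J "\<lambda>x. f x * section_integral P m q g (restrict x ?I)"]
      disj unfolding un by simp
  qed
  also have "\<dots> = (\<integral>\<^sup>+z. section_integral P m p f z * section_integral P m q g z \<partial>(\<Pi>\<^sub>M i\<in>?I. P))"
  proof (intro nn_integral_cong)
    fix z assume z: "z \<in> space (\<Pi>\<^sub>M i\<in>?I. P)"
    have "restrict (merge ?I ?J (z, u)) ?I = z" for u
      using z by (auto simp: space_PiM PiE_iff extensional_def fun_eq_iff merge_def)
    then have "(\<integral>\<^sup>+u. f (merge ?I ?J (z, u)) * section_integral P m q g (restrict (merge ?I ?J (z, u)) ?I) \<partial>(\<Pi>\<^sub>M i\<in>?J. P)) =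
      (\<integral>\<^sup>+u. f (merge ?I ?J (z, u)) * section_integral P m q g z \<partial>(\<Pi>\<^sub>M i\<in>?J. P))" by simp
    also have "\<dots> = section_integral P m p f z * section_integral P m q g z"
    proof -
      have "merge ?I ?J \<in> measurable ((\<Pi>\<^sub>M i\<in>?I. P) \<Otimes>\<^sub>M (\<Pi>\<^sub>M i\<in>?J. P)) (\<Pi>\<^sub>M i\<in>{..<p}. P)"
        using measurable_merge[of ?I ?J "\<lambda>_. P"] un by simp
      then have "(\<lambda>w. f (merge ?I ?J w)) \<in> borel_measurable ((\<Pi>\<^sub>M i\<in>?I. P) \<Otimes>\<^sub>M (\<Pi>\<^sub>M i\<in>?J. P))"
        using f(2) by (rule measurable_compose)
      from measurable_Pair2[OF this z] show ?thesis
        unfolding section_integral_def[of P m p] by (intro nn_integral_multc) simp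
    qed
    finally show "(\<integral>\<^sup>+u. f (merge ?I ?J (z, u)) * section_integral P m q g (restrict (merge ?I ?J (z, u)) ?I) \<partial>(\<Pi>\<^sub>M i\<in>?J. P)) =
       section_integral P m p f z * section_integral P m q g z" .
  qed
  finally show ?thesis .
qed

section \<open>Products of U-statistics\<close>

definition image_invariant :: "nat \<Rightarrow> ((nat \<Rightarrow> 'a) \<Rightarrow> 'b) \<Rightarrow> bool" where
  "image_invariant p f \<longleftrightarrow> (\<forall>x y. x ` {..<p} = y ` {..<p} \<longrightarrow> f x = f y)"

lemma image_invariant_depends_below: "image_invariant p f \<Longrightarrow> depends_below p f"
  unfolding image_invariant_def depends_below_def by (metis image_restrict_eq)

text \<open>
  A tuple function that only depends on the set of entries, regarded as a function of sets.
\<close>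

definition on_image :: "nat \<Rightarrow> ((nat \<Rightarrow> 'a) \<Rightarrow> 'b) \<Rightarrow> 'a set \<Rightarrow> 'b" where
  "on_image p f S = f (SOME z. z ` {..<p} = S)"

lemma on_image_eq: "image_invariant p f \<Longrightarrow> on_image p f (z ` {..<p}) = f z"
  unfolding on_image_def image_invariant_def by (metis (mono_tags, lifting) someI_ex)

lemma sum_inj_tuples_eq_subsets:
  fixes \<phi> :: "'a set \<Rightarrow> ennreal"
  assumes A: "finite A"
  shows "(\<Sum>z\<in>inj_tuples p A. \<phi> (z ` {..<p})) = of_nat (fact p) * (\<Sum>S | S \<subseteq> A \<and> card S = p. \<phi> S)"
proof -
  have "{(S,T). S \<subseteq> A \<and> T \<subseteq> A \<and> card S = p \<and> card T = 0 \<and> card (S \<inter> T) = 0} = {S. S \<subseteq> A \<and> card S = p} \<times> {{}}"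
    using A finite_subset by fastforce
  then show ?thesis
    using sum_tuples_eq_sum_pairs[OF A, where m=0 and p=p and q=0 and \<phi>=\<phi> and \<psi>="\<lambda>_. 1"]
    by (simp add: inj_tuples_def sum.cartesian_product[symmetric])
qed

text \<open>
  The weights \<open>1 / p!\<close> and \<open>1 / q!\<close> turn the sums over tuples into sums over subsets, and the pairs of
  subsets are sorted by the size of their intersection.
\<close>

lemma ustatistic_product:
  fixes f g :: "(nat \<Rightarrow> 'a) \<Rightarrow> ennreal"
  assumes A: "finite A" and f: "image_invariant p f" and g: "image_invariant q g"
  shows "(\<Sum>z\<in>inj_tuples p A. f z) / of_nat (fact p) * ((\<Sum>z\<in>inj_tuples q A. g z) / of_nat (fact q)) =
    (\<Sum>m\<le>min p q. (\<Sum>z\<in>inj_tuples (p + q - m) A. f z * g (second_block p m z)) / of_nat (fact m * fact (p - m) * fact (q - m)))"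
proof -
  let ?\<phi> = "on_image p f" and ?\<psi> = "on_image q g"
  let ?X = "{S. S \<subseteq> A \<and> card S = p}" and ?Y = "{T. T \<subseteq> A \<and> card T = q}"
  have fin: "finite ?X" "finite ?Y" using A by auto
  have canc: "of_nat (fact p) * x / of_nat (fact p) = x" for x :: ennreal and p :: nat
  proof -
    have "(of_nat (fact p) :: ennreal) \<noteq> 0" "(of_nat (fact p) :: ennreal) \<noteq> \<top>" by auto
    then show ?thesis by (metis ennreal_mult_divide_eq mult.commute)
  qed
  have 1: "(\<Sum>z\<in>inj_tuples p A. f z) / of_nat (fact p) = (\<Sum>S\<in>?X. ?\<phi> S)"
    using sum_inj_tuples_eq_subsets[OF A, where p=p and \<phi>="?\<phi>"] by (simp only: on_image_eq[OF f] canc)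
  have 2: "(\<Sum>z\<in>inj_tuples q A. g z) / of_nat (fact q) = (\<Sum>T\<in>?Y. ?\<psi> T)"
    using sum_inj_tuples_eq_subsets[OF A, where p=q and \<phi>="?\<psi>"] by (simp only: on_image_eq[OF g] canc)
  have "(\<Sum>S\<in>?X. ?\<phi> S) * (\<Sum>T\<in>?Y. ?\<psi> T) = (\<Sum>(S,T)\<in>?X \<times> ?Y. ?\<phi> S * ?\<psi> T)"
    by (simp add: sum_product sum.cartesian_product)
  also have "\<dots> = (\<Sum>m\<le>min p q. \<Sum>y\<in>{y \<in> ?X \<times> ?Y. (\<lambda>(S,T). card (S \<inter> T)) y = m}. (\<lambda>(S,T). ?\<phi> S * ?\<psi> T) y)"
  proof (rule sum.group[symmetric])
    show "(\<lambda>(S,T). card (S \<inter> T)) ` (?X \<times> ?Y) \<subseteq> {..min p q}"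
    proof safe
      fix S T assume "S \<subseteq> A" "T \<subseteq> A" "p = card S" "q = card T"
      then show "card (S \<inter> T) \<le> min (card S) (card T)" using A finite_subset by (metis card_mono inf_le1 inf_le2 min.bounded_iff)
    qed
  qed (use fin in auto)
  also have "\<dots> = (\<Sum>m\<le>min p q. (\<Sum>z\<in>inj_tuples (p + q - m) A. f z * g (second_block p m z)) / of_nat (fact m * fact (p - m) * fact (q - m)))"
  proof (intro sum.cong refl)
    fix m assume "m \<in> {..min p q}"
    then have m: "m \<le> p" "m \<le> q" by auto
    let ?c = "fact m * fact (p - m) * fact (q - m) :: nat"
    let ?R = "{(S,T). S \<subseteq> A \<and> T \<subseteq> A \<and> card S = p \<and> card T = q \<and> card (S \<inter> T) = m}"
    have R: "{y \<in> ?X \<times> ?Y. (\<lambda>(S,T). card (S \<inter> T)) y = m} = ?R" by auto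
    have "(\<Sum>z\<in>inj_tuples (p + q - m) A. f z * g (second_block p m z)) =
      (\<Sum>z\<in>inj_tuples (p + q - m) A. ?\<phi> (z ` {..<p}) * ?\<psi> (z ` ({..<m} \<union> {p..<p+q-m})))"
      unfolding image_second_block[OF m, symmetric] by (simp only: on_image_eq[OF f] on_image_eq[OF g])
    also have "\<dots> = of_nat ?c * (\<Sum>(S,T)\<in>?R. ?\<phi> S * ?\<psi> T)"
      unfolding inj_tuples_def by (rule sum_tuples_eq_sum_pairs[OF A m])
    finally have e: "(\<Sum>z\<in>inj_tuples (p + q - m) A. f z * g (second_block p m z)) = of_nat ?c * (\<Sum>(S,T)\<in>?R. ?\<phi> S * ?\<psi> T)" .
    have "(of_nat ?c :: ennreal) \<noteq> 0" by simp
    moreover have "(of_nat ?c :: ennreal) \<noteq> \<top>" by (rule ennreal_of_nat_neq_top)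
    ultimately have "of_nat ?c * x / of_nat ?c = x" for x :: ennreal
      by (metis ennreal_mult_divide_eq mult.commute)
    then show "(\<Sum>y\<in>{y \<in> ?X \<times> ?Y. (\<lambda>(S,T). card (S \<inter> T)) y = m}. (\<lambda>(S,T). ?\<phi> S * ?\<psi> T) y) =
      (\<Sum>z\<in>inj_tuples (p + q - m) A. f z * g (second_block p m z)) / of_nat ?c"
      unfolding e R by simp
  qed
  finally show ?thesis unfolding 1 2 .
qed

lemma poisson_ustatistic_product:
  fixes W :: "(real^'d) set"
  assumes pp: "poisson_process M W t \<eta>" and t: "0 \<le> t"
    and W: "W \<in> sets borel" "emeasure lborel W = 1"
    and f: "image_invariant p f" "f \<in> borel_measurable (\<Pi>\<^sub>M i\<in>{..<p}. borel)"
    and g: "image_invariant q g" "g \<in> borel_measurable (\<Pi>\<^sub>M i\<in>{..<q}. borel)"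
  shows "(\<integral>\<^sup>+\<omega>. (\<Sum>z\<in>inj_tuples p (\<eta> \<omega>). f z) / of_nat (fact p) * ((\<Sum>z\<in>inj_tuples q (\<eta> \<omega>). g z) / of_nat (fact q)) \<partial>M) =
    (\<Sum>m\<le>min p q. ennreal (t ^ (p + q - m) / (fact m * fact (p - m) * fact (q - m))) * overlap_integral (uniform_on W) p q m f g)"
proof -
  let ?h = "\<lambda>m z. f z * g (second_block p m z)"
  let ?c = "\<lambda>m. fact m * fact (p - m) * fact (q - m) :: nat"
  have h: "?h m \<in> borel_measurable (\<Pi>\<^sub>M i\<in>{..<p+q-m}. borel)" if "m \<le> min p q" for m
  proof -
    have "f \<in> borel_measurable (\<Pi>\<^sub>M i\<in>{..<p+q-m}. borel)"
      by (rule depends_below_measurable[OF image_invariant_depends_below[OF f(1)] f(2)]) (use that in auto)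
    moreover have "(\<lambda>z. g (second_block p m z)) \<in> borel_measurable (\<Pi>\<^sub>M i\<in>{..<p+q-m}. borel)"
      by (rule measurable_second_block_comp[OF image_invariant_depends_below[OF g(1)] g(2)]) (use that in auto)
    ultimately show ?thesis by measurable
  qed
  have fin: "finite (\<eta> \<omega>)" if "\<omega> \<in> space M" for \<omega> using pp that by (auto simp: poisson_process_def)
  have "(\<integral>\<^sup>+\<omega>. (\<Sum>z\<in>inj_tuples p (\<eta> \<omega>). f z) / of_nat (fact p) * ((\<Sum>z\<in>inj_tuples q (\<eta> \<omega>). g z) / of_nat (fact q)) \<partial>M) =
    (\<integral>\<^sup>+\<omega>. (\<Sum>m\<le>min p q. (\<Sum>z\<in>inj_tuples (p + q - m) (\<eta> \<omega>). ?h m z) / of_nat (?c m)) \<partial>M)"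
    by (intro nn_integral_cong ustatistic_product fin f(1) g(1))
  also have "\<dots> = (\<Sum>m\<le>min p q. \<integral>\<^sup>+\<omega>. (\<Sum>z\<in>inj_tuples (p + q - m) (\<eta> \<omega>). ?h m z) / of_nat (?c m) \<partial>M)"
  proof (rule nn_integral_sum)
    fix m assume "m \<in> {..min p q}"
    then have "(\<lambda>\<omega>. \<Sum>z\<in>inj_tuples (p + q - m) (\<eta> \<omega>). ?h m z) \<in> borel_measurable M"
      using poisson_tuple_sum[OF pp t W h, of m] by simp
    then show "(\<lambda>\<omega>. (\<Sum>z\<in>inj_tuples (p + q - m) (\<eta> \<omega>). ?h m z) / of_nat (?c m)) \<in> borel_measurable M"
      by measurable
  qed
  also have "\<dots> = (\<Sum>m\<le>min p q. ennreal (t ^ (p + q - m) / (fact m * fact (p - m) * fact (q - m))) * overlap_integral (uniform_on W) p q m f g)"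
  proof (intro sum.cong refl)
    fix m assume "m \<in> {..min p q}"
    then have m: "m \<le> min p q" by simp
    note T = poisson_tuple_sum[OF pp t W h[OF m]]
    have "(\<integral>\<^sup>+\<omega>. (\<Sum>z\<in>inj_tuples (p + q - m) (\<eta> \<omega>). ?h m z) / of_nat (?c m) \<partial>M) =
      (\<integral>\<^sup>+\<omega>. (\<Sum>z\<in>inj_tuples (p + q - m) (\<eta> \<omega>). ?h m z) \<partial>M) / of_nat (?c m)"
      by (rule nn_integral_divide) (use T in simp)
    also have "\<dots> = ennreal (t ^ (p + q - m)) * overlap_integral (uniform_on W) p q m f g / of_nat (?c m)"
      using T by (simp add: overlap_integral_def)
    also have "\<dots> = ennreal (t ^ (p + q - m)) / ennreal (real (?c m)) * overlap_integral (uniform_on W) p q m f g"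
      by (simp add: divide_ennreal_def mult_ac ennreal_of_nat_eq_real_of_nat)
    also have "ennreal (t ^ (p + q - m)) / ennreal (real (?c m)) = ennreal (t ^ (p + q - m) / (fact m * fact (p - m) * fact (q - m)))"
      using t by (subst divide_ennreal) auto
    finally show "(\<integral>\<^sup>+\<omega>. (\<Sum>z\<in>inj_tuples (p + q - m) (\<eta> \<omega>). ?h m z) / of_nat (?c m) \<partial>M) =
      ennreal (t ^ (p + q - m) / (fact m * fact (p - m) * fact (q - m))) * overlap_integral (uniform_on W) p q m f g" .
  qed
  finally show ?thesis .
qed

section \<open>Translation, scaling and the boundary\<close>

lemma lborel_box_affine:
  fixes x :: "'a::euclidean_space"
  assumes r: "r > 0" and A: "A \<in> sets borel"
  shows "ennreal (r ^ DIM('a)) * emeasure lborel {u. x + r *\<^sub>R u \<in> A} = emeasure lborel A"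
proof -
  have "emeasure lborel A = emeasure (density (distr lborel borel (\<lambda>u. x + r *\<^sub>R u)) (\<lambda>_. \<bar>r\<bar> ^ DIM('a))) A"
    using lborel_affine[of r x] r by simp
  also have "\<dots> = ennreal (r ^ DIM('a)) * emeasure (distr lborel borel (\<lambda>u. x + r *\<^sub>R u)) A"
    using r A by (subst emeasure_density) (auto simp: nn_integral_cmult_indicator)
  also have "emeasure (distr lborel borel (\<lambda>u. x + r *\<^sub>R u)) A = emeasure lborel {u. x + r *\<^sub>R u \<in> A}"
    using A by (subst emeasure_distr) (auto simp: vimage_def)
  finally show ?thesis by simp
qed

lemma PiM_lborel_affine:
  fixes x :: "'a::euclidean_space"
  assumes r: "r > 0" and I: "finite I" and f: "f \<in> borel_measurable (\<Pi>\<^sub>M i\<in>I. (borel :: 'a measure))"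
  shows "(\<integral>\<^sup>+u. f u \<partial>(\<Pi>\<^sub>M i\<in>I. lborel)) =
    ennreal (r ^ (DIM('a) * card I)) * (\<integral>\<^sup>+u. f (\<lambda>i\<in>I. x + r *\<^sub>R u i) \<partial>(\<Pi>\<^sub>M i\<in>I. lborel))"
proof -
  interpret PP: product_sigma_finite "\<lambda>_. lborel :: 'a measure" by standard
  let ?L = "\<Pi>\<^sub>M i\<in>I. lborel :: 'a measure" and ?T = "\<lambda>u. \<lambda>i\<in>I. x + r *\<^sub>R u i"
  let ?c = "ennreal (r ^ (DIM('a) * card I))"
  have c: "?c = (\<Prod>i\<in>I. ennreal (r ^ DIM('a)))"
    using r by (simp add: power_mult ennreal_power)
  have T[measurable]: "?T \<in> measurable ?L ?L" by (rule measurable_restrict) simp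
  have "density (distr ?L ?L ?T) (\<lambda>_. ?c) = ?L"
  proof (rule PP.PiM_eqI[OF I])
    fix A assume A: "\<And>i. i \<in> I \<Longrightarrow> A i \<in> sets (lborel :: 'a measure)"
    have As: "Pi\<^sub>E I A \<in> sets ?L" using A I by (intro sets_PiM_I_finite) auto
    have "emeasure (density (distr ?L ?L ?T) (\<lambda>_. ?c)) (Pi\<^sub>E I A) = ?c * emeasure ?L (?T -` Pi\<^sub>E I A \<inter> space ?L)"
      using As by (subst emeasure_density) (auto simp: nn_integral_cmult_indicator emeasure_distr)
    also have "?T -` Pi\<^sub>E I A \<inter> space ?L = Pi\<^sub>E I (\<lambda>i. {u. x + r *\<^sub>R u \<in> A i})"
      by (auto simp: space_PiM PiE_iff)
    also have "emeasure ?L \<dots> = (\<Prod>i\<in>I. emeasure lborel {u. x + r *\<^sub>R u \<in> A i})"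
    proof (rule PP.emeasure_PiM[OF I])
      fix i assume "i \<in> I"
      then have "A i \<in> sets borel" using A by simp
      from measurable_sets[OF _ this, of "\<lambda>u. x + r *\<^sub>R u" borel]
      show "{u. x + r *\<^sub>R u \<in> A i} \<in> sets lborel" by (simp add: vimage_def)
    qed
    also have "?c * (\<Prod>i\<in>I. emeasure lborel {u. x + r *\<^sub>R u \<in> A i}) = (\<Prod>i\<in>I. emeasure lborel (A i))"
      unfolding c prod.distrib[symmetric] using A by (intro prod.cong refl lborel_box_affine[OF r]) auto
    finally show "emeasure (density (distr ?L ?L ?T) (\<lambda>_. ?c)) (Pi\<^sub>E I A) = (\<Prod>i\<in>I. emeasure lborel (A i))" .
  qed simp
  moreover have fL: "f \<in> borel_measurable ?L" using f by (simp cong: measurable_cong_sets sets_PiM_cong)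
  then have "(\<integral>\<^sup>+u. f u \<partial>density (distr ?L ?L ?T) (\<lambda>_. ?c)) = ?c * (\<integral>\<^sup>+u. f (?T u) \<partial>?L)"
    by (subst nn_integral_density) (auto simp: nn_integral_distr nn_integral_cmult)
  ultimately show ?thesis by simp
qed

lemma PiM_uniform_on:
  fixes W :: "'a::euclidean_space set"
  assumes W: "W \<in> sets borel" "emeasure lborel W = 1" and I: "finite I"
    and f: "f \<in> borel_measurable (\<Pi>\<^sub>M i\<in>I. (borel :: 'a measure))"
  shows "(\<integral>\<^sup>+u. f u \<partial>(\<Pi>\<^sub>M i\<in>I. uniform_on W)) =
    (\<integral>\<^sup>+u. indicator {u. \<forall>i\<in>I. u i \<in> W} u * f u \<partial>(\<Pi>\<^sub>M i\<in>I. lborel))"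
proof -
  interpret PL: product_sigma_finite "\<lambda>_. lborel :: 'a measure" by standard
  interpret U: prob_space "uniform_on W" by (rule prob_space_uniform_on[OF W(2)])
  interpret PP: product_sigma_finite "\<lambda>_. uniform_on W" by standard
  let ?L = "\<Pi>\<^sub>M i\<in>I. lborel :: 'a measure" and ?h = "indicator {u. \<forall>i\<in>I. u i \<in> W} :: _ \<Rightarrow> ennreal"
  have ind: "?h = (\<lambda>u. \<Prod>i\<in>I. indicator W (u i))"
    using I by (auto simp: fun_eq_iff indicator_def prod_zero_iff)
  have h[measurable]: "?h \<in> borel_measurable ?L"
    unfolding ind using W(1) by measurable
  have "density ?L ?h = (\<Pi>\<^sub>M i\<in>I. uniform_on W)"
  proof (rule PP.PiM_eqI[OF I])
    show "sets (density ?L ?h) = sets (\<Pi>\<^sub>M i\<in>I. uniform_on W)"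
      by (simp cong: sets_PiM_cong)
    fix A assume "\<And>i. i \<in> I \<Longrightarrow> A i \<in> sets (uniform_on W)"
    then have A: "\<And>i. i \<in> I \<Longrightarrow> A i \<in> sets borel" by simp
    have As: "Pi\<^sub>E I A \<in> sets ?L" using A I by (intro sets_PiM_I_finite) auto
    have "emeasure (density ?L ?h) (Pi\<^sub>E I A) = (\<integral>\<^sup>+u. ?h u * indicator (Pi\<^sub>E I A) u \<partial>?L)"
      by (rule emeasure_density[OF h As])
    also have "\<dots> = (\<integral>\<^sup>+u. indicator (Pi\<^sub>E I (\<lambda>i. W \<inter> A i)) u \<partial>?L)"
      by (intro nn_integral_cong) (auto simp: indicator_def space_PiM PiE_iff)
    also have "\<dots> = emeasure ?L (Pi\<^sub>E I (\<lambda>i. W \<inter> A i))"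
      by (rule nn_integral_indicator) (use A W I in \<open>auto intro!: sets_PiM_I_finite\<close>)
    also have "\<dots> = (\<Prod>i\<in>I. emeasure lborel (W \<inter> A i))"
      by (rule PL.emeasure_PiM[OF I]) (use A W in auto)
    also have "\<dots> = (\<Prod>i\<in>I. emeasure (uniform_on W) (A i))"
      using A by (intro prod.cong refl emeasure_uniform_on[symmetric] W) auto
    finally show "emeasure (density ?L ?h) (Pi\<^sub>E I A) = (\<Prod>i\<in>I. emeasure (uniform_on W) (A i))" .
  qed
  moreover have fL: "f \<in> borel_measurable ?L" using f by (simp cong: measurable_cong_sets sets_PiM_cong)
  ultimately show ?thesis by (metis nn_integral_density[OF h fL])
qed

text \<open>
  The points of \<open>W\<close> from which a simplex of diameter at most \<open>s\<close> cannot leave \<open>W\<close>.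
\<close>

definition erosion :: "real \<Rightarrow> 'a::metric_space set \<Rightarrow> 'a set" where
  "erosion s W = {x. cball x s \<subseteq> W}"

lemma erosion_subset: "0 \<le> s \<Longrightarrow> erosion s W \<subseteq> W"
  by (auto simp: erosion_def)

lemma erosion_mono: "s \<le> s' \<Longrightarrow> erosion s' W \<subseteq> erosion s W"
  unfolding erosion_def using subset_cball by blast

lemma erosion_closed:
  fixes W :: "'a::real_normed_vector set"
  assumes "closed W"
  shows "closed (erosion s W)"
proof -
  have "erosion s W = (\<Inter>y\<in>cball 0 s. (+) (- y) ` W)"
  proof (intro set_eqI iffI)
    fix x assume x: "x \<in> erosion s W"
    show "x \<in> (\<Inter>y\<in>cball 0 s. (+) (- y) ` W)"
    proof
      fix y :: 'a assume "y \<in> cball 0 s"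
      then have "x + y \<in> W" using x by (auto simp: erosion_def dist_norm)
      then show "x \<in> (+) (- y) ` W" by (intro image_eqI[of _ _ "x + y"]) auto
    qed
  next
    fix x assume x: "x \<in> (\<Inter>y\<in>cball 0 s. (+) (- y) ` W)"
    show "x \<in> erosion s W"
      unfolding erosion_def
    proof safe
      fix z assume "z \<in> cball x s"
      then have "z - x \<in> cball 0 s" by (simp add: dist_norm norm_minus_commute)
      then have "x \<in> (+) (- (z - x)) ` W" using x by blast
      then show "z \<in> W" by auto
    qed
  qed
  then show ?thesis using assms by (auto intro!: closed_INT closed_translation_subtract)
qed

text \<open>
  The eroded sets exhaust the interior of \<open>W\<close>, and the frontier of a convex set is a null set.
\<close>

lemma erosion_volume_tendsto:
  fixes W :: "(real^'d) set" and \<delta> :: "real \<Rightarrow> real"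
  assumes W: "compact W" "convex W" "measure lborel W = 1"
    and \<delta>: "(\<delta> \<longlongrightarrow> 0) at_top" "\<forall>t>0. \<delta> t > 0"
  shows "((\<lambda>t. measure lborel (erosion (\<delta> t) W)) \<longlongrightarrow> 1) at_top"
proof -
  have cW: "closed W" using W compact_imp_closed by blast
  have er: "erosion s W \<in> sets borel" for s using erosion_closed[OF cW] by auto
  have WL: "W \<in> fmeasurable lborel" using W(1) by (intro fmeasurable_compact) auto
  have le1: "measure lborel (erosion s W) \<le> 1" if "0 \<le> s" for s
    using measure_mono_fmeasurable[OF erosion_subset[OF that] _ WL] er W(3) by simp
  \<comment> \<open>Monotonicity in \<open>s\<close> reduces the limit to the sequence \<open>s = 1/(n+1)\<close>.\<close>
  let ?E = "\<lambda>n. erosion (1 / real (Suc n)) W"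
  have inc: "incseq ?E"
    unfolding incseq_def by (auto intro!: erosion_mono frac_le)
  have "interior W \<subseteq> (\<Union>n. ?E n)"
  proof
    fix x assume "x \<in> interior W"
    then obtain e where e: "e > 0" "cball x e \<subseteq> W" using mem_interior_cball by blast
    then obtain n where "1 / real (Suc n) < e" using nat_approx_posE by blast
    then have "x \<in> ?E n" using e subset_cball[of "1 / real (Suc n)" e x] unfolding erosion_def by auto
    then show "x \<in> (\<Union>n. ?E n)" by blast
  qed
  moreover have "measure lborel (interior W) = 1"
  proof -
    have "negligible (frontier W)" by (rule negligible_convex_frontier[OF W(2)])
    then have "measure lebesgue (interior W) = measure lebesgue W"
      by (intro measure_interior) (use W compact_imp_bounded in auto)
    then show ?thesis using W cW by simp
  qed
  moreover have sub: "(\<Union>n. ?E n) \<subseteq> W" using erosion_subset[of "1 / real (Suc _)" W] by fastforce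
  ultimately have U: "measure lborel (\<Union>n. ?E n) = 1"
  proof -
    have m: "(\<Union>n. ?E n) \<in> fmeasurable lborel" using sub er by (intro fmeasurableI2[OF WL]) auto
    have "measure lborel (interior W) \<le> measure lborel (\<Union>n. ?E n)"
      using \<open>interior W \<subseteq> (\<Union>n. ?E n)\<close> m by (intro measure_mono_fmeasurable) auto
    moreover have "measure lborel (\<Union>n. ?E n) \<le> measure lborel W"
      using sub m WL by (intro measure_mono_fmeasurable) auto
    ultimately show ?thesis using \<open>measure lborel (interior W) = 1\<close> W(3) by simp
  qed
  have "(\<lambda>n. measure lborel (?E n)) \<longlonglongrightarrow> measure lborel (\<Union>n. ?E n)"
  proof (rule Lim_measure_incseq[OF _ inc])
    show "range ?E \<subseteq> sets lborel" using er by auto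
    have "emeasure lborel (\<Union>n. ?E n) \<le> emeasure lborel W" using sub cW by (intro emeasure_mono) auto
    then show "emeasure lborel (\<Union>n. ?E n) \<noteq> \<infinity>"
      using WL by (auto simp: fmeasurable_def top_unique)
  qed
  then have lim: "(\<lambda>n. measure lborel (?E n)) \<longlonglongrightarrow> 1" using U by simp
  show ?thesis
  proof (rule order_tendstoI)
    fix a :: real assume "a < 1"
    then obtain n where n: "a < measure lborel (?E n)"
      using order_tendstoD(1)[OF lim] by (meson eventually_sequentially order_refl)
    have "\<forall>\<^sub>F t in at_top. \<delta> t < 1 / real (Suc n)" using order_tendstoD(2)[OF \<delta>(1)] by simp
    moreover have "\<forall>\<^sub>F t in at_top. \<delta> t > 0" by (rule eventually_mono[OF eventually_gt_at_top[of 0]]) (use \<delta>(2) in auto)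
    ultimately show "\<forall>\<^sub>F t in at_top. a < measure lborel (erosion (\<delta> t) W)"
    proof eventually_elim
      fix t assume t: "\<delta> t < 1 / real (Suc n)" "0 < \<delta> t"
      have "erosion (\<delta> t) W \<in> fmeasurable lborel"
        using erosion_subset[of "\<delta> t" W] er t by (intro fmeasurableI2[OF WL]) auto
      then have "measure lborel (?E n) \<le> measure lborel (erosion (\<delta> t) W)"
        using erosion_mono[of "\<delta> t" "1 / real (Suc n)" W] er t by (intro measure_mono_fmeasurable) auto
      then show "a < measure lborel (erosion (\<delta> t) W)" using n by simp
    qed
  next
    fix a :: real assume "a > 1"
    have "\<forall>\<^sub>F t in at_top. \<delta> t > 0" by (rule eventually_mono[OF eventually_gt_at_top[of 0]]) (use \<delta>(2) in auto)
    then show "\<forall>\<^sub>F t in at_top. measure lborel (erosion (\<delta> t) W) < a"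
    proof eventually_elim
      fix t assume "0 < \<delta> t"
      then show "measure lborel (erosion (\<delta> t) W) < a" using le1[of "\<delta> t"] \<open>a > 1\<close> by simp
    qed
  qed
qed

text \<open>
  For a translation-invariant \<open>f\<close>, the integral over configurations of \<open>n + 1\<close> points per unit volume.
\<close>

definition based_integral :: "nat \<Rightarrow> ((nat \<Rightarrow> 'a::euclidean_space) \<Rightarrow> ennreal) \<Rightarrow> ennreal" where
  "based_integral n f = (\<integral>\<^sup>+u. f (u(0 := 0)) \<partial>(\<Pi>\<^sub>M i\<in>{1..<Suc n}. lborel))"

text \<open>
  A kernel \<open>f\<close> of range \<open>s\<close> that is the image of a kernel \<open>g\<close> of range \<open>1\<close> under scaling, up to a factor
  \<open>c\<close>. Its integral over \<open>W\<close> with a fixed first point \<open>x\<close> is at most the integral over the whole space, which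
  does not depend on \<open>x\<close>, and it is equal to it for \<open>x\<close> in the eroded set.
\<close>

locale local_homogeneous_kernel =
  fixes W :: "'a::euclidean_space set" and s :: real and n :: nat
    and f g :: "(nat \<Rightarrow> 'a) \<Rightarrow> ennreal" and c :: ennreal
  assumes W: "W \<in> sets borel" "emeasure lborel W = 1" "closed W" and s: "s > 0"
    and f: "depends_below (Suc n) f" "f \<in> borel_measurable (\<Pi>\<^sub>M i\<in>{..<Suc n}. borel)"
    and g: "g \<in> borel_measurable (\<Pi>\<^sub>M i\<in>{..<Suc n}. borel)"
    and hom: "\<And>x u. f (\<lambda>i. x + s *\<^sub>R u i) = c * g u"
    and supp: "\<And>z i. f z \<noteq> 0 \<Longrightarrow> i \<le> n \<Longrightarrow> norm (z i - z 0) \<le> s"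
begin

definition "scaled_mass = ennreal (s ^ (DIM('a) * n)) * (c * based_integral n g)"

abbreviation "J \<equiv> {1..<Suc n}"

lemma insert_J: "insert 0 J = {..<Suc n}" by auto

lemma measurable_upd: "(\<lambda>u. u(0 := x)) \<in> measurable (\<Pi>\<^sub>M i\<in>J. (borel :: 'a measure)) (\<Pi>\<^sub>M i\<in>{..<Suc n}. borel)"
  by (rule measurable_fun_upd[where J=J]) auto

lemma f_upd: "(\<lambda>u. f (u(0 := x))) \<in> borel_measurable (\<Pi>\<^sub>M i\<in>J. borel)"
  by (rule measurable_compose[OF measurable_upd f(2)])

lemma whole_space: "(\<integral>\<^sup>+u. f (u(0 := x)) \<partial>(\<Pi>\<^sub>M i\<in>J. lborel)) = scaled_mass"
proof -
  have gm: "(\<lambda>u. g (u(0 := 0))) \<in> borel_measurable (\<Pi>\<^sub>M i\<in>J. lborel)"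
    using measurable_compose[OF measurable_upd g, of 0] by (simp cong: measurable_cong_sets sets_PiM_cong)
  have eq: "f ((\<lambda>i\<in>J. x + s *\<^sub>R u i)(0 := x)) = c * g (u(0 := 0))" for u
  proof -
    have "f ((\<lambda>i\<in>J. x + s *\<^sub>R u i)(0 := x)) = f (\<lambda>i. x + s *\<^sub>R (u(0 := 0)) i)"
      by (rule depends_below_cong[OF f(1)]) auto
    then show ?thesis by (simp only: hom)
  qed
  have "(\<integral>\<^sup>+u. f (u(0 := x)) \<partial>(\<Pi>\<^sub>M i\<in>J. lborel)) =
    ennreal (s ^ (DIM('a) * card J)) * (\<integral>\<^sup>+u. f ((\<lambda>i\<in>J. x + s *\<^sub>R u i)(0 := x)) \<partial>(\<Pi>\<^sub>M i\<in>J. lborel))"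
    by (rule PiM_lborel_affine[OF s _ f_upd]) simp
  also have "(\<integral>\<^sup>+u. f ((\<lambda>i\<in>J. x + s *\<^sub>R u i)(0 := x)) \<partial>(\<Pi>\<^sub>M i\<in>J. lborel)) = c * based_integral n g"
    unfolding eq based_integral_def by (rule nn_integral_cmult[OF gm])
  finally show ?thesis by (simp only: scaled_mass_def card_atLeastLessThan diff_Suc_1)
qed

lemma uniform_eq: "(\<integral>\<^sup>+u. f (u(0 := x)) \<partial>(\<Pi>\<^sub>M i\<in>J. uniform_on W)) =
    (\<integral>\<^sup>+u. indicator {u. \<forall>i\<in>J. u i \<in> W} u * f (u(0 := x)) \<partial>(\<Pi>\<^sub>M i\<in>J. lborel))"
  by (rule PiM_uniform_on[OF W(1,2) _ f_upd]) simp

lemma inner_le: "(\<integral>\<^sup>+u. f (u(0 := x)) \<partial>(\<Pi>\<^sub>M i\<in>J. uniform_on W)) \<le> scaled_mass"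
  unfolding uniform_eq whole_space[of x, symmetric]
  by (intro nn_integral_mono) (auto simp: indicator_def)

lemma inner_eq:
  assumes "x \<in> erosion s W"
  shows "(\<integral>\<^sup>+u. f (u(0 := x)) \<partial>(\<Pi>\<^sub>M i\<in>J. uniform_on W)) = scaled_mass"
  unfolding uniform_eq whole_space[of x, symmetric]
proof (intro nn_integral_cong)
  fix u :: "nat \<Rightarrow> 'a"
  have "u i \<in> W" if "f (u(0 := x)) \<noteq> 0" "i \<in> J" for i
  proof -
    have "norm (u i - x) \<le> s" using supp[OF that(1), of i] that(2) by auto
    then have "u i \<in> cball x s" by (simp add: dist_norm norm_minus_commute)
    then show ?thesis using assms by (auto simp: erosion_def)
  qed
  then show "indicator {u. \<forall>i\<in>J. u i \<in> W} u * f (u(0 := x)) = f (u(0 := x))"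
    by (cases "f (u(0 := x)) = 0") (auto simp: indicator_def)
qed

lemma total_eq: "(\<integral>\<^sup>+z. f z \<partial>(\<Pi>\<^sub>M i\<in>{..<Suc n}. uniform_on W)) =
   (\<integral>\<^sup>+x. (\<integral>\<^sup>+u. f (u(0 := x)) \<partial>(\<Pi>\<^sub>M i\<in>J. uniform_on W)) \<partial>uniform_on W)"
proof -
  interpret U: prob_space "uniform_on W" by (rule prob_space_uniform_on[OF W(2)])
  interpret PP: product_sigma_finite "\<lambda>_::nat. uniform_on W" by standard
  have "f \<in> borel_measurable (\<Pi>\<^sub>M i\<in>insert 0 J. uniform_on W)"
    using f(2) unfolding insert_J by (simp cong: measurable_cong_sets sets_PiM_cong)
  from PP.product_nn_integral_insert_rev[OF _ _ this] show ?thesis unfolding insert_J by simp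
qed

lemma total_le: "(\<integral>\<^sup>+z. f z \<partial>(\<Pi>\<^sub>M i\<in>{..<Suc n}. uniform_on W)) \<le> scaled_mass"
proof -
  interpret U: prob_space "uniform_on W" by (rule prob_space_uniform_on[OF W(2)])
  have "(\<integral>\<^sup>+z. f z \<partial>(\<Pi>\<^sub>M i\<in>{..<Suc n}. uniform_on W)) \<le> (\<integral>\<^sup>+x. scaled_mass \<partial>uniform_on W)"
    unfolding total_eq by (intro nn_integral_mono inner_le)
  also have "\<dots> = scaled_mass" using U.emeasure_space_1 by simp
  finally show ?thesis .
qed

lemma emeasure_erosion: "emeasure (uniform_on W) (erosion s W) = ennreal (measure lborel (erosion s W))"
proof -
  have er: "erosion s W \<in> sets borel" using erosion_closed[OF W(3)] by auto
  have sub: "erosion s W \<subseteq> W" using s by (intro erosion_subset) auto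
  then have "emeasure (uniform_on W) (erosion s W) = emeasure lborel (erosion s W)"
    using er by (subst emeasure_uniform_on[OF W(1,2)]) (auto simp: Int_absorb1)
  moreover have "emeasure lborel (erosion s W) \<le> 1"
    using emeasure_mono[OF sub, of lborel] W by simp
  then have "emeasure lborel (erosion s W) = ennreal (measure lborel (erosion s W))"
    by (intro emeasure_eq_ennreal_measure) (auto simp: top_unique)
  ultimately show ?thesis by (simp only:)
qed

lemma total_ge: "ennreal (measure lborel (erosion s W)) * scaled_mass \<le> (\<integral>\<^sup>+z. f z \<partial>(\<Pi>\<^sub>M i\<in>{..<Suc n}. uniform_on W))"
proof -
  have er: "erosion s W \<in> sets borel" using erosion_closed[OF W(3)] by auto
  have "ennreal (measure lborel (erosion s W)) * scaled_mass = (\<integral>\<^sup>+x. scaled_mass * indicator (erosion s W) x \<partial>uniform_on W)"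
    using er by (subst nn_integral_cmult_indicator) (auto simp: emeasure_erosion mult.commute simp del: emeasure_uniform_measure)
  also have "\<dots> \<le> (\<integral>\<^sup>+z. f z \<partial>(\<Pi>\<^sub>M i\<in>{..<Suc n}. uniform_on W))"
    unfolding total_eq
  proof (intro nn_integral_mono)
    fix x
    show "scaled_mass * indicator (erosion s W) x \<le> (\<integral>\<^sup>+u. f (u(0 := x)) \<partial>(\<Pi>\<^sub>M i\<in>J. uniform_on W))"
    proof (cases "x \<in> erosion s W")
      case True
      then show ?thesis by (simp only: inner_eq indicator_simps mult_1_right order_refl)
    qed simp
  qed
  finally show ?thesis .
qed

end

section \<open>Linear independence of powers of simplex volumes\<close>

text \<open>
  Divide by the power of the largest \<open>\<theta>\<close> that occurs and let \<open>j \<rightarrow> \<infinity>\<close>.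
\<close>

lemma exponential_sum_zero:
  fixes \<theta> c :: "'i \<Rightarrow> real"
  assumes L: "finite L" and pos: "\<And>l. l \<in> L \<Longrightarrow> 0 < \<theta> l" and inj: "inj_on \<theta> L"
    and zero: "\<And>j::nat. (\<Sum>l\<in>L. c l * \<theta> l ^ j) = 0" and l: "l \<in> L"
  shows "c l = 0"
proof (rule ccontr)
  assume "c l \<noteq> 0"
  let ?L = "{l \<in> L. c l \<noteq> 0}"
  have fin: "finite ?L" "?L \<noteq> {}" using L l \<open>c l \<noteq> 0\<close> by auto
  obtain i where i: "i \<in> ?L" "\<theta> i = Max (\<theta> ` ?L)"
    using Max_in[of "\<theta> ` ?L"] fin by fastforce
  have le: "\<theta> j < \<theta> i" if "j \<in> ?L" "j \<noteq> i" for j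
  proof -
    have "\<theta> j \<le> \<theta> i" using i(2) fin that by simp
    moreover have "\<theta> j \<noteq> \<theta> i" using inj that i(1) by (auto simp: inj_on_def)
    ultimately show ?thesis by simp
  qed
  have "(\<lambda>j. \<Sum>l\<in>?L. c l * (\<theta> l / \<theta> i) ^ j) \<longlonglongrightarrow> (\<Sum>l\<in>?L. if l = i then c i else 0)"
  proof (rule tendsto_sum)
    fix l assume l: "l \<in> ?L"
    show "(\<lambda>j. c l * (\<theta> l / \<theta> i) ^ j) \<longlonglongrightarrow> (if l = i then c i else 0)"
    proof (cases "l = i")
      case True
      then show ?thesis using pos[of i] i(1) by simp
    next
      case False
      have "norm (\<theta> l / \<theta> i) < 1" using le[OF l False] pos[of l] pos[of i] l i(1) by simp
      then have "(\<lambda>j. c l * (\<theta> l / \<theta> i) ^ j) \<longlonglongrightarrow> c l * 0"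
        by (intro tendsto_mult_left LIMSEQ_power_zero)
      then show ?thesis using False by simp
    qed
  qed
  moreover have "(\<Sum>l\<in>?L. c l * (\<theta> l / \<theta> i) ^ j) = 0" for j
  proof -
    have "(\<Sum>l\<in>?L. c l * (\<theta> l / \<theta> i) ^ j) = (\<Sum>l\<in>?L. c l * \<theta> l ^ j) / \<theta> i ^ j"
      by (simp add: sum_divide_distrib power_divide)
    also have "(\<Sum>l\<in>?L. c l * \<theta> l ^ j) = (\<Sum>l\<in>L. c l * \<theta> l ^ j)"
      by (rule sum.mono_neutral_left) (use L in auto)
    finally show ?thesis by (simp add: zero)
  qed
  ultimately have "(\<Sum>l\<in>?L. if l = i then c i else 0) = 0"
    by (simp add: LIMSEQ_const_iff)
  then show False using i(1) fin by simp
qed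

lemma regular_points_nonnull:
  "\<exists>B. B \<in> sets (\<Pi>\<^sub>M i\<in>{1..<Suc k}. (lborel :: (real^'d) measure)) \<and> emeasure (\<Pi>\<^sub>M i\<in>{1..<Suc k}. (lborel :: (real^'d) measure)) B \<noteq> 0 \<and>
    (\<forall>u\<in>B. small_diameter 1 k (u(0 := 0)) \<and> (k \<le> CARD('d) \<longrightarrow> 0 < simplex_volume k (u(0 := 0))))"
proof -
  interpret PL: product_sigma_finite "\<lambda>_::nat. lborel :: (real^'d) measure" by standard
  obtain b \<epsilon> where b: "0 < \<epsilon>" "b 0 = 0"
    "\<And>x :: nat \<Rightarrow> real^'d. (\<And>i. i \<le> k \<Longrightarrow> norm (x i - b i) < \<epsilon>) \<Longrightarrow> small_diameter 1 k x \<and> (k \<le> CARD('d) \<longrightarrow> 0 < simplex_volume k x)"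
    using exists_regular_box[where 'd='d, of k] by blast
  let ?B = "\<Pi>\<^sub>E i\<in>{1..<Suc k}. ball (b i) \<epsilon>"
  have "emeasure (\<Pi>\<^sub>M i\<in>{1..<Suc k}. lborel) ?B = (\<Prod>i\<in>{1..<Suc k}. emeasure lborel (ball (b i) \<epsilon>))"
    by (rule PL.emeasure_PiM) auto
  also have "\<dots> \<noteq> 0"
  proof -
    have "emeasure lborel (ball (b i) \<epsilon>) \<noteq> 0" for i
    proof
      assume "emeasure lborel (ball (b i) \<epsilon>) = 0"
      then have "negligible (ball (b i) \<epsilon>)"
        by (auto simp: negligible_iff_null_sets null_sets_def)
      moreover have "open (ball (b i) \<epsilon>)" "ball (b i) \<epsilon> \<noteq> {}" using b(1) by auto
      ultimately show False using open_not_negligible by blast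
    qed
    then show ?thesis by (simp add: prod_zero_iff)
  qed
  finally have "emeasure (\<Pi>\<^sub>M i\<in>{1..<Suc k}. lborel) ?B \<noteq> 0" .
  moreover have "small_diameter 1 k (u(0 := 0)) \<and> (k \<le> CARD('d) \<longrightarrow> 0 < simplex_volume k (u(0 := 0)))" if "u \<in> ?B" for u
  proof (rule b(3))
    fix i assume "i \<le> k"
    then show "norm ((u(0 := 0)) i - b i) < \<epsilon>"
      using that b(1,2) by (cases "i = 0") (auto simp: PiE_iff dist_norm norm_minus_commute)
  qed
  moreover have "?B \<in> sets (\<Pi>\<^sub>M i\<in>{1..<Suc k}. lborel)" by (intro sets_PiM_I_finite) auto
  ultimately show ?thesis by blast
qed

text \<open>
  If the integral vanishes, the linear combination vanishes almost everywhere, and also almost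
  everywhere after scaling the configuration by \<open>1, 1/2, 1/4, \<dots>\<close>. So there is a single nondegenerate
  configuration at which all these values vanish. Scaling by \<open>r\<close> multiplies the \<open>l\<close>-th summand by
  \<open>r^(k \<alpha>\<^sub>l)\<close>, which turns the values into an exponential sum with distinct bases. For \<open>k = 0\<close>
  the bases coincide, hence the restriction to one summand.
\<close>

lemma simplex_powers_independent:
  fixes a \<alpha> :: "'i \<Rightarrow> real"
  assumes L: "finite L" and \<alpha>: "\<And>l. l \<in> L \<Longrightarrow> k \<le> CARD('d) \<or> \<alpha> l = 0"
    and inj: "inj_on \<alpha> L" and k0: "k = 0 \<Longrightarrow> \<exists>l. L \<subseteq> {l}" and a: "l \<in> L" "a l \<noteq> 0"
  shows "based_integral k (\<lambda>x :: nat \<Rightarrow> real^'d. ennreal ((\<Sum>l\<in>L. a l * simplex_power 1 k (\<alpha> l) x)\<^sup>2)) \<noteq> 0"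
proof
  let ?J = "{1..<Suc k}" and ?g = "\<lambda>x :: nat \<Rightarrow> real^'d. \<Sum>l\<in>L. a l * simplex_power 1 k (\<alpha> l) x"
  let ?P = "\<Pi>\<^sub>M i\<in>?J. (lborel :: (real^'d) measure)"
  let ?f = "\<lambda>u. ennreal ((?g (u(0 := 0)))\<^sup>2)"
  assume "based_integral k (\<lambda>x :: nat \<Rightarrow> real^'d. ennreal ((?g x)\<^sup>2)) = 0"
  then have zero: "(\<integral>\<^sup>+u. ?f u \<partial>?P) = 0" by (simp add: based_integral_def)
  have upd: "(\<lambda>u. u(0 := 0)) \<in> measurable (\<Pi>\<^sub>M i\<in>?J. (borel :: (real^'d) measure)) (\<Pi>\<^sub>M i\<in>{..<Suc k}. borel)"
    by (rule measurable_fun_upd[where J="?J"]) auto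
  have g: "?g \<in> borel_measurable (\<Pi>\<^sub>M i\<in>{..<Suc k}. borel)"
  proof (intro borel_measurable_sum borel_measurable_times borel_measurable_const)
    fix l assume "l \<in> L"
    show "simplex_power 1 k (\<alpha> l) \<in> borel_measurable (\<Pi>\<^sub>M i\<in>{..<Suc k}. (borel :: (real^'d) measure))"
      by (rule simplex_power_measurable[OF \<alpha>[OF \<open>l \<in> L\<close>]]) auto
  qed
  have f: "?f \<in> borel_measurable (\<Pi>\<^sub>M i\<in>?J. borel)"
    using measurable_compose[OF upd g] by measurable
  let ?r = "\<lambda>j::nat. (1/2::real) ^ j"
  have ae: "AE u in ?P. ?g (\<lambda>i. ?r j *\<^sub>R (u(0 := 0)) i) = 0" for j
  proof -
    have r: "?r j > 0" by simp
    let ?T = "\<lambda>u::nat \<Rightarrow> real^'d. \<lambda>i\<in>?J. 0 + ?r j *\<^sub>R u i"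
    have T: "?T \<in> measurable ?P (\<Pi>\<^sub>M i\<in>?J. borel)" by (rule measurable_restrict) simp
    have fT: "(\<lambda>u. ?f (?T u)) \<in> borel_measurable ?P" by (rule measurable_compose[OF T f])
    have "ennreal (?r j ^ (DIM(real^'d) * card ?J)) * (\<integral>\<^sup>+u. ?f (?T u) \<partial>?P) = 0"
      using PiM_lborel_affine[OF r _ f, of 0] zero by simp
    moreover have "ennreal (?r j ^ (DIM(real^'d) * card ?J)) \<noteq> 0"
      by (simp only: ennreal_eq_0_iff not_le zero_less_power[OF r] simp_thms)
    ultimately have "(\<integral>\<^sup>+u. ?f (?T u) \<partial>?P) = 0" by (simp only: mult_eq_0_iff simp_thms)
    then have "AE u in ?P. ?f (?T u) = 0" using nn_integral_0_iff_AE[OF fT] by simp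
    then show ?thesis
    proof eventually_elim
      case (elim u)
      have "?g ((?T u)(0 := 0)) = ?g (\<lambda>i. ?r j *\<^sub>R (u(0 := 0)) i)"
      proof (intro sum.cong refl arg_cong2[where f="(*)"] simplex_power_image_cong image_cong)
        fix i assume "i \<in> {..k}"
        then show "((?T u)(0 := 0)) i = ?r j *\<^sub>R (u(0 := 0)) i" by auto
      qed
      then show ?case using elim by (simp add: ennreal_eq_0_iff)
    qed
  qed
  then have "AE u in ?P. \<forall>j. ?g (\<lambda>i. ?r j *\<^sub>R (u(0 := 0)) i) = 0" by (simp only: AE_all_countable) simp
  moreover obtain B where B: "B \<in> sets ?P" "emeasure ?P B \<noteq> 0"
    "\<And>u. u \<in> B \<Longrightarrow> small_diameter 1 k (u(0 := 0)) \<and> (k \<le> CARD('d) \<longrightarrow> 0 < simplex_volume k (u(0 := 0)))"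
    using regular_points_nonnull[where 'd='d, of k] by blast
  ultimately have "\<exists>u\<in>B. \<forall>j. ?g (\<lambda>i. ?r j *\<^sub>R (u(0 := 0)) i) = 0"
  proof (rule_tac ccontr)
    assume ae: "AE u in ?P. \<forall>j. ?g (\<lambda>i. ?r j *\<^sub>R (u(0 := 0)) i) = 0"
      and neg: "\<not> (\<exists>u\<in>B. \<forall>j. ?g (\<lambda>i. ?r j *\<^sub>R (u(0 := 0)) i) = 0)"
    from ae have "AE u in ?P. u \<notin> B"
    proof (rule eventually_mono)
      fix u assume "\<forall>j. ?g (\<lambda>i. ?r j *\<^sub>R (u(0 := 0)) i) = 0"
      then show "u \<notin> B" using neg by blast
    qed
    then have "B \<in> null_sets ?P" using AE_iff_null_sets[OF B(1)] by blast
    then have "emeasure ?P B = 0" by (rule null_setsD1)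
    then show False using B(2) by simp
  qed
  then obtain u where u: "u \<in> B" "\<And>j. ?g (\<lambda>i. ?r j *\<^sub>R (u(0 := 0)) i) = 0" by blast
  define y where "y = u(0 := 0)"
  have y: "small_diameter 1 k y" "k \<le> CARD('d) \<Longrightarrow> 0 < simplex_volume k y"
    using B(3)[OF u(1)] by (auto simp: y_def)
  define c where "c l = a l * simplex_power 1 k (\<alpha> l) y" for l
  define \<theta> where "\<theta> l = (1/2::real) powr (\<alpha> l * real k)" for l
  have sum: "(\<Sum>l\<in>L. c l * \<theta> l ^ j) = 0" for j
  proof -
    have "simplex_power 1 k (\<alpha> l) (\<lambda>i. ?r j *\<^sub>R y i) = \<theta> l ^ j * simplex_power 1 k (\<alpha> l) y" if "l \<in> L" for l
    proof -
      have "?r j powr (\<alpha> l * real k) = \<theta> l ^ j"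
        unfolding \<theta>_def by (simp add: powr_realpow[symmetric] powr_powr mult.commute)
      then show ?thesis
        using simplex_power_shrink[OF \<alpha>[OF that], of "?r j" y] y(1) by (simp add: power_le_one)
    qed
    then have "?g (\<lambda>i. ?r j *\<^sub>R y i) = (\<Sum>l\<in>L. c l * \<theta> l ^ j)"
      unfolding c_def by (intro sum.cong) auto
    then show ?thesis using u(2)[of j] by (simp add: y_def)
  qed
  have "c l = 0"
  proof (cases "k = 0")
    case True
    then have "L = {l}" using k0 a(1) by auto
    then show ?thesis using sum[of 0] by simp
  next
    case False
    then have "inj_on \<theta> L" using inj unfolding \<theta>_def inj_on_def by (simp add: powr_inj)
    then show ?thesis by (intro exponential_sum_zero[OF L _ _ sum a(1)]) (simp add: \<theta>_def)
  qed
  moreover have "simplex_power 1 k (\<alpha> l) y > 0"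
    using \<alpha>[OF a(1)] y by (auto simp: simplex_power_alt)
  ultimately show False using a(2) by (simp add: c_def)
qed

section \<open>Covariances of Poisson U-statistics\<close>

lemma integrable_mult_of_squares:
  fixes X Y :: "'a \<Rightarrow> real"
  assumes "X \<in> borel_measurable M" "Y \<in> borel_measurable M"
    and "integrable M (\<lambda>\<omega>. (X \<omega>)\<^sup>2)" "integrable M (\<lambda>\<omega>. (Y \<omega>)\<^sup>2)"
  shows "integrable M (\<lambda>\<omega>. X \<omega> * Y \<omega>)"
proof (rule Bochner_Integration.integrable_bound)
  show "integrable M (\<lambda>\<omega>. (X \<omega>)\<^sup>2 + (Y \<omega>)\<^sup>2)" using assms by auto
  show "AE \<omega> in M. norm (X \<omega> * Y \<omega>) \<le> norm ((X \<omega>)\<^sup>2 + (Y \<omega>)\<^sup>2)"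
  proof (rule AE_I2)
    fix \<omega>
    have "2 * \<bar>X \<omega> * Y \<omega>\<bar> \<le> \<bar>X \<omega>\<bar>\<^sup>2 + \<bar>Y \<omega>\<bar>\<^sup>2"
      using sum_squares_bound[of "\<bar>X \<omega>\<bar>" "\<bar>Y \<omega>\<bar>"] by (simp add: abs_mult mult.assoc)
    moreover have "0 \<le> \<bar>X \<omega> * Y \<omega>\<bar>" by simp
    ultimately have "\<bar>X \<omega> * Y \<omega>\<bar> \<le> (X \<omega>)\<^sup>2 + (Y \<omega>)\<^sup>2" by (simp only: power2_abs)
    then show "norm (X \<omega> * Y \<omega>) \<le> norm ((X \<omega>)\<^sup>2 + (Y \<omega>)\<^sup>2)" by simp
  qed
qed (use assms in measurable)

lemma covariance_eq:
  assumes "prob_space M"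
    and "integrable M X" "integrable M Y" "integrable M (\<lambda>\<omega>. X \<omega> * Y \<omega> :: real)"
  shows "covariance M X Y = (\<integral>\<omega>. X \<omega> * Y \<omega> \<partial>M) - (\<integral>\<omega>. X \<omega> \<partial>M) * (\<integral>\<omega>. Y \<omega> \<partial>M)"
proof -
  interpret prob_space M by fact
  define x where "x = (\<integral>\<omega>. X \<omega> \<partial>M)"
  define y where "y = (\<integral>\<omega>. Y \<omega> \<partial>M)"
  have "covariance M X Y = (\<integral>\<omega>. X \<omega> * Y \<omega> - x * Y \<omega> - y * X \<omega> + x * y \<partial>M)"
    unfolding covariance_def x_def[symmetric] y_def[symmetric]
    by (intro Bochner_Integration.integral_cong refl) (simp add: algebra_simps)
  also have "\<dots> = (\<integral>\<omega>. X \<omega> * Y \<omega> \<partial>M) - x * y - y * x + x * y"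
    using assms by (simp add: prob_space x_def y_def)
  finally show ?thesis by (simp add: x_def y_def)
qed

lemma image_invariant_comp:
  assumes "image_invariant p f"
  shows "image_invariant p (\<lambda>z. h (f z))"
  unfolding image_invariant_def
proof (intro allI impI)
  fix x y :: "nat \<Rightarrow> 'a" assume "x ` {..<p} = y ` {..<p}"
  then have "f x = f y" using assms unfolding image_invariant_def by blast
  then show "h (f x) = h (f y)" by simp
qed

definition ustatistic :: "nat \<Rightarrow> ((nat \<Rightarrow> 'a) \<Rightarrow> real) \<Rightarrow> 'a set \<Rightarrow> real" where
  "ustatistic p f A = (\<Sum>z\<in>inj_tuples p A. f z) / fact p"

lemma ennreal_ustatistic:
  assumes "\<And>z. 0 \<le> f z"
  shows "ennreal (ustatistic p f A) = (\<Sum>z\<in>inj_tuples p A. ennreal (f z)) / of_nat (fact p)"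
proof -
  have "(\<Sum>z\<in>inj_tuples p A. ennreal (f z)) = ennreal (\<Sum>z\<in>inj_tuples p A. f z)"
    using assms by (rule sum_ennreal)
  moreover have "of_nat (fact p) = ennreal (fact p)" by (metis ennreal_of_nat_eq_real_of_nat of_nat_fact)
  ultimately show ?thesis unfolding ustatistic_def using assms
    by (simp add: divide_ennreal sum_nonneg)
qed

text \<open>
  Without shared points the two tuples are independent; this is the term of the second moment that
  the covariance subtracts.
\<close>

lemma overlap_integral_0:
  assumes P: "prob_space P"
    and f: "depends_below p f" "f \<in> borel_measurable (\<Pi>\<^sub>M i\<in>{..<p}. P)"
    and g: "depends_below q g" "g \<in> borel_measurable (\<Pi>\<^sub>M i\<in>{..<q}. P)"
  shows "overlap_integral P p q 0 f g = (\<integral>\<^sup>+z. f z \<partial>(\<Pi>\<^sub>M i\<in>{..<p}. P)) * (\<integral>\<^sup>+z. g z \<partial>(\<Pi>\<^sub>M i\<in>{..<q}. P))"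
proof -
  have s: "section_integral P 0 p f z = (\<integral>\<^sup>+z. f z \<partial>(\<Pi>\<^sub>M i\<in>{..<p}. P))" if "depends_below p f" for p f and z :: "nat \<Rightarrow> 'a"
    unfolding section_integral_def atLeast0LessThan[symmetric] lessThan_0
    by (intro nn_integral_cong depends_below_cong[OF that]) (auto simp: merge_def)
  show ?thesis
    unfolding overlap_integral_eq[OF P f g le0 le0] s[OF f(1)] s[OF g(1)] by (simp add: PiM_empty nn_integral_count_space_finite)
qed

text \<open>
  Square integrability makes the second moment finite. Since all its terms are nonnegative and have
  positive coefficients, each overlap integral is finite, and the formula for the product can be
  read in the real numbers.
\<close>

lemma poisson_ustatistic_covariance:
  fixes W :: "(real^'d) set" and f g :: "(nat \<Rightarrow> real^'d) \<Rightarrow> real"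
  assumes pp: "poisson_process M W t \<eta>" and t: "0 < t"
    and W: "W \<in> sets borel" "emeasure lborel W = 1"
    and f: "\<And>z. 0 \<le> f z" "image_invariant p f" "f \<in> borel_measurable (\<Pi>\<^sub>M i\<in>{..<p}. borel)"
    and g: "\<And>z. 0 \<le> g z" "image_invariant q g" "g \<in> borel_measurable (\<Pi>\<^sub>M i\<in>{..<q}. borel)"
    and X: "(\<lambda>\<omega>. ustatistic p f (\<eta> \<omega>)) \<in> borel_measurable M" "integrable M (\<lambda>\<omega>. (ustatistic p f (\<eta> \<omega>))\<^sup>2)"
    and Y: "(\<lambda>\<omega>. ustatistic q g (\<eta> \<omega>)) \<in> borel_measurable M" "integrable M (\<lambda>\<omega>. (ustatistic q g (\<eta> \<omega>))\<^sup>2)"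
  shows "(\<forall>m\<le>min p q. overlap_integral (uniform_on W) p q m f g < \<top>) \<and>
    covariance M (\<lambda>\<omega>. ustatistic p f (\<eta> \<omega>)) (\<lambda>\<omega>. ustatistic q g (\<eta> \<omega>)) =
    (\<Sum>m\<in>{1..min p q}. t ^ (p + q - m) / (fact m * fact (p - m) * fact (q - m)) *
      enn2real (overlap_integral (uniform_on W) p q m f g))"
proof -
  interpret M: prob_space M using pp by (simp add: poisson_process_def)
  let ?X = "\<lambda>\<omega>. ustatistic p f (\<eta> \<omega>)" and ?Y = "\<lambda>\<omega>. ustatistic q g (\<eta> \<omega>)"
  let ?O = "\<lambda>m. overlap_integral (uniform_on W) p q m f g"
  let ?c = "\<lambda>m. t ^ (p + q - m) / (fact m * fact (p - m) * fact (q - m)) :: real"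
  have f': "image_invariant p (\<lambda>z. ennreal (f z))" "(\<lambda>z. ennreal (f z)) \<in> borel_measurable (\<Pi>\<^sub>M i\<in>{..<p}. borel)"
    using f(3) by (auto intro: image_invariant_comp f(2))
  have g': "image_invariant q (\<lambda>z. ennreal (g z))" "(\<lambda>z. ennreal (g z)) \<in> borel_measurable (\<Pi>\<^sub>M i\<in>{..<q}. borel)"
    using g(3) by (auto intro: image_invariant_comp g(2))
  have nonneg: "0 \<le> ?X \<omega>" "0 \<le> ?Y \<omega>" for \<omega>
    using f(1) g(1) by (auto simp: ustatistic_def intro!: divide_nonneg_nonneg sum_nonneg)
  have XY: "integrable M (\<lambda>\<omega>. ?X \<omega> * ?Y \<omega>)" by (rule integrable_mult_of_squares[OF X(1) Y(1) X(2) Y(2)])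
  have iX: "integrable M ?X" by (rule M.square_integrable_imp_integrable[OF X])
  have iY: "integrable M ?Y" by (rule M.square_integrable_imp_integrable[OF Y])
  have "ennreal (\<integral>\<omega>. ?X \<omega> * ?Y \<omega> \<partial>M) = (\<integral>\<^sup>+\<omega>. ennreal (?X \<omega> * ?Y \<omega>) \<partial>M)"
    using XY nonneg by (intro nn_integral_eq_integral[symmetric]) auto
  also have "\<dots> = (\<integral>\<^sup>+\<omega>. (\<Sum>z\<in>inj_tuples p (\<eta> \<omega>). ennreal (f z)) / of_nat (fact p) * ((\<Sum>z\<in>inj_tuples q (\<eta> \<omega>). ennreal (g z)) / of_nat (fact q)) \<partial>M)"
    using nonneg by (simp add: ennreal_mult ennreal_ustatistic f(1) g(1))
  also have "\<dots> = (\<Sum>m\<le>min p q. ennreal (?c m) * ?O m)"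
    by (rule poisson_ustatistic_product[OF pp _ W f' g']) (use t in simp)
  finally have E: "ennreal (\<integral>\<omega>. ?X \<omega> * ?Y \<omega> \<partial>M) = (\<Sum>m\<le>min p q. ennreal (?c m) * ?O m)" .
  have fin: "?O m < \<top>" if "m \<le> min p q" for m
  proof -
    have "(\<Sum>m\<le>min p q. ennreal (?c m) * ?O m) < \<top>" unfolding E[symmetric] by simp
    then have "ennreal (?c m) * ?O m < \<top>" using that by simp
    moreover have "?c m > 0" using t by simp
    ultimately show ?thesis by (auto simp: ennreal_mult_less_top ennreal_eq_0_iff)
  qed
  have O: "?O m = ennreal (enn2real (?O m))" if "m \<le> min p q" for m using fin[OF that] by simp
  have cO: "ennreal (?c m * enn2real (?O m)) = ennreal (?c m) * ?O m" if "m \<le> min p q" for m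
  proof -
    have "ennreal (?c m * enn2real (?O m)) = ennreal (?c m) * ennreal (enn2real (?O m))"
      using t by (intro ennreal_mult) auto
    then show ?thesis by (simp only: O[OF that, symmetric])
  qed
  have "ennreal (\<integral>\<omega>. ?X \<omega> * ?Y \<omega> \<partial>M) = ennreal (\<Sum>m\<le>min p q. ?c m * enn2real (?O m))"
  proof -
    have "(\<Sum>m\<le>min p q. ennreal (?c m) * ?O m) = (\<Sum>m\<le>min p q. ennreal (?c m * enn2real (?O m)))"
      by (intro sum.cong refl cO[symmetric]) simp
    then show ?thesis unfolding E using t by (subst sum_ennreal[symmetric]) auto
  qed
  then have EXY: "(\<integral>\<omega>. ?X \<omega> * ?Y \<omega> \<partial>M) = (\<Sum>m\<le>min p q. ?c m * enn2real (?O m))"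
    using t nonneg by (subst (asm) ennreal_inj) (auto intro!: sum_nonneg integral_nonneg_AE)
  have mean: "ennreal (\<integral>\<omega>. ustatistic p f (\<eta> \<omega>) \<partial>M) = ennreal (t ^ p / fact p) * (\<integral>\<^sup>+z. f z \<partial>(\<Pi>\<^sub>M i\<in>{..<p}. uniform_on W))"
    if f: "\<And>z. 0 \<le> f z" "f \<in> borel_measurable (\<Pi>\<^sub>M i\<in>{..<p}. borel)" and iX: "integrable M (\<lambda>\<omega>. ustatistic p f (\<eta> \<omega>))"
    for p and f :: "(nat \<Rightarrow> real^'d) \<Rightarrow> real"
  proof -
    have "ennreal (\<integral>\<omega>. ustatistic p f (\<eta> \<omega>) \<partial>M) = (\<integral>\<^sup>+\<omega>. ennreal (ustatistic p f (\<eta> \<omega>)) \<partial>M)"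
      using iX f(1) by (intro nn_integral_eq_integral[symmetric]) (auto simp: ustatistic_def intro!: divide_nonneg_nonneg sum_nonneg)
    also have "\<dots> = (\<integral>\<^sup>+\<omega>. (\<Sum>z\<in>inj_tuples p (\<eta> \<omega>). ennreal (f z)) / of_nat (fact p) \<partial>M)"
      by (simp add: ennreal_ustatistic f(1))
    also have "\<dots> = (\<integral>\<^sup>+\<omega>. (\<Sum>z\<in>inj_tuples p (\<eta> \<omega>). ennreal (f z)) \<partial>M) / of_nat (fact p)"
      using poisson_tuple_sum[OF pp _ W, of "\<lambda>z. ennreal (f z)" p] f(2) t by (intro nn_integral_divide) auto
    also have "\<dots> = ennreal (t ^ p) * (\<integral>\<^sup>+z. f z \<partial>(\<Pi>\<^sub>M i\<in>{..<p}. uniform_on W)) / of_nat (fact p)"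
      using poisson_tuple_sum[OF pp _ W, of "\<lambda>z. ennreal (f z)" p] f(2) t by simp
    also have "\<dots> = ennreal (t ^ p) / ennreal (real (fact p)) * (\<integral>\<^sup>+z. f z \<partial>(\<Pi>\<^sub>M i\<in>{..<p}. uniform_on W))"
      by (simp only: divide_ennreal_def mult_ac ennreal_of_nat_eq_real_of_nat)
    also have "ennreal (t ^ p) / ennreal (real (fact p)) = ennreal (t ^ p / fact p)"
      using t by (subst divide_ennreal) auto
    finally show ?thesis .
  qed
  have "ennreal ((\<integral>\<omega>. ?X \<omega> \<partial>M) * (\<integral>\<omega>. ?Y \<omega> \<partial>M)) = ennreal (?c 0) * ?O 0"
  proof -
    have P: "prob_space (uniform_on W)" by (rule prob_space_uniform_on[OF W(2)])
    have f0: "(\<lambda>z. ennreal (f z)) \<in> borel_measurable (\<Pi>\<^sub>M i\<in>{..<p}. uniform_on W)"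
      "(\<lambda>z. ennreal (g z)) \<in> borel_measurable (\<Pi>\<^sub>M i\<in>{..<q}. uniform_on W)"
      using f'(2) g'(2) by (simp_all cong: measurable_cong_sets sets_PiM_cong)
    have "ennreal ((\<integral>\<omega>. ?X \<omega> \<partial>M) * (\<integral>\<omega>. ?Y \<omega> \<partial>M)) = ennreal (\<integral>\<omega>. ?X \<omega> \<partial>M) * ennreal (\<integral>\<omega>. ?Y \<omega> \<partial>M)"
      using nonneg by (intro ennreal_mult) (auto intro!: integral_nonneg_AE)
    also have "\<dots> = (ennreal (t ^ p / fact p) * ennreal (t ^ q / fact q)) * ?O 0"
      unfolding mean[OF f(1,3) iX] mean[OF g(1,3) iY]
        overlap_integral_0[OF P image_invariant_depends_below[OF f'(1)] f0(1) image_invariant_depends_below[OF g'(1)] f0(2)]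
      by (simp only: mult_ac)
    also have "ennreal (t ^ p / fact p) * ennreal (t ^ q / fact q) = ennreal (?c 0)"
      using t by (subst ennreal_mult[symmetric]) (auto simp: power_add)
    finally show ?thesis .
  qed
  also have "ennreal (?c 0) * ?O 0 = ennreal (?c 0 * enn2real (?O 0))"
    by (rule cO[symmetric]) simp
  finally have EX: "(\<integral>\<omega>. ?X \<omega> \<partial>M) * (\<integral>\<omega>. ?Y \<omega> \<partial>M) = ?c 0 * enn2real (?O 0)"
    using t nonneg by (subst (asm) ennreal_inj) (auto intro!: mult_nonneg_nonneg integral_nonneg_AE)
  have "{..min p q} = insert 0 {1..min p q}" by auto
  then have "covariance M ?X ?Y = (\<Sum>m\<in>{1..min p q}. ?c m * enn2real (?O m))"
    unfolding covariance_eq[OF M.prob_space_axioms iX iY XY] EXY EX by simp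
  then show ?thesis using fin by simp
qed

text \<open>
  The functions are square integrable and hence almost everywhere finite, so the quadratic form of
  their inner products can be expanded in the real numbers.
\<close>

lemma gram_identity:
  fixes H :: "'i \<Rightarrow> 'a \<Rightarrow> ennreal" and b :: "'i \<Rightarrow> real"
  assumes L: "finite L" and H: "\<And>l. l \<in> L \<Longrightarrow> H l \<in> borel_measurable M"
    and fin: "\<And>l. l \<in> L \<Longrightarrow> (\<integral>\<^sup>+z. H l z * H l z \<partial>M) < \<top>"
  shows "integrable M (\<lambda>z. (\<Sum>l\<in>L. b l * enn2real (H l z))\<^sup>2) \<and>
    (\<Sum>l\<in>L. \<Sum>j\<in>L. b l * b j * enn2real (\<integral>\<^sup>+z. H l z * H j z \<partial>M)) =
    (\<integral>z. (\<Sum>l\<in>L. b l * enn2real (H l z))\<^sup>2 \<partial>M)"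
proof -
  let ?h = "\<lambda>l z. enn2real (H l z)"
  have m: "?h l \<in> borel_measurable M" if "l \<in> L" for l using H[OF that] by measurable
  have ae: "AE z in M. H l z = ennreal (?h l z)" if "l \<in> L" for l
  proof -
    have "AE z in M. H l z * H l z \<noteq> \<infinity>"
      using H[OF that] fin[OF that] by (intro nn_integral_PInf_AE) auto
    then show ?thesis by eventually_elim (auto simp: ennreal_mult_eq_top_iff less_top)
  qed
  have sq: "integrable M (\<lambda>z. (?h l z)\<^sup>2)" if "l \<in> L" for l
  proof (rule integrableI_nonneg)
    have "(\<integral>\<^sup>+z. ennreal ((?h l z)\<^sup>2) \<partial>M) = (\<integral>\<^sup>+z. H l z * H l z \<partial>M)"
    proof (intro nn_integral_cong_AE)
      show "AE z in M. ennreal ((?h l z)\<^sup>2) = H l z * H l z"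
        using ae[OF that] by eventually_elim (metis ennreal_mult enn2real_nonneg power2_eq_square)
    qed
    then show "(\<integral>\<^sup>+z. ennreal ((?h l z)\<^sup>2) \<partial>M) < \<infinity>" using fin[OF that] by simp
  qed (use m[OF that] in auto)
  have prod: "integrable M (\<lambda>z. ?h l z * ?h j z)" if "l \<in> L" "j \<in> L" for l j
    by (rule integrable_mult_of_squares[OF m[OF that(1)] m[OF that(2)] sq[OF that(1)] sq[OF that(2)]])
  have eq: "enn2real (\<integral>\<^sup>+z. H l z * H j z \<partial>M) = (\<integral>z. ?h l z * ?h j z \<partial>M)" if "l \<in> L" "j \<in> L" for l j
  proof -
    have "(\<integral>\<^sup>+z. H l z * H j z \<partial>M) = (\<integral>\<^sup>+z. ennreal (?h l z * ?h j z) \<partial>M)"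
    proof (intro nn_integral_cong_AE)
      show "AE z in M. H l z * H j z = ennreal (?h l z * ?h j z)"
        using ae[OF that(1)] ae[OF that(2)] by eventually_elim (metis ennreal_mult enn2real_nonneg)
    qed
    also have "\<dots> = ennreal (\<integral>z. ?h l z * ?h j z \<partial>M)"
      by (rule nn_integral_eq_integral[OF prod[OF that]]) simp
    finally show ?thesis by (simp add: integral_nonneg_AE)
  qed
  have expand: "(\<Sum>l\<in>L. b l * ?h l z)\<^sup>2 = (\<Sum>l\<in>L. \<Sum>j\<in>L. b l * b j * (?h l z * ?h j z))" for z
    by (simp add: power2_eq_square sum_product mult_ac)
  have int: "integrable M (\<lambda>z. \<Sum>j\<in>L. b l * b j * (?h l z * ?h j z))" if "l \<in> L" for l
    by (intro Bochner_Integration.integrable_sum integrable_mult_right prod that)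
  have "(\<integral>z. (\<Sum>l\<in>L. b l * ?h l z)\<^sup>2 \<partial>M) = (\<Sum>l\<in>L. \<integral>z. (\<Sum>j\<in>L. b l * b j * (?h l z * ?h j z)) \<partial>M)"
    unfolding expand by (rule Bochner_Integration.integral_sum) (rule int)
  also have "\<dots> = (\<Sum>l\<in>L. \<Sum>j\<in>L. \<integral>z. b l * b j * (?h l z * ?h j z) \<partial>M)"
    by (intro sum.cong refl Bochner_Integration.integral_sum integrable_mult_right prod)
  also have "\<dots> = (\<Sum>l\<in>L. \<Sum>j\<in>L. b l * b j * enn2real (\<integral>\<^sup>+z. H l z * H j z \<partial>M))"
    by (intro sum.cong refl) (simp add: eq)
  finally have "(\<Sum>l\<in>L. \<Sum>j\<in>L. b l * b j * enn2real (\<integral>\<^sup>+z. H l z * H j z \<partial>M)) =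
    (\<integral>z. (\<Sum>l\<in>L. b l * ?h l z)\<^sup>2 \<partial>M)" by simp
  moreover have "integrable M (\<lambda>z. (\<Sum>l\<in>L. b l * ?h l z)\<^sup>2)"
    unfolding expand by (intro Bochner_Integration.integrable_sum int)
  ultimately show ?thesis by simp
qed

section \<open>The functionals at a fixed intensity\<close>

text \<open>
  The maximum in the normalization at \<open>\<tau> = t \<delta>^d\<close>, common to all functionals with the same \<open>k\<close>.
\<close>

definition rate :: "nat \<Rightarrow> real \<Rightarrow> real" where
  "rate k \<tau> = Max ((\<lambda>m. \<tau> powr (real k - (real m - 1) / 2)) ` {1..k+1})"

lemma normalizer_eq: "normalizer d t s k \<alpha> = t powr (1/2) * s powr (\<alpha> * real k) * rate k (t * s ^ d)"
  by (simp add: normalizer_def rate_def)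

lemma rate_pos: "0 < \<tau> \<Longrightarrow> 0 < rate k \<tau>"
  unfolding rate_def by (subst Max_gr_iff) auto

lemma rate_ge_1:
  assumes "1 \<le> \<tau>"
  shows "rate k \<tau> = \<tau> ^ k"
  unfolding rate_def
proof (rule Max_eqI)
  fix y assume "y \<in> (\<lambda>m. \<tau> powr (real k - (real m - 1) / 2)) ` {1..k+1}"
  then obtain m where m: "m \<in> {1..k+1}" "y = \<tau> powr (real k - (real m - 1) / 2)" by auto
  have "y \<le> \<tau> powr real k" unfolding m(2) using assms m(1) by (intro powr_mono) auto
  then show "y \<le> \<tau> ^ k" using assms by (simp add: powr_realpow)
next
  show "\<tau> ^ k \<in> (\<lambda>m. \<tau> powr (real k - (real m - 1) / 2)) ` {1..k+1}"
    using assms by (intro image_eqI[of _ _ 1]) (auto simp: powr_realpow)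
qed simp

text \<open>
  All exponents in the maximum lie between \<open>k / 2\<close> and \<open>k\<close>.
\<close>

lemma rate_square_le:
  assumes "0 < \<tau>" "\<tau> \<le> S" "1 \<le> S"
  shows "(rate k \<tau>)\<^sup>2 \<le> S ^ k * \<tau> ^ k"
proof -
  have "rate k \<tau> \<in> (\<lambda>m. \<tau> powr (real k - (real m - 1) / 2)) ` {1..k+1}"
    unfolding rate_def by (rule Max_in) auto
  then obtain m where m: "m \<in> {1..k+1}" "rate k \<tau> = \<tau> powr (real k - (real m - 1) / 2)" by auto
  have "(rate k \<tau>)\<^sup>2 = \<tau> powr (real (k + 1 - m) + real k)"
  proof -
    have "(real k - (real m - 1) / 2) + (real k - (real m - 1) / 2) = real (k + 1 - m) + real k"
      using m(1) by (simp add: of_nat_diff field_simps)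
    then show ?thesis unfolding m(2) power2_eq_square powr_add[symmetric] by (simp only:)
  qed
  also have "\<dots> = \<tau> ^ (k + 1 - m) * \<tau> ^ k"
    using assms by (simp only: powr_add powr_realpow)
  also have "\<dots> \<le> S ^ k * \<tau> ^ k"
  proof (rule mult_right_mono)
    have "\<tau> ^ (k + 1 - m) \<le> S ^ (k + 1 - m)" using assms by (intro power_mono) auto
    also have "\<dots> \<le> S ^ k" using assms m(1) by (intro power_increasing) auto
    finally show "\<tau> ^ (k + 1 - m) \<le> S ^ k" .
  qed (use assms in simp)
  finally show ?thesis .
qed

lemma image_invariant_simplex_power:
  "image_invariant (Suc k) (simplex_power s k \<alpha> :: (nat \<Rightarrow> real^'d) \<Rightarrow> real)"
  unfolding image_invariant_def lessThan_Suc_atMost using simplex_power_image_cong by blast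

lemma normalized_volume_power_eq:
  "normalized_volume_power t s k \<alpha> (A :: (real^'d) set) =
     ustatistic (Suc k) (simplex_power s k \<alpha>) A / normalizer CARD('d) t s k \<alpha>"
  by (simp add: normalized_volume_power_def volume_power_def ustatistic_def distinct_tuples_def inj_tuples_def lessThan_Suc_atMost)

lemma simplex_power_support:
  assumes "simplex_power s k \<alpha> z \<noteq> 0" "i \<le> k" "j \<le> k"
  shows "norm (z i - z j) \<le> s"
  using assms by (auto simp: simplex_power_def split: if_splits)

text \<open>
  The functionals at one intensity \<open>t\<close> and distance parameter \<open>s\<close>; in the limit theorems these hypotheses hold
  for all large \<open>t\<close>.
\<close>

locale rips_functionals =
  fixes W :: "(real^'d) set" and M :: "'w measure" and \<eta> :: "'w \<Rightarrow> (real^'d) set" and t s :: real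
    and k :: "'n::finite \<Rightarrow> nat" and \<alpha> :: "'n \<Rightarrow> real"
  assumes pp: "poisson_process M W t \<eta>" and t: "0 < t" and s: "0 < s"
    and W: "W \<in> sets borel" "emeasure lborel W = 1" "closed W"
    and k\<alpha>: "\<And>l. k l \<le> CARD('d) \<or> \<alpha> l = 0"
    and meas: "\<And>l. (\<lambda>\<omega>. normalized_volume_power t s (k l) (\<alpha> l) (\<eta> \<omega>)) \<in> borel_measurable M"
    and sq: "\<And>l. integrable M (\<lambda>\<omega>. (normalized_volume_power t s (k l) (\<alpha> l) (\<eta> \<omega>))\<^sup>2)"
begin

abbreviation "P \<equiv> uniform_on W"
abbreviation "X l \<omega> \<equiv> normalized_volume_power t s (k l) (\<alpha> l) (\<eta> \<omega>)"
abbreviation "\<phi> l \<equiv> simplex_power s (k l) (\<alpha> l) :: (nat \<Rightarrow> real^'d) \<Rightarrow> real"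
abbreviation "\<phi>\<^sub>1 l \<equiv> simplex_power 1 (k l) (\<alpha> l) :: (nat \<Rightarrow> real^'d) \<Rightarrow> real"
abbreviation "p l \<equiv> Suc (k l)"
abbreviation "U l \<omega> \<equiv> ustatistic (p l) (\<phi> l) (\<eta> \<omega>)"
abbreviation "ov l j m \<equiv> overlap_integral P (p l) (p j) m (\<phi> l) (\<phi> j)"
abbreviation "vol \<equiv> measure lborel (erosion s W)"

lemma P: "prob_space P" by (rule prob_space_uniform_on[OF W(2)])

lemma tau_pos: "0 < t * s ^ CARD('d)" using t s by simp

lemma Q_pos: "0 < normalizer CARD('d) t s (k l) (\<alpha> l)"
  using t s rate_pos[OF tau_pos] by (simp add: normalizer_eq)

lemma \<phi>_meas: "simplex_power r (k l) (\<alpha> l) \<in> borel_measurable (\<Pi>\<^sub>M i\<in>{..<p l}. (borel :: (real^'d) measure))"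
  by (rule simplex_power_measurable[OF k\<alpha>]) auto

lemma \<phi>_P: "(\<lambda>z. ennreal (\<phi> l z)) \<in> borel_measurable (\<Pi>\<^sub>M i\<in>{..<p l}. P)"
  using \<phi>_meas[where r=s and l=l] by (simp cong: measurable_cong_sets sets_PiM_cong)

lemma \<phi>_dep: "depends_below (p l) (\<lambda>z. ennreal (simplex_power r (k l) (\<alpha> l) (z :: nat \<Rightarrow> real^'d)))"
  by (rule image_invariant_depends_below, rule image_invariant_comp[where h=ennreal], rule image_invariant_simplex_power)

lemma U_eq: "U l \<omega> = normalizer CARD('d) t s (k l) (\<alpha> l) * X l \<omega>"
  using Q_pos[of l] by (simp add: normalized_volume_power_eq)

lemma covariance_U:
  "(\<forall>m\<le>min (p l) (p j). ov l j m < \<top>) \<and>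
   covariance M (U l) (U j) = (\<Sum>m\<in>{1..min (p l) (p j)}.
     t ^ (p l + p j - m) / (fact m * fact (p l - m) * fact (p j - m)) * enn2real (ov l j m))"
proof -
  have U: "(\<lambda>\<omega>. U l \<omega>) \<in> borel_measurable M" "integrable M (\<lambda>\<omega>. (U l \<omega>)\<^sup>2)" for l
    unfolding U_eq power_mult_distrib using meas sq by (auto intro!: borel_measurable_times)
  show ?thesis
    by (rule poisson_ustatistic_covariance[OF pp t W(1,2) simplex_power_nonneg image_invariant_simplex_power \<phi>_meas
      simplex_power_nonneg image_invariant_simplex_power \<phi>_meas U U])
qed

lemma covariance_X: "covariance M (X l) (X j) = covariance M (U l) (U j) / (normalizer CARD('d) t s (k l) (\<alpha> l) * normalizer CARD('d) t s (k j) (\<alpha> j))"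
proof -
  have X: "X l = (\<lambda>\<omega>. U l \<omega> / normalizer CARD('d) t s (k l) (\<alpha> l))" for l using U_eq[of l] Q_pos[of l] by (simp add: fun_eq_iff)
  show ?thesis unfolding covariance_def X by (simp add: diff_divide_distrib[symmetric])
qed

lemma overlap_as_gram:
  assumes "m \<le> p l" "m \<le> p j"
  shows "ov l j m = (\<integral>\<^sup>+z. section_integral P m (p l) (\<phi> l) z * section_integral P m (p j) (\<phi> j) z \<partial>(\<Pi>\<^sub>M i\<in>{..<m}. P))"
  by (rule overlap_integral_eq[OF P \<phi>_dep \<phi>_P \<phi>_dep \<phi>_P assms])

lemma section_full: "section_integral P (p l) (p l) (\<phi> l) z = ennreal (\<phi> l z)"
proof -
  have "section_integral P (p l) (p l) (\<phi> l) z = (\<integral>\<^sup>+u. ennreal (\<phi> l z) \<partial>(\<Pi>\<^sub>M i\<in>{p l..<p l}. P))"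
    unfolding section_integral_def
    by (intro nn_integral_cong depends_below_cong[OF \<phi>_dep]) (simp add: merge_def)
  then show ?thesis by (simp add: PiM_empty nn_integral_count_space_finite)
qed

text \<open>
  For each overlap size \<open>m\<close> the terms form a Gram matrix, because the combinatorial weight
  \<open>t^(p + q - m) / (m! (p - m)! (q - m)!)\<close> is \<open>t^m / m!\<close> times a factor for each of the two functionals. The
  form is therefore at least its part with \<open>m = K + 1\<close>, the largest overlap that
  can occur, to which only the functionals with \<open>k\<^sub>l = K\<close> contribute.
\<close>

lemma quadratic_form_ge:
  fixes a :: "'n \<Rightarrow> real"
  assumes K: "\<And>l. a l \<noteq> 0 \<Longrightarrow> k l \<le> K"
  defines "L \<equiv> {l. a l \<noteq> 0 \<and> k l = K}"
  defines "G \<equiv> \<lambda>z. (\<Sum>l\<in>L. a l / normalizer CARD('d) t s (k l) (\<alpha> l) * \<phi> l z)\<^sup>2"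
  shows "integrable (\<Pi>\<^sub>M i\<in>{..<Suc K}. P) G \<and>
    t ^ Suc K / fact (Suc K) * (\<integral>z. G z \<partial>(\<Pi>\<^sub>M i\<in>{..<Suc K}. P)) \<le>
      (\<Sum>l\<in>UNIV. \<Sum>j\<in>UNIV. a l * a j * covariance M (X l) (X j))"
proof -
  let ?A = "{l. a l \<noteq> 0}"
  \<comment> \<open>\<open>D m l j\<close> is the contribution of the overlap size \<open>m\<close> to the covariance of the unnormalized functionals, \<open>T m\<close> its quadratic form, and \<open>w m l * H m l\<close> the corresponding vector of the Gram representation.\<close>
  define b where "b l = a l / normalizer CARD('d) t s (k l) (\<alpha> l)" for l
  define D where "D m l j = (if m \<le> min (p l) (p j) then t ^ (p l + p j - m) / (fact m * fact (p l - m) * fact (p j - m)) * enn2real (ov l j m) else 0)" for m l j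
  define T where "T m = (\<Sum>l\<in>?A. \<Sum>j\<in>?A. b l * b j * D m l j)" for m
  define w where "w m l = b l * (t ^ (p l - m) / fact (p l - m))" for m l
  define H where "H m l = section_integral P m (p l) (\<lambda>z. ennreal (\<phi> l z))" for m l
  have cov: "covariance M (U l) (U j) = (\<Sum>m\<in>{1..Suc K}. D m l j)" if "l \<in> ?A" "j \<in> ?A" for l j
  proof -
    have "k l \<le> K" "k j \<le> K" using that K by auto
    then have "(\<Sum>m\<in>{1..Suc K}. D m l j) = (\<Sum>m\<in>{1..min (p l) (p j)}. D m l j)"
      by (intro sum.mono_neutral_right) (auto simp: D_def)
    also have "\<dots> = covariance M (U l) (U j)"
      unfolding covariance_U[THEN conjunct2] by (intro sum.cong) (auto simp: D_def)
    finally show ?thesis by simp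
  qed
  have "(\<Sum>l\<in>UNIV. \<Sum>j\<in>UNIV. a l * a j * covariance M (X l) (X j)) = (\<Sum>l\<in>?A. \<Sum>j\<in>?A. a l * a j * covariance M (X l) (X j))"
  proof -
    have "(\<Sum>j\<in>UNIV. a l * a j * covariance M (X l) (X j)) = (\<Sum>j\<in>?A. a l * a j * covariance M (X l) (X j))" for l
      by (rule sum.mono_neutral_right) auto
    moreover have "(\<Sum>l\<in>UNIV. \<Sum>j\<in>?A. a l * a j * covariance M (X l) (X j)) = (\<Sum>l\<in>?A. \<Sum>j\<in>?A. a l * a j * covariance M (X l) (X j))"
      by (rule sum.mono_neutral_right) auto
    ultimately show ?thesis by simp
  qed
  also have "\<dots> = (\<Sum>l\<in>?A. \<Sum>j\<in>?A. \<Sum>m\<in>{1..Suc K}. b l * b j * D m l j)"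
  proof (intro sum.cong refl)
    fix l j assume lj: "l \<in> ?A" "j \<in> ?A"
    have "a l * a j * covariance M (X l) (X j) = b l * b j * covariance M (U l) (U j)"
      by (simp add: covariance_X b_def)
    then show "a l * a j * covariance M (X l) (X j) = (\<Sum>m\<in>{1..Suc K}. b l * b j * D m l j)"
      by (simp only: cov[OF lj] sum_distrib_left)
  qed
  also have "\<dots> = (\<Sum>m\<in>{1..Suc K}. T m)"
  proof -
    have "(\<Sum>l\<in>?A. \<Sum>j\<in>?A. \<Sum>m\<in>{1..Suc K}. b l * b j * D m l j) = (\<Sum>l\<in>?A. \<Sum>m\<in>{1..Suc K}. \<Sum>j\<in>?A. b l * b j * D m l j)"
      by (intro sum.cong refl sum.swap)
    also have "\<dots> = (\<Sum>m\<in>{1..Suc K}. T m)" unfolding T_def by (rule sum.swap)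
    finally show ?thesis .
  qed
  finally have form: "(\<Sum>l\<in>UNIV. \<Sum>j\<in>UNIV. a l * a j * covariance M (X l) (X j)) = (\<Sum>m\<in>{1..Suc K}. T m)" .
  have T: "integrable (\<Pi>\<^sub>M i\<in>{..<m}. P) (\<lambda>z. (\<Sum>l\<in>{l\<in>?A. m \<le> p l}. w m l * enn2real (H m l z))\<^sup>2) \<and>
     T m = t ^ m / fact m * (\<integral>z. (\<Sum>l\<in>{l\<in>?A. m \<le> p l}. w m l * enn2real (H m l z))\<^sup>2 \<partial>(\<Pi>\<^sub>M i\<in>{..<m}. P))" for m
  proof -
    let ?L = "{l\<in>?A. m \<le> p l}"
    have H: "H m l \<in> borel_measurable (\<Pi>\<^sub>M i\<in>{..<m}. P)" if "l \<in> ?L" for l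
      unfolding H_def by (rule section_integral_measurable[OF P \<phi>_P]) (use that in simp)
    have eq: "(\<integral>\<^sup>+z. H m l z * H m j z \<partial>(\<Pi>\<^sub>M i\<in>{..<m}. P)) = ov l j m" if "l \<in> ?L" "j \<in> ?L" for l j
      unfolding H_def using overlap_as_gram[of m l j] that by simp
    have fin: "(\<integral>\<^sup>+z. H m l z * H m l z \<partial>(\<Pi>\<^sub>M i\<in>{..<m}. P)) < \<top>" if "l \<in> ?L" for l
      unfolding eq[OF that that] using covariance_U[of l l] that by simp
    have D0: "D m l j = 0" if "\<not> (m \<le> p l \<and> m \<le> p j)" for l j
      using that unfolding D_def min.bounded_iff by (rule if_not_P)
    have "T m = (\<Sum>l\<in>?A. \<Sum>j\<in>?L. b l * b j * D m l j)"
      unfolding T_def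
    proof (rule sum.cong[OF refl], rule sum.mono_neutral_right)
      fix l
      show "\<forall>j\<in>?A - ?L. b l * b j * D m l j = 0"
      proof
        fix j assume "j \<in> ?A - ?L"
        then have "\<not> (m \<le> p l \<and> m \<le> p j)" by auto
        from D0[OF this] show "b l * b j * D m l j = 0" by simp
      qed
    qed auto
    also have "\<dots> = (\<Sum>l\<in>?L. \<Sum>j\<in>?L. b l * b j * D m l j)"
    proof (rule sum.mono_neutral_right)
      show "\<forall>l\<in>?A - ?L. (\<Sum>j\<in>?L. b l * b j * D m l j) = 0"
      proof (intro ballI sum.neutral)
        fix l j assume "l \<in> ?A - ?L"
        then have "\<not> (m \<le> p l \<and> m \<le> p j)" by auto
        from D0[OF this] show "b l * b j * D m l j = 0" by simp
      qed
    qed auto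
    also have "\<dots> = (\<Sum>l\<in>?L. \<Sum>j\<in>?L. t ^ m / fact m * (w m l * w m j * enn2real (\<integral>\<^sup>+z. H m l z * H m j z \<partial>(\<Pi>\<^sub>M i\<in>{..<m}. P))))"
    proof (intro sum.cong refl)
      fix l j assume lj: "l \<in> ?L" "j \<in> ?L"
      have "m \<le> p l" "m \<le> p j" using lj by auto
      then have "p l + p j - m = m + (p l - m) + (p j - m)" by linarith
      then have pow: "t ^ (p l + p j - m) = t ^ m * t ^ (p l - m) * t ^ (p j - m)" by (simp only: power_add)
      have "D m l j = t ^ (p l + p j - m) / (fact m * fact (p l - m) * fact (p j - m)) * enn2real (ov l j m)"
        unfolding D_def min.bounded_iff using lj by (intro if_P) blast
      then show "b l * b j * D m l j = t ^ m / fact m * (w m l * w m j * enn2real (\<integral>\<^sup>+z. H m l z * H m j z \<partial>(\<Pi>\<^sub>M i\<in>{..<m}. P)))"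
        unfolding eq[OF lj] w_def pow by (simp add: mult_ac del: fact_Suc power_Suc)
    qed
    also have "\<dots> = t ^ m / fact m * (\<Sum>l\<in>?L. \<Sum>j\<in>?L. w m l * w m j * enn2real (\<integral>\<^sup>+z. H m l z * H m j z \<partial>(\<Pi>\<^sub>M i\<in>{..<m}. P)))"
      by (simp only: sum_distrib_left)
    finally have Tm: "T m = t ^ m / fact m * (\<Sum>l\<in>?L. \<Sum>j\<in>?L. w m l * w m j * enn2real (\<integral>\<^sup>+z. H m l z * H m j z \<partial>(\<Pi>\<^sub>M i\<in>{..<m}. P)))" .
    have "finite ?L" by simp
    then have gram: "integrable (\<Pi>\<^sub>M i\<in>{..<m}. P) (\<lambda>z. (\<Sum>l\<in>?L. w m l * enn2real (H m l z))\<^sup>2) \<and>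
        (\<Sum>l\<in>?L. \<Sum>j\<in>?L. w m l * w m j * enn2real (\<integral>\<^sup>+z. H m l z * H m j z \<partial>(\<Pi>\<^sub>M i\<in>{..<m}. P))) =
        (\<integral>z. (\<Sum>l\<in>?L. w m l * enn2real (H m l z))\<^sup>2 \<partial>(\<Pi>\<^sub>M i\<in>{..<m}. P))"
      by (rule gram_identity[OF _ H fin])
    show ?thesis
      by (rule conjI[OF gram[THEN conjunct1] trans[OF Tm arg_cong[where f="(*) (t ^ m / fact m)", OF gram[THEN conjunct2]]]])
  qed
  have "T m \<ge> 0" for m
    unfolding T[THEN conjunct2] using t by (intro mult_nonneg_nonneg integral_nonneg_AE) auto
  then have "T (Suc K) \<le> (\<Sum>m\<in>{1..Suc K}. T m)" by (intro member_le_sum) auto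
  moreover have "(\<lambda>z. (\<Sum>l\<in>{l\<in>?A. Suc K \<le> p l}. w (Suc K) l * enn2real (H (Suc K) l z))\<^sup>2) = G"
  proof -
    have L: "{l\<in>?A. Suc K \<le> p l} = L" using K unfolding L_def by (auto intro: le_antisym)
    have "w (Suc K) l * enn2real (H (Suc K) l z) = a l / normalizer CARD('d) t s (k l) (\<alpha> l) * \<phi> l z" if "l \<in> L" for l z
    proof -
      have Kl: "Suc K = p l" using that by (simp add: L_def)
      show ?thesis unfolding w_def H_def b_def Kl section_full by (simp add: simplex_power_nonneg)
    qed
    then show ?thesis unfolding L G_def by (simp cong: sum.cong)
  qed
  ultimately show ?thesis using T[of "Suc K"] unfolding form by simp
qed

end

text \<open>
  The constants \<open>\<mu>\<close> of the limiting covariance: one simplex, and two simplices with \<open>m\<close> common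
  vertices, each of diameter at most \<open>1\<close>, with a (common) vertex at the origin.
\<close>

definition mean_limit :: "'d::finite itself \<Rightarrow> nat \<Rightarrow> real \<Rightarrow> ennreal" where
  "mean_limit _ k \<alpha> = based_integral k (\<lambda>z :: nat \<Rightarrow> (real, 'd) vec. ennreal (simplex_power 1 k \<alpha> z))"

definition overlap_limit :: "'d::finite itself \<Rightarrow> nat \<Rightarrow> real \<Rightarrow> nat \<Rightarrow> real \<Rightarrow> nat \<Rightarrow> ennreal" where
  "overlap_limit _ k \<alpha> k' \<alpha>' m = based_integral (Suc k + Suc k' - m - 1)
     (\<lambda>z :: nat \<Rightarrow> (real, 'd) vec. ennreal (simplex_power 1 k \<alpha> z) * ennreal (simplex_power 1 k' \<alpha>' (second_block (Suc k) m z)))"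

context rips_functionals
begin

text \<open>
  The factor \<open>s powr (\<alpha> l * k l)\<close> gained by scaling cancels against the normalization, so that all
  summands scale alike.
\<close>

lemma top_kernel:
  fixes a :: "'n \<Rightarrow> real"
  defines "L K \<equiv> {l. a l \<noteq> 0 \<and> k l = K}"
  shows "local_homogeneous_kernel W s K
    (\<lambda>z. ennreal ((\<Sum>l\<in>L K. a l / normalizer CARD('d) t s (k l) (\<alpha> l) * \<phi> l z)\<^sup>2))
    (\<lambda>z. ennreal ((\<Sum>l\<in>L K. a l * \<phi>\<^sub>1 l z)\<^sup>2))
    (ennreal (1 / (t * (rate K (t * s ^ CARD('d)))\<^sup>2)))" (is "local_homogeneous_kernel W s K ?f ?g ?c")
proof
  show "W \<in> sets borel" "emeasure lborel W = 1" "closed W" "0 < s" using W s by auto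
  have kL: "k l = K" if "l \<in> L K" for l using that by (simp add: L_def)
  have m: "simplex_power r (k l) (\<alpha> l) \<in> borel_measurable (\<Pi>\<^sub>M i\<in>{..<Suc K}. (borel :: (real^'d) measure))" if "l \<in> L K" for l r
    using \<phi>_meas[where r=r and l=l] kL[OF that] by simp
  show "depends_below (Suc K) ?f"
    unfolding depends_below_def
  proof
    fix x :: "nat \<Rightarrow> real^'d"
    have "\<phi> l (restrict x {..<Suc K}) = \<phi> l x" if "l \<in> L K" for l
      using depends_belowD[OF image_invariant_depends_below[OF image_invariant_simplex_power[of K s "\<alpha> l"]], of x] kL[OF that] by simp
    then show "?f (restrict x {..<Suc K}) = ?f x" by (simp cong: sum.cong)
  qed
  show "?f \<in> borel_measurable (\<Pi>\<^sub>M i\<in>{..<Suc K}. borel)" "?g \<in> borel_measurable (\<Pi>\<^sub>M i\<in>{..<Suc K}. borel)"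
    using m by (auto intro!: borel_measurable_sum measurable_compose[OF _ measurable_ennreal] borel_measurable_power borel_measurable_times)
  let ?r = "sqrt t * rate K (t * s ^ CARD('d))"
  have r: "?r > 0" using t rate_pos[OF tau_pos, where k=K] by simp
  fix x :: "real^'d" and u :: "nat \<Rightarrow> real^'d"
  have "a l / normalizer CARD('d) t s (k l) (\<alpha> l) * \<phi> l (\<lambda>i. x + s *\<^sub>R u i) = a l * \<phi>\<^sub>1 l u / ?r" if "l \<in> L K" for l
  proof -
    have "\<phi> l (\<lambda>i. x + s *\<^sub>R u i) = s powr (\<alpha> l * real (k l)) * \<phi>\<^sub>1 l u"
      using simplex_power_affine[OF k\<alpha>[of l] s, where s=1 and v=x and x=u] by simp
    moreover have "normalizer CARD('d) t s (k l) (\<alpha> l) = ?r * s powr (\<alpha> l * real (k l))"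
      using t kL[OF that] by (simp add: normalizer_eq powr_half_sqrt)
    moreover have "s powr (\<alpha> l * real (k l)) \<noteq> 0" using s by simp
    ultimately show ?thesis by simp
  qed
  then have "(\<Sum>l\<in>L K. a l / normalizer CARD('d) t s (k l) (\<alpha> l) * \<phi> l (\<lambda>i. x + s *\<^sub>R u i)) = (\<Sum>l\<in>L K. a l * \<phi>\<^sub>1 l u) / ?r"
    by (simp add: sum_divide_distrib cong: sum.cong)
  then have "(\<Sum>l\<in>L K. a l / normalizer CARD('d) t s (k l) (\<alpha> l) * \<phi> l (\<lambda>i. x + s *\<^sub>R u i))\<^sup>2 =
    1 / (t * (rate K (t * s ^ CARD('d)))\<^sup>2) * (\<Sum>l\<in>L K. a l * \<phi>\<^sub>1 l u)\<^sup>2"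
    using t by (simp add: power_divide power_mult_distrib)
  then show "?f (\<lambda>i. x + s *\<^sub>R u i) = ?c * ?g u"
    using t by (simp only:) (rule ennreal_mult, auto)
next
  fix z :: "nat \<Rightarrow> real^'d" and i
  assume "?f z \<noteq> 0" and i: "i \<le> K"
  then have "(\<Sum>l\<in>L K. a l / normalizer CARD('d) t s (k l) (\<alpha> l) * \<phi> l z) \<noteq> 0" by auto
  then obtain l where "l \<in> L K" "a l / normalizer CARD('d) t s (k l) (\<alpha> l) * \<phi> l z \<noteq> 0"
    by (meson sum.neutral)
  then have "\<phi> l z \<noteq> 0" "k l = K" by (auto simp: L_def)
  then show "norm (z i - z 0) \<le> s" using simplex_power_support i by blast
qed

text \<open>
  The term \<open>m = K + 1\<close> of the form is at least \<open>\<tau>^K / (rate K \<tau>)\<^sup>2\<close> times \<open>vol\<close> times \<open>J / (K + 1)!\<close>, and the first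
  factor is bounded below while \<open>\<tau>\<close> is bounded. Truncating \<open>J\<close> at \<open>1\<close> keeps the bound a real number.
\<close>

lemma quadratic_form_lower_bound:
  fixes a :: "'n \<Rightarrow> real" and S :: real
  assumes K: "\<And>l. a l \<noteq> 0 \<Longrightarrow> k l \<le> K" and S: "1 \<le> S" "t * s ^ CARD('d) \<le> S"
    and vol: "1/2 \<le> vol"
  defines "J \<equiv> based_integral K (\<lambda>z. ennreal ((\<Sum>l | a l \<noteq> 0 \<and> k l = K. a l * \<phi>\<^sub>1 l z)\<^sup>2))"
  shows "enn2real (min J 1) / (2 * fact (Suc K) * S ^ K) \<le>
      (\<Sum>l\<in>UNIV. \<Sum>j\<in>UNIV. a l * a j * covariance M (X l) (X j))"
proof -
  let ?L = "{l. a l \<noteq> 0 \<and> k l = K}" and ?\<tau> = "t * s ^ CARD('d)"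
  let ?G = "\<lambda>z. (\<Sum>l\<in>?L. a l / normalizer CARD('d) t s (k l) (\<alpha> l) * \<phi> l z)\<^sup>2"
  let ?P = "\<Pi>\<^sub>M i\<in>{..<Suc K}. P"
  let ?R = "t * (rate K ?\<tau>)\<^sup>2"
  interpret kern: local_homogeneous_kernel W s K "\<lambda>z. ennreal (?G z)"
    "\<lambda>z. ennreal ((\<Sum>l\<in>?L. a l * \<phi>\<^sub>1 l z)\<^sup>2)" "ennreal (1 / ?R)" by (rule top_kernel)
  note Q = quadratic_form_ge[of a K, OF K]
  define J' where "J' = enn2real (min J 1)"
  have J': "ennreal J' \<le> J" "0 \<le> J'"
  proof -
    have "min J 1 < \<top>" by (simp add: min_less_iff_disj)
    then have "ennreal J' = min J 1" by (simp add: J'_def)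
    then show "ennreal J' \<le> J" by simp
  qed (simp add: J'_def)
  have R: "?R > 0" using t rate_pos[OF tau_pos, where k=K] by simp
  have "ennreal (vol * (s ^ (CARD('d) * K) * (1 / ?R * J'))) \<le> ennreal vol * kern.scaled_mass"
  proof -
    have "ennreal (vol * (s ^ (CARD('d) * K) * (1 / ?R * J'))) = ennreal vol * (ennreal (s ^ (CARD('d) * K)) * (ennreal (1 / ?R) * ennreal J'))"
    proof -
      have "0 \<le> 1 / ?R" "0 \<le> s ^ (CARD('d) * K)" "0 \<le> vol" using R s by auto
      moreover from this J'(2) have "0 \<le> 1 / ?R * J'" "0 \<le> s ^ (CARD('d) * K) * (1 / ?R * J')"
        by (auto intro!: mult_nonneg_nonneg)
      ultimately show ?thesis using J'(2) by (simp only: ennreal_mult)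
    qed
    also have "\<dots> \<le> ennreal vol * kern.scaled_mass"
      unfolding kern.scaled_mass_def using J'(1) by (auto simp: J_def intro!: mult_left_mono)
    finally show ?thesis .
  qed
  also have "\<dots> \<le> (\<integral>\<^sup>+z. ennreal (?G z) \<partial>?P)" by (rule kern.total_ge)
  also have "\<dots> = ennreal (\<integral>z. ?G z \<partial>?P)"
    using Q by (intro nn_integral_eq_integral) auto
  finally have "vol * (s ^ (CARD('d) * K) * (1 / ?R * J')) \<le> (\<integral>z. ?G z \<partial>?P)"
    by (subst (asm) ennreal_le_iff) (auto intro!: integral_nonneg_AE)
  then have "t ^ Suc K / fact (Suc K) * (vol * (s ^ (CARD('d) * K) * (1 / ?R * J'))) \<le> t ^ Suc K / fact (Suc K) * (\<integral>z. ?G z \<partial>?P)"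
    using t by (intro mult_left_mono) auto
  also have "\<dots> \<le> (\<Sum>l\<in>UNIV. \<Sum>j\<in>UNIV. a l * a j * covariance M (X l) (X j))" using Q by blast
  finally have le: "t ^ Suc K / fact (Suc K) * (vol * (s ^ (CARD('d) * K) * (1 / ?R * J'))) \<le> (\<Sum>l\<in>UNIV. \<Sum>j\<in>UNIV. a l * a j * covariance M (X l) (X j))" .
  have "t ^ Suc K / fact (Suc K) * (vol * (s ^ (CARD('d) * K) * (1 / ?R * J'))) = vol * J' / fact (Suc K) * (?\<tau> ^ K / (rate K ?\<tau>)\<^sup>2)"
    unfolding power_mult[of s "CARD('d)" K] power_mult_distrib power_Suc using t by (simp add: field_simps del: fact_Suc)
  moreover have "1 / S ^ K \<le> ?\<tau> ^ K / (rate K ?\<tau>)\<^sup>2"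
    using rate_square_le[OF tau_pos S(2,1), where k=K] rate_pos[OF tau_pos, where k=K] S by (simp add: divide_simps mult.commute)
  moreover have "(1/2) * J' / fact (Suc K) \<le> vol * J' / fact (Suc K)"
    using vol J'(2) by (intro divide_right_mono mult_right_mono) auto
  ultimately have "(1/2) * J' / fact (Suc K) * (1 / S ^ K) \<le> t ^ Suc K / fact (Suc K) * (vol * (s ^ (CARD('d) * K) * (1 / ?R * J')))"
    using J'(2) S(1) by (simp only:) (intro mult_mono, auto simp del: fact_Suc)
  then have "(1/2) * J' / fact (Suc K) * (1 / S ^ K) \<le> (\<Sum>l\<in>UNIV. \<Sum>j\<in>UNIV. a l * a j * covariance M (X l) (X j))"
    using le by linarith
  then show ?thesis by (simp add: J'_def del: fact_Suc)
qed

text \<open>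
  Point \<open>0\<close> belongs to both simplices because \<open>m \<ge> 1\<close>, so all points lie within distance \<open>s\<close> of it.
\<close>

lemma overlap_kernel:
  assumes m: "1 \<le> m" "m \<le> p l" "m \<le> p j"
  shows "local_homogeneous_kernel W s (p l + p j - m - 1)
    (\<lambda>z. ennreal (\<phi> l z) * ennreal (\<phi> j (second_block (p l) m z)))
    (\<lambda>z. ennreal (\<phi>\<^sub>1 l z) * ennreal (\<phi>\<^sub>1 j (second_block (p l) m z)))
    (ennreal (s powr (\<alpha> l * real (k l)) * s powr (\<alpha> j * real (k j))))" (is "local_homogeneous_kernel W s ?n ?f ?g ?c")
proof
  have N: "Suc ?n = p l + p j - m" using m by linarith
  show "W \<in> sets borel" "emeasure lborel W = 1" "closed W" "0 < s" using W s by auto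
  show "depends_below (Suc ?n) ?f"
    unfolding depends_below_def N
  proof
    fix x :: "nat \<Rightarrow> real^'d"
    have "ennreal (\<phi> l (restrict x {..<p l + p j - m})) = ennreal (\<phi> l x)"
      by (rule depends_below_cong[OF \<phi>_dep]) (use m in auto)
    moreover have "ennreal (\<phi> j (second_block (p l) m (restrict x {..<p l + p j - m}))) = ennreal (\<phi> j (second_block (p l) m x))"
      by (rule depends_below_cong[OF \<phi>_dep]) (use m in \<open>auto simp: second_block_def\<close>)
    ultimately show "?f (restrict x {..<p l + p j - m}) = ?f x" by (simp only:)
  qed
  have meas: "(\<lambda>z. ennreal (simplex_power r (k l) (\<alpha> l) z) * ennreal (simplex_power r (k j) (\<alpha> j) (second_block (p l) m z)))
      \<in> borel_measurable (\<Pi>\<^sub>M i\<in>{..<Suc ?n}. (borel :: (real^'d) measure))" for r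
  proof -
    have k: "(\<lambda>z. ennreal (simplex_power r (k i) (\<alpha> i) z)) \<in> borel_measurable (\<Pi>\<^sub>M i\<in>{..<p i}. (borel :: (real^'d) measure))" for i
      by (rule measurable_compose[OF \<phi>_meas measurable_ennreal])
    have "(\<lambda>z. ennreal (simplex_power r (k l) (\<alpha> l) z)) \<in> borel_measurable (\<Pi>\<^sub>M i\<in>{..<p l + p j - m}. (borel :: (real^'d) measure))"
      by (rule depends_below_measurable[OF \<phi>_dep k]) (use m in auto)
    moreover have "(\<lambda>z. ennreal (simplex_power r (k j) (\<alpha> j) (second_block (p l) m z))) \<in> borel_measurable (\<Pi>\<^sub>M i\<in>{..<p l + p j - m}. (borel :: (real^'d) measure))"
      by (rule measurable_second_block_comp[OF \<phi>_dep k m(2,3)])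
    ultimately show ?thesis unfolding N by (rule borel_measurable_times_ennreal)
  qed
  show "?f \<in> borel_measurable (\<Pi>\<^sub>M i\<in>{..<Suc ?n}. borel)" "?g \<in> borel_measurable (\<Pi>\<^sub>M i\<in>{..<Suc ?n}. borel)"
    by (rule meas)+
  fix x :: "real^'d" and u :: "nat \<Rightarrow> real^'d"
  have "second_block (p l) m (\<lambda>i. x + s *\<^sub>R u i) = (\<lambda>i. x + s *\<^sub>R second_block (p l) m u i)"
    by (auto simp: second_block_def fun_eq_iff)
  then have "\<phi> l (\<lambda>i. x + s *\<^sub>R u i) = s powr (\<alpha> l * real (k l)) * \<phi>\<^sub>1 l u"
    "\<phi> j (second_block (p l) m (\<lambda>i. x + s *\<^sub>R u i)) = s powr (\<alpha> j * real (k j)) * \<phi>\<^sub>1 j (second_block (p l) m u)"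
    using simplex_power_affine[OF k\<alpha>[of l] s, where s=1 and v=x and x=u] simplex_power_affine[OF k\<alpha>[of j] s, where s=1 and v=x and x="second_block (p l) m u"] by simp_all
  then show "?f (\<lambda>i. x + s *\<^sub>R u i) = ?c * ?g u"
    by (simp add: ennreal_mult simplex_power_nonneg mult_ac)
next
  fix z :: "nat \<Rightarrow> real^'d" and i
  assume "?f z \<noteq> 0" and i: "i \<le> ?n"
  then have nz: "\<phi> l z \<noteq> 0" "\<phi> j (second_block (p l) m z) \<noteq> 0" by auto
  show "norm (z i - z 0) \<le> s"
  proof (cases "i \<le> k l")
    case True
    then show ?thesis using simplex_power_support[OF nz(1)] by simp
  next
    case False
    have "i + m - p l \<le> k j" using i m False by linarith
    from simplex_power_support[OF nz(2) this, of 0]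
    have "norm (second_block (p l) m z (i + m - p l) - second_block (p l) m z 0) \<le> s" by simp
    moreover have "second_block (p l) m z (i + m - p l) = z i" "second_block (p l) m z 0 = z 0"
      using m False by (auto simp: second_block_def)
    ultimately show ?thesis by simp
  qed
qed

lemma mean_kernel:
  "local_homogeneous_kernel W s (k l) (\<lambda>z. ennreal (\<phi> l z)) (\<lambda>z. ennreal (\<phi>\<^sub>1 l z)) (ennreal (s powr (\<alpha> l * real (k l))))"
proof
  show "W \<in> sets borel" "emeasure lborel W = 1" "closed W" "0 < s" using W s by auto
  show "depends_below (Suc (k l)) (\<lambda>z. ennreal (\<phi> l z))" by (rule \<phi>_dep)
  show "(\<lambda>z. ennreal (\<phi> l z)) \<in> borel_measurable (\<Pi>\<^sub>M i\<in>{..<Suc (k l)}. borel)"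
    "(\<lambda>z. ennreal (\<phi>\<^sub>1 l z)) \<in> borel_measurable (\<Pi>\<^sub>M i\<in>{..<Suc (k l)}. borel)"
    using \<phi>_meas[where r=s and l=l] \<phi>_meas[where r=1 and l=l] by measurable
  fix x :: "real^'d" and u :: "nat \<Rightarrow> real^'d"
  show "ennreal (\<phi> l (\<lambda>i. x + s *\<^sub>R u i)) = ennreal (s powr (\<alpha> l * real (k l))) * ennreal (\<phi>\<^sub>1 l u)"
    using simplex_power_affine[OF k\<alpha>[of l] s, where s=1 and v=x and x=u] by (simp add: ennreal_mult simplex_power_nonneg)
next
  fix z :: "nat \<Rightarrow> real^'d" and i
  assume nz: "ennreal (\<phi> l z) \<noteq> 0" and "i \<le> k l"
  have "\<phi> l z \<noteq> 0" using nz by (intro notI) simp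
  with \<open>i \<le> k l\<close> show "norm (z i - z 0) \<le> s" using simplex_power_support[of s "k l" "\<alpha> l" z i 0] by auto
qed

end

section \<open>The dense regime\<close>

lemma finite_of_finite_multiple: "ennreal c * x < \<top> \<Longrightarrow> 0 < c \<Longrightarrow> x < \<top>"
  by (auto simp: ennreal_mult_less_top ennreal_eq_0_iff not_le)

context rips_functionals
begin

lemma overlap_bounds:
  assumes m: "1 \<le> m" "m \<le> p l" "m \<le> p j"
  defines "B \<equiv> ennreal (s ^ (CARD('d) * (p l + p j - m - 1))) *
     (ennreal (s powr (\<alpha> l * real (k l)) * s powr (\<alpha> j * real (k j))) * overlap_limit TYPE('d) (k l) (\<alpha> l) (k j) (\<alpha> j) m)"
  shows "ennreal vol * B \<le> ov l j m" "ov l j m \<le> B"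
proof -
  interpret kern: local_homogeneous_kernel W s "p l + p j - m - 1"
    "\<lambda>z. ennreal (\<phi> l z) * ennreal (\<phi> j (second_block (p l) m z))"
    "\<lambda>z. ennreal (\<phi>\<^sub>1 l z) * ennreal (\<phi>\<^sub>1 j (second_block (p l) m z))"
    "ennreal (s powr (\<alpha> l * real (k l)) * s powr (\<alpha> j * real (k j)))"
    by (rule overlap_kernel[OF m])
  have N: "Suc (p l + p j - m - 1) = p l + p j - m" using m by linarith
  have B: "kern.scaled_mass = B"
    unfolding kern.scaled_mass_def B_def overlap_limit_def by simp
  show "ennreal vol * B \<le> ov l j m" "ov l j m \<le> B"
    using kern.total_ge kern.total_le unfolding B N overlap_integral_def by simp_all
qed

lemma section_first: "section_integral P 1 (p l) (\<phi> l) z = (\<integral>\<^sup>+u. ennreal (\<phi> l (u(0 := z 0))) \<partial>(\<Pi>\<^sub>M i\<in>{1..<p l}. P))"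
  unfolding section_integral_def
  by (intro nn_integral_cong depends_below_cong[OF \<phi>_dep]) (auto simp: merge_def)

text \<open>
  With a single shared point the overlap integral is the integral of the product of two functions of
  this point, each of which is constant away from the boundary. Hence it factorizes up to the volume of the
  eroded set.
\<close>

lemma first_overlap_bounds:
  defines "A \<equiv> \<lambda>l. ennreal (s ^ (CARD('d) * k l)) * (ennreal (s powr (\<alpha> l * real (k l))) * mean_limit TYPE('d) (k l) (\<alpha> l))"
  shows "ennreal vol * (A l * A j) \<le> ov l j 1" "ov l j 1 \<le> A l * A j"
proof -
  interpret U: prob_space P by (rule P)
  interpret PP: product_sigma_finite "\<lambda>_::nat. P" by standard
  interpret L1: prob_space "\<Pi>\<^sub>M i\<in>{..<1::nat}. P" by (rule prob_space_PiM) (rule P)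
  have le: "section_integral P 1 (p i) (\<phi> i) z \<le> A i" for i z
  proof -
    interpret kern: local_homogeneous_kernel W s "k i" "\<lambda>z. ennreal (\<phi> i z)" "\<lambda>z. ennreal (\<phi>\<^sub>1 i z)"
      "ennreal (s powr (\<alpha> i * real (k i)))" by (rule mean_kernel)
    show ?thesis using kern.inner_le unfolding section_first A_def kern.scaled_mass_def mean_limit_def by simp
  qed
  have eq: "section_integral P 1 (p i) (\<phi> i) z = A i" if "z 0 \<in> erosion s W" for i z
  proof -
    interpret kern: local_homogeneous_kernel W s "k i" "\<lambda>z. ennreal (\<phi> i z)" "\<lambda>z. ennreal (\<phi>\<^sub>1 i z)"
      "ennreal (s powr (\<alpha> i * real (k i)))" by (rule mean_kernel)
    show ?thesis using kern.inner_eq[OF that] unfolding section_first A_def kern.scaled_mass_def mean_limit_def by simp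
  qed
  have gram: "ov l j 1 = (\<integral>\<^sup>+z. section_integral P 1 (p l) (\<phi> l) z * section_integral P 1 (p j) (\<phi> j) z \<partial>(\<Pi>\<^sub>M i\<in>{..<1}. P))"
    by (rule overlap_as_gram) auto
  have "ov l j 1 \<le> (\<integral>\<^sup>+z. A l * A j \<partial>(\<Pi>\<^sub>M i\<in>{..<1::nat}. P))"
    unfolding gram by (intro nn_integral_mono mult_mono le) auto
  also have "\<dots> = A l * A j" using L1.emeasure_space_1 by simp
  finally show "ov l j 1 \<le> A l * A j" .
  have er: "erosion s W \<in> sets borel" using erosion_closed[OF W(3)] by auto
  interpret kern: local_homogeneous_kernel W s "k l" "\<lambda>z. ennreal (\<phi> l z)" "\<lambda>z. ennreal (\<phi>\<^sub>1 l z)"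
    "ennreal (s powr (\<alpha> l * real (k l)))" by (rule mean_kernel)
  have "ennreal vol * (A l * A j) = (\<integral>\<^sup>+x. A l * A j * indicator (erosion s W) x \<partial>P)"
    using er by (subst nn_integral_cmult_indicator) (auto simp: kern.emeasure_erosion mult.commute simp del: emeasure_uniform_measure)
  also have "\<dots> = (\<integral>\<^sup>+z. A l * A j * indicator (erosion s W) (z 0) \<partial>(\<Pi>\<^sub>M i\<in>{0::nat}. P))"
    using PP.product_nn_integral_singleton[of "\<lambda>x. A l * A j * indicator (erosion s W) x" 0] er by simp
  also have "{0::nat} = {..<1}" by auto
  also have "(\<integral>\<^sup>+z. A l * A j * indicator (erosion s W) (z 0) \<partial>(\<Pi>\<^sub>M i\<in>{..<1::nat}. P)) \<le> ov l j 1"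
    unfolding gram
  proof (intro nn_integral_mono)
    fix z :: "nat \<Rightarrow> real^'d"
    show "A l * A j * indicator (erosion s W) (z 0) \<le> section_integral P 1 (p l) (\<phi> l) z * section_integral P 1 (p j) (\<phi> j) z"
      by (cases "z 0 \<in> erosion s W") (simp_all add: eq del: One_nat_def)
  qed
  finally show "ennreal vol * (A l * A j) \<le> ov l j 1" .
qed

lemma normalizer_dense:
  assumes "1 \<le> t * s ^ CARD('d)"
  shows "normalizer CARD('d) t s (k l) (\<alpha> l) * normalizer CARD('d) t s (k j) (\<alpha> j) =
    t * (s powr (\<alpha> l * real (k l)) * s powr (\<alpha> j * real (k j))) * (t * s ^ CARD('d)) ^ (k l + k j)"
  using t by (simp add: normalizer_eq rate_ge_1[OF assms] power_add powr_half_sqrt)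

text \<open>
  The scaling limit is, up to a positive factor, bounded by the overlap integral at finite \<open>t\<close>.
\<close>

lemma overlap_limit_finite:
  assumes vol: "0 < vol" and m: "1 \<le> m" "m \<le> p l" "m \<le> p j"
  shows "overlap_limit TYPE('d) (k l) (\<alpha> l) (k j) (\<alpha> j) m < \<top>"
proof -
  let ?B = "ennreal (s ^ (CARD('d) * (p l + p j - m - 1))) *
     (ennreal (s powr (\<alpha> l * real (k l)) * s powr (\<alpha> j * real (k j))) * overlap_limit TYPE('d) (k l) (\<alpha> l) (k j) (\<alpha> j) m)"
  have "ennreal vol * ?B < \<top>"
    by (rule le_less_trans[OF overlap_bounds(1)[OF m] covariance_U[THEN conjunct1, of l j, rule_format]]) (use m in simp)
  moreover have "0 < s ^ (CARD('d) * (p l + p j - m - 1))" "0 < s powr (\<alpha> l * real (k l)) * s powr (\<alpha> j * real (k j))"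
    using s by simp_all
  ultimately show ?thesis using vol finite_of_finite_multiple by blast
qed

lemma mean_limit_finite:
  assumes vol: "0 < vol"
  shows "mean_limit TYPE('d) (k l) (\<alpha> l) < \<top>"
proof -
  let ?A = "ennreal (s ^ (CARD('d) * k l)) * (ennreal (s powr (\<alpha> l * real (k l))) * mean_limit TYPE('d) (k l) (\<alpha> l))"
  have "ennreal vol * (?A * ?A) < \<top>"
    by (rule le_less_trans[OF first_overlap_bounds(1)[of l l] covariance_U[THEN conjunct1, of l l, rule_format, of 1]]) simp
  moreover have "0 < s ^ (CARD('d) * k l)" "0 < s powr (\<alpha> l * real (k l))" using s by simp_all
  moreover have "?A < \<top>"
    using finite_of_finite_multiple[OF calculation(1) vol] by (auto simp: ennreal_mult_less_top)
  ultimately show ?thesis using finite_of_finite_multiple by blast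
qed

text \<open>
  For \<open>\<tau> \<ge> 1\<close> the maximum in the normalization is \<open>\<tau>^k\<close>. With \<open>p = k\<^sub>l + 1\<close> and \<open>q = k\<^sub>j + 1\<close>, the
  overlap size \<open>m\<close> contributes
  \<open>\<tau>^(p + q - m - 1) / \<tau>^(k\<^sub>l + k\<^sub>j) = \<tau>^(1 - m)\<close> times a bounded factor: \<open>m = 1\<close> gives the product \<open>v\<^sub>l v\<^sub>j\<close>
  and each \<open>m \<ge> 2\<close> at most a multiple of \<open>1 / \<tau>\<close>.
\<close>

lemma covariance_dense:
  assumes \<tau>: "1 \<le> t * s ^ CARD('d)" and vol: "0 < vol"
  defines "v \<equiv> \<lambda>l. enn2real (mean_limit TYPE('d) (k l) (\<alpha> l)) / fact (k l)"
  shows "vol * (v l * v j) \<le> covariance M (X l) (X j) \<and>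
    covariance M (X l) (X j) \<le> v l * v j + (\<Sum>m\<in>{2..min (p l) (p j)}. enn2real (overlap_limit TYPE('d) (k l) (\<alpha> l) (k j) (\<alpha> j) m)) / (t * s ^ CARD('d))"
proof -
  let ?\<tau> = "t * s ^ CARD('d)" and ?q = "s powr (\<alpha> l * real (k l)) * s powr (\<alpha> j * real (k j))"
  have q: "?q > 0" using s by simp
  let ?QQ = "t * ?q * ?\<tau> ^ (k l + k j)"
  have QQ: "?QQ > 0" using t q tau_pos by simp
  \<comment> \<open>The normalized contribution of the overlap size \<open>m\<close>.\<close>
  define T where "T m = t ^ (p l + p j - m) / (fact m * fact (p l - m) * fact (p j - m)) * enn2real (ov l j m) / ?QQ" for m
  have cov: "covariance M (X l) (X j) = (\<Sum>m\<in>{1..min (p l) (p j)}. T m)"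
    unfolding covariance_X covariance_U[THEN conjunct2] normalizer_dense[OF \<tau>] T_def by (rule sum_divide_distrib)
  have finite_ov: "ov l j m < \<top>" if "m \<le> p l" "m \<le> p j" for m
    using covariance_U[THEN conjunct1, of l j] that by simp
  have T_nonneg: "0 \<le> T m" for m
    unfolding T_def by (intro divide_nonneg_pos[OF _ QQ] mult_nonneg_nonneg divide_nonneg_nonneg) (use t in auto)
  have T_le: "T m \<le> enn2real (overlap_limit TYPE('d) (k l) (\<alpha> l) (k j) (\<alpha> j) m) / ?\<tau>" if m: "2 \<le> m" "m \<le> p l" "m \<le> p j" for m
  proof -
    have m1: "1 \<le> m" using m by simp
    define n where "n = p l + p j - m - 1"
    let ?x = "enn2real (overlap_limit TYPE('d) (k l) (\<alpha> l) (k j) (\<alpha> j) m)"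
    have "overlap_limit TYPE('d) (k l) (\<alpha> l) (k j) (\<alpha> j) m = ennreal ?x" using overlap_limit_finite[OF vol m1 m(2,3)] by simp
    then have "ov l j m \<le> ennreal (s ^ (CARD('d) * n)) * (ennreal ?q * ennreal ?x)"
      using overlap_bounds(2)[OF m1 m(2,3)] unfolding n_def by simp
    also have "\<dots> = ennreal (s ^ (CARD('d) * n) * (?q * ?x))"
      using s q by (simp only: ennreal_mult enn2real_nonneg mult_nonneg_nonneg less_imp_le zero_less_power)
    finally have ov: "enn2real (ov l j m) \<le> s ^ (CARD('d) * n) * (?q * ?x)"
      using s q by (intro enn2real_leI) auto
    have N: "p l + p j - m = Suc n" "k l + k j = n + (m - 1)" using m unfolding n_def by linarith+
    have fac: "(1::real) \<le> fact m * fact (p l - m) * fact (p j - m)"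
      by (intro mult_ge1_I mult_nonneg_nonneg) (auto simp: fact_ge_1)
    have "T m \<le> t ^ (p l + p j - m) * enn2real (ov l j m) / ?QQ"
    proof -
      have "t ^ (p l + p j - m) / (fact m * fact (p l - m) * fact (p j - m)) \<le> t ^ (p l + p j - m) / 1"
        using t fac by (intro divide_left_mono) auto
      then show ?thesis unfolding T_def using QQ by (intro divide_right_mono mult_right_mono) auto
    qed
    also have "\<dots> \<le> t ^ (p l + p j - m) * (s ^ (CARD('d) * n) * (?q * ?x)) / ?QQ"
      using ov t QQ by (intro divide_right_mono mult_left_mono) auto
    also have "\<dots> = ?x / ?\<tau> ^ (m - 1)"
    proof -
      have num: "t ^ (p l + p j - m) * (s ^ (CARD('d) * n) * (?q * ?x)) = t * ?q * ?\<tau> ^ n * ?x"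
        unfolding N(1) power_mult power_mult_distrib power_Suc by (simp only: mult_ac)
      have den: "?QQ = t * ?q * ?\<tau> ^ n * ?\<tau> ^ (m - 1)"
        unfolding N(2) power_add by (simp only: mult_ac)
      have nz: "t * ?q * ?\<tau> ^ n \<noteq> 0" using t q s by simp
      show ?thesis unfolding num den by (rule mult_divide_mult_cancel_left[OF nz])
    qed
    also have "\<dots> \<le> ?x / ?\<tau>"
    proof (intro divide_left_mono)
      show "?\<tau> \<le> ?\<tau> ^ (m - 1)" using power_increasing[of 1 "m - 1" ?\<tau>] \<tau> m by simp
    qed (use tau_pos in auto)
    finally show ?thesis .
  qed
  have first: "vol * (v l * v j) \<le> T 1" "T 1 \<le> v l * v j"
  proof -
    let ?a = "\<lambda>l. s ^ (CARD('d) * k l) * (s powr (\<alpha> l * real (k l)) * enn2real (mean_limit TYPE('d) (k l) (\<alpha> l)))"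
    have a: "ennreal (s ^ (CARD('d) * k l)) * (ennreal (s powr (\<alpha> l * real (k l))) * mean_limit TYPE('d) (k l) (\<alpha> l)) = ennreal (?a l)" for l
    proof -
      have "mean_limit TYPE('d) (k l) (\<alpha> l) = ennreal (enn2real (mean_limit TYPE('d) (k l) (\<alpha> l)))" using mean_limit_finite[OF vol] by simp
      then have "ennreal (s ^ (CARD('d) * k l)) * (ennreal (s powr (\<alpha> l * real (k l))) * mean_limit TYPE('d) (k l) (\<alpha> l)) =
        ennreal (s ^ (CARD('d) * k l)) * (ennreal (s powr (\<alpha> l * real (k l))) * ennreal (enn2real (mean_limit TYPE('d) (k l) (\<alpha> l))))" by simp
      also have "\<dots> = ennreal (?a l)"
        using s by (simp only: ennreal_mult enn2real_nonneg mult_nonneg_nonneg less_imp_le zero_less_power powr_ge_zero)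
      finally show ?thesis .
    qed
    have a0: "0 \<le> ?a l" for l using s by simp
    have b: "ennreal (vol * (?a l * ?a j)) \<le> ov l j 1" "ov l j 1 \<le> ennreal (?a l * ?a j)"
      using first_overlap_bounds[of l j] unfolding a using a0 vol
      by (simp_all only: ennreal_mult mult_nonneg_nonneg less_imp_le)
    have a00: "0 \<le> ?a l * ?a j" by (intro mult_nonneg_nonneg a0)
    have "vol * (?a l * ?a j) = enn2real (ennreal (vol * (?a l * ?a j)))"
      using vol by (intro enn2real_ennreal[symmetric] mult_nonneg_nonneg[OF _ a00]) simp
    also have "\<dots> \<le> enn2real (ov l j 1)"
      by (rule enn2real_mono[OF b(1) finite_ov]) auto
    finally have ov: "vol * (?a l * ?a j) \<le> enn2real (ov l j 1)" "enn2real (ov l j 1) \<le> ?a l * ?a j"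
      using enn2real_leI[OF a00 b(2)] by auto
    let ?c = "t ^ (p l + p j - 1) / (fact 1 * fact (p l - 1) * fact (p j - 1)) :: real"
    have c: "?c * (?a l * ?a j) / ?QQ = v l * v j"
    proof -
      have N: "p l + p j - 1 = Suc (k l + k j)" by simp
      have num: "t ^ (p l + p j - 1) * (?a l * ?a j) = ?QQ * (enn2real (mean_limit TYPE('d) (k l) (\<alpha> l)) * enn2real (mean_limit TYPE('d) (k j) (\<alpha> j)))"
        unfolding N power_mult power_mult_distrib power_Suc power_add by (simp only: mult_ac)
      have "?c * (?a l * ?a j) / ?QQ = t ^ (p l + p j - 1) * (?a l * ?a j) / ?QQ / (fact 1 * fact (p l - 1) * fact (p j - 1))"
      proof -
        have "a / F * A / R = a * A / R / F" for a F A R :: real by simp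
        then show ?thesis .
      qed
      also have "\<dots> = enn2real (mean_limit TYPE('d) (k l) (\<alpha> l)) * enn2real (mean_limit TYPE('d) (k j) (\<alpha> j)) / (fact 1 * fact (p l - 1) * fact (p j - 1))"
        unfolding num using QQ by (subst nonzero_mult_div_cancel_left[OF less_imp_neq[OF QQ, symmetric]]) (rule refl)
      also have "\<dots> = v l * v j" unfolding v_def by simp
      finally show ?thesis .
    qed
    have c0: "0 \<le> ?c" using t by simp
    have "vol * (v l * v j) = ?c * (vol * (?a l * ?a j)) / ?QQ" unfolding c[symmetric] by simp
    also have "\<dots> \<le> T 1" unfolding T_def using ov(1) c0 QQ by (intro divide_right_mono mult_left_mono) auto
    finally show "vol * (v l * v j) \<le> T 1" .
    have "T 1 \<le> ?c * (?a l * ?a j) / ?QQ" unfolding T_def using ov(2) c0 QQ by (intro divide_right_mono mult_left_mono) auto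
    then show "T 1 \<le> v l * v j" unfolding c .
  qed
  have "{1..min (p l) (p j)} = insert 1 {2..min (p l) (p j)}" by auto
  then have "covariance M (X l) (X j) = T 1 + (\<Sum>m\<in>{2..min (p l) (p j)}. T m)" unfolding cov by simp
  moreover have "0 \<le> (\<Sum>m\<in>{2..min (p l) (p j)}. T m)" using T_nonneg by (intro sum_nonneg) auto
  moreover have "(\<Sum>m\<in>{2..min (p l) (p j)}. T m) \<le> (\<Sum>m\<in>{2..min (p l) (p j)}. enn2real (overlap_limit TYPE('d) (k l) (\<alpha> l) (k j) (\<alpha> j) m)) / ?\<tau>"
    unfolding sum_divide_distrib by (intro sum_mono T_le) auto
  ultimately show ?thesis using first by linarith
qed

end

text \<open>
  The case of a single summand of the linear independence.
\<close>

lemma mean_limit_nonzero: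
  assumes "k \<le> CARD('d::finite) \<or> \<alpha> = 0"
  shows "mean_limit TYPE('d) k \<alpha> \<noteq> 0"
proof
  let ?f = "\<lambda>u :: nat \<Rightarrow> (real, 'd) vec. simplex_power 1 k \<alpha> (u(0 := 0))"
  let ?L = "\<Pi>\<^sub>M i\<in>{1..<Suc k}. (lborel :: (real, 'd) vec measure)"
  assume "mean_limit TYPE('d) k \<alpha> = 0"
  then have z: "(\<integral>\<^sup>+u. ennreal (?f u) \<partial>?L) = 0" by (simp add: mean_limit_def based_integral_def)
  have upd: "(\<lambda>u. u(0 := 0)) \<in> measurable (\<Pi>\<^sub>M i\<in>{1..<Suc k}. (borel :: (real, 'd) vec measure)) (\<Pi>\<^sub>M i\<in>{..<Suc k}. borel)"
    by (rule measurable_fun_upd[where J="{1..<Suc k}"]) auto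
  have "simplex_power 1 k \<alpha> \<in> borel_measurable (\<Pi>\<^sub>M i\<in>{..<Suc k}. (borel :: (real, 'd) vec measure))"
    by (rule simplex_power_measurable[OF assms]) auto
  from measurable_compose[OF upd this] have "?f \<in> borel_measurable ?L"
    by (simp cong: measurable_cong_sets sets_PiM_cong)
  then have "AE u in ?L. ennreal (?f u) = 0" using z by (subst (asm) nn_integral_0_iff_AE) auto
  then have "AE u in ?L. ennreal ((1 * ?f u)\<^sup>2) = 0"
    by eventually_elim (simp add: ennreal_eq_0_iff simplex_power_nonneg antisym)
  then have "(\<integral>\<^sup>+u. ennreal ((1 * ?f u)\<^sup>2) \<partial>?L) = (\<integral>\<^sup>+u. 0 \<partial>?L)" by (rule nn_integral_cong_AE)
  then have "based_integral k (\<lambda>x :: nat \<Rightarrow> (real, 'd) vec. ennreal ((\<Sum>l\<in>{()}. 1 * simplex_power 1 k \<alpha> x)\<^sup>2)) = 0"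
    by (simp add: based_integral_def)
  moreover have "based_integral k (\<lambda>x :: nat \<Rightarrow> (real, 'd) vec. ennreal ((\<Sum>l\<in>{()}. 1 * simplex_power 1 k \<alpha> x)\<^sup>2)) \<noteq> 0"
    by (rule simplex_powers_independent) (use assms in auto)
  ultimately show False by blast
qed

section \<open>The limiting covariance matrix\<close>

lemma emeasure_of_unit_volume:
  assumes "measure lborel W = 1"
  shows "emeasure lborel W = 1"
proof -
  have "emeasure lborel W \<noteq> \<top>" using assms by (auto simp: measure_def)
  then show ?thesis using assms by (simp add: emeasure_eq_ennreal_measure)
qed

lemma eventually_rips_functionals:
  fixes W :: "(real^'d) set" and k :: "'n::{finite,linorder} \<Rightarrow> nat"
  assumes W: "compact W" "measure lborel W = 1" and adm: "admissible CARD('d) k \<alpha>"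
    and lim: "rips_limit_covariance W k \<alpha> M \<eta> \<delta> \<Sigma>"
  shows "\<forall>\<^sub>F t in at_top. rips_functionals W (M t) (\<eta> t) t (\<delta> t) k \<alpha>"
proof -
  have "\<forall>\<^sub>F t in at_top. \<forall>l. (\<lambda>\<omega>. normalized_volume_power t (\<delta> t) (k l) (\<alpha> l) (\<eta> t \<omega>)) \<in> borel_measurable (M t) \<and>
     integrable (M t) (\<lambda>\<omega>. (normalized_volume_power t (\<delta> t) (k l) (\<alpha> l) (\<eta> t \<omega>))\<^sup>2)"
    using lim unfolding rips_limit_covariance_def limit_covariance_def by blast
  then show ?thesis using eventually_gt_at_top[of 0]
  proof eventually_elim
    case (elim t)
    have "closed W" using W(1) by (rule compact_imp_closed)
    show ?case
    proof
      show "poisson_process (M t) W t (\<eta> t)" "0 < \<delta> t" "0 < t"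
        using lim elim by (auto simp: rips_limit_covariance_def)
      show "W \<in> sets borel" "closed W" "emeasure lborel W = 1"
        using \<open>closed W\<close> emeasure_of_unit_volume[OF W(2)] by auto
      show "k l \<le> CARD('d) \<or> \<alpha> l = 0" for l
        using adm unfolding admissible_def by (meson not_le)
    qed (use elim in auto)
  qed
qed

text \<open>
  The quadratic form of the limit is bounded below by the same positive constant as the forms at
  finite \<open>t\<close>. Distinct indices with \<open>k\<^sub>l = K\<close> have distinct exponents, and for \<open>K = 0\<close> there is only one such
  index.
\<close>

lemma full_rank_of_bounded_intensity:
  fixes W :: "(real^'d) set" and k :: "'n::{finite,linorder} \<Rightarrow> nat"
  assumes W: "compact W" "convex W" "measure lborel W = 1" and adm: "admissible CARD('d) k \<alpha>"
    and lim: "rips_limit_covariance W k \<alpha> M \<eta> \<delta> \<Sigma>" and single: "no_repeated_vertex_count k"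
    and c: "((\<lambda>t. t * \<delta> t ^ CARD('d)) \<longlongrightarrow> c) at_top" "0 \<le> c"
  shows "rank \<Sigma> = CARD('n)"
proof (rule rank_pos_def)
  fix a :: "(real, 'n) vec" assume "a \<noteq> 0"
  define K where "K = Max (k ` {l. a $ l \<noteq> 0})"
  have ne: "{l. a $ l \<noteq> 0} \<noteq> {}" using \<open>a \<noteq> 0\<close> by (auto simp: vec_eq_iff)
  have K: "k l \<le> K" if "a $ l \<noteq> 0" for l unfolding K_def using that by (intro Max_ge) auto
  have "K \<in> k ` {l. a $ l \<noteq> 0}" unfolding K_def using ne by (intro Max_in) auto
  then obtain l0 where l0: "a $ l0 \<noteq> 0" "k l0 = K" by auto
  let ?L = "{l. a $ l \<noteq> 0 \<and> k l = K}"
  define J where "J = based_integral K (\<lambda>z :: nat \<Rightarrow> real^'d. ennreal ((\<Sum>l\<in>?L. a $ l * simplex_power 1 K (\<alpha> l) z)\<^sup>2))"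
  have J: "J \<noteq> 0"
    unfolding J_def
  proof (rule simplex_powers_independent[where l=l0])
    show "K \<le> CARD('d) \<or> \<alpha> l = 0" if "l \<in> ?L" for l
      using adm unfolding admissible_def \<open>l \<in> ?L\<close>[unfolded mem_Collect_eq, THEN conjunct2, symmetric] by (meson not_le)
    show "inj_on \<alpha> ?L"
    proof (rule inj_onI)
      fix i j assume "i \<in> ?L" "j \<in> ?L" "\<alpha> i = \<alpha> j"
      then have "(\<lambda>i. (k i, \<alpha> i)) i = (\<lambda>i. (k i, \<alpha> i)) j" by simp
      then show "i = j" using adm unfolding admissible_def by (meson injD)
    qed
    show "\<exists>l. ?L \<subseteq> {l}" if "K = 0"
      using single l0 that unfolding no_repeated_vertex_count_def by (intro exI[of _ l0]) auto
  qed (use l0 in auto)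
  \<comment> \<open>An eventual upper bound of \<open>t \<delta>^d\<close>.\<close>
  define S where "S = c + 1"
  have S: "1 \<le> S" "c < S" using c by (auto simp: S_def)
  define B where "B = enn2real (min J 1) / (2 * fact (Suc K) * S ^ K)"
  have "0 < B"
  proof -
    have "min J 1 \<noteq> 0" using J by (simp add: min_def)
    moreover have "min J 1 < \<top>" by (simp add: min_less_iff_disj)
    ultimately have "0 < enn2real (min J 1)" unfolding enn2real_positive_iff zero_less_iff_neq_zero by (rule conjI)
    then show ?thesis using S unfolding B_def by (intro divide_pos_pos mult_pos_pos) auto
  qed
  have \<delta>: "(\<delta> \<longlongrightarrow> 0) at_top" "\<forall>t>0. \<delta> t > 0" using lim by (auto simp: rips_limit_covariance_def)
  let ?X = "\<lambda>t i \<omega>. normalized_volume_power t (\<delta> t) (k i) (\<alpha> i) (\<eta> t \<omega>)"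
  have conv: "((\<lambda>t. covariance (M t) (?X t l) (?X t j)) \<longlongrightarrow> \<Sigma> $ l $ j) at_top" for l j
    using lim by (simp add: rips_limit_covariance_def limit_covariance_def)
  have "((\<lambda>t. \<Sum>l\<in>UNIV. \<Sum>j\<in>UNIV. a $ l * a $ j * covariance (M t) (?X t l) (?X t j)) \<longlongrightarrow>
    (\<Sum>l\<in>UNIV. \<Sum>j\<in>UNIV. a $ l * a $ j * \<Sigma> $ l $ j)) at_top"
    by (intro tendsto_sum tendsto_mult tendsto_const conv)
  moreover have "\<forall>\<^sub>F t in at_top. B \<le> (\<Sum>l\<in>UNIV. \<Sum>j\<in>UNIV. a $ l * a $ j * covariance (M t) (?X t l) (?X t j))"
    using eventually_rips_functionals[OF W(1,3) adm lim] order_tendstoD(2)[OF c(1) S(2)]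
      order_tendstoD(1)[OF erosion_volume_tendsto[OF W \<delta>], of "1/2", simplified]
  proof eventually_elim
    case (elim t)
    interpret rips_functionals W "M t" "\<eta> t" t "\<delta> t" k \<alpha> by (rule elim(1))
    have JK: "based_integral K (\<lambda>z :: nat \<Rightarrow> real^'d. ennreal ((\<Sum>l\<in>?L. a $ l * simplex_power 1 (k l) (\<alpha> l) z)\<^sup>2)) = J"
    proof -
      have "(\<Sum>l\<in>?L. a $ l * simplex_power 1 (k l) (\<alpha> l) z) = (\<Sum>l\<in>?L. a $ l * simplex_power 1 K (\<alpha> l) z)"
        for z :: "nat \<Rightarrow> real^'d"
        by (intro sum.cong) auto
      then show ?thesis unfolding J_def by (simp only:)
    qed
    show ?case
      using quadratic_form_lower_bound[of "\<lambda>l. a $ l" K S] K S(1) elim(2,3) unfolding JK B_def by simp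
  qed
  ultimately have "B \<le> (\<Sum>l\<in>UNIV. \<Sum>j\<in>UNIV. a $ l * a $ j * \<Sigma> $ l $ j)"
    by (rule tendsto_lowerbound) simp
  also have "\<dots> = a \<bullet> (\<Sigma> *v a)"
    by (simp add: inner_vec_def matrix_vector_mult_def sum_distrib_left mult_ac)
  finally show "0 < a \<bullet> (\<Sigma> *v a)" using \<open>0 < B\<close> by simp
qed

lemma rank_one_of_dense:
  fixes W :: "(real^'d) set" and k :: "'n::{finite,linorder} \<Rightarrow> nat"
  assumes W: "compact W" "convex W" "measure lborel W = 1" and adm: "admissible CARD('d) k \<alpha>"
    and lim: "rips_limit_covariance W k \<alpha> M \<eta> \<delta> \<Sigma>"
    and dense: "filterlim (\<lambda>t. t * \<delta> t ^ CARD('d)) at_top at_top"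
  shows "rank \<Sigma> = 1"
proof -
  have \<delta>: "(\<delta> \<longlongrightarrow> 0) at_top" "\<forall>t>0. \<delta> t > 0" using lim by (auto simp: rips_limit_covariance_def)
  let ?X = "\<lambda>t i \<omega>. normalized_volume_power t (\<delta> t) (k i) (\<alpha> i) (\<eta> t \<omega>)"
  let ?\<tau> = "\<lambda>t. t * \<delta> t ^ CARD('d)" and ?vol = "\<lambda>t. measure lborel (erosion (\<delta> t) W)"
  define v :: "(real, 'n) vec" where "v = (\<chi> l. enn2real (mean_limit TYPE('d) (k l) (\<alpha> l)) / fact (k l))"
  have vol: "(?vol \<longlongrightarrow> 1) at_top" by (rule erosion_volume_tendsto[OF W \<delta>])
  have ev: "\<forall>\<^sub>F t in at_top. rips_functionals W (M t) (\<eta> t) t (\<delta> t) k \<alpha> \<and> 0 < ?vol t \<and> 1 \<le> ?\<tau> t"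
    using eventually_rips_functionals[OF W(1,3) adm lim] order_tendstoD(1)[OF vol, of 0, simplified]
      dense[unfolded filterlim_at_top, rule_format, of 1]
    by eventually_elim auto
  have entry: "\<Sigma> $ l $ j = v $ l * v $ j" for l j
  proof -
    let ?r = "\<Sum>m\<in>{2..min (Suc (k l)) (Suc (k j))}. enn2real (overlap_limit TYPE('d) (k l) (\<alpha> l) (k j) (\<alpha> j) m)"
    have "((\<lambda>t. covariance (M t) (?X t l) (?X t j)) \<longlongrightarrow> v $ l * v $ j) at_top"
    proof (rule tendsto_sandwich)
      show "\<forall>\<^sub>F t in at_top. ?vol t * (v $ l * v $ j) \<le> covariance (M t) (?X t l) (?X t j)"
        using ev
      proof eventually_elim
        case (elim t)
        interpret rips_functionals W "M t" "\<eta> t" t "\<delta> t" k \<alpha> using elim by blast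
        show ?case using covariance_dense[of l j] elim by (simp add: v_def)
      qed
      show "\<forall>\<^sub>F t in at_top. covariance (M t) (?X t l) (?X t j) \<le> v $ l * v $ j + ?r / ?\<tau> t"
        using ev
      proof eventually_elim
        case (elim t)
        interpret rips_functionals W "M t" "\<eta> t" t "\<delta> t" k \<alpha> using elim by blast
        show ?case using covariance_dense[of l j] elim by (simp add: v_def)
      qed
      show "((\<lambda>t. ?vol t * (v $ l * v $ j)) \<longlongrightarrow> v $ l * v $ j) at_top"
        using tendsto_mult_right[OF vol, of "v $ l * v $ j"] by simp
      have "((\<lambda>t. ?r / ?\<tau> t) \<longlongrightarrow> 0) at_top"
        by (rule real_tendsto_divide_at_top[OF tendsto_const dense])
      from tendsto_add[OF tendsto_const this, of "v $ l * v $ j"]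
      show "((\<lambda>t. v $ l * v $ j + ?r / ?\<tau> t) \<longlongrightarrow> v $ l * v $ j) at_top" by simp
    qed
    moreover have "((\<lambda>t. covariance (M t) (?X t l) (?X t j)) \<longlongrightarrow> \<Sigma> $ l $ j) at_top"
      using lim by (simp add: rips_limit_covariance_def limit_covariance_def)
    ultimately show ?thesis by (intro tendsto_unique[OF trivial_limit_at_top_linorder])
  qed
  have "v \<noteq> 0"
  proof -
    fix l :: 'n
    obtain t where rf: "rips_functionals W (M t) (\<eta> t) t (\<delta> t) k \<alpha>" "0 < ?vol t"
      using eventually_happens[OF ev] by auto
    interpret rips_functionals W "M t" "\<eta> t" t "\<delta> t" k \<alpha> by (rule rf(1))
    have "mean_limit TYPE('d) (k l) (\<alpha> l) < \<top>" by (rule mean_limit_finite[OF rf(2)])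
    moreover have "mean_limit TYPE('d) (k l) (\<alpha> l) \<noteq> 0" by (rule mean_limit_nonzero[OF k\<alpha>])
    ultimately have "v $ l \<noteq> 0" by (simp add: v_def enn2real_eq_0_iff less_top)
    then show ?thesis by auto
  qed
  from rank_outer_product[OF entry this] show ?thesis .
qed

theorem corollary3p6:
  fixes W :: "(real^'d) set"
    and k :: "'n::{finite,linorder} \<Rightarrow> nat" and \<alpha> :: "'n \<Rightarrow> real"
  assumes "compact W" and "convex W" and "measure lborel W = 1"
    and "admissible CARD('d) k \<alpha>"
  shows
    "(no_repeated_vertex_count k \<longrightarrow>
       (\<forall>(M :: real \<Rightarrow> 'w measure) \<eta> \<delta> \<Sigma>.
          rips_limit_covariance W k \<alpha> M \<eta> \<delta> \<Sigma> \<longrightarrow>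
          ((\<lambda>t. t * \<delta> t ^ CARD('d)) \<longlongrightarrow> 0) at_top \<longrightarrow>
          rank \<Sigma> = CARD('n))) \<and>
     (no_repeated_vertex_count k \<longrightarrow>
       (\<exists>C :: real set. finite C \<and>
         (\<forall>c. 0 < c \<longrightarrow> c \<notin> C \<longrightarrow>
           (\<forall>(M :: real \<Rightarrow> 'w measure) \<eta> \<delta> \<Sigma>.
              rips_limit_covariance W k \<alpha> M \<eta> \<delta> \<Sigma> \<longrightarrow>
              ((\<lambda>t. t * \<delta> t ^ CARD('d)) \<longlongrightarrow> c) at_top \<longrightarrow>
              rank \<Sigma> = CARD('n))))) \<and>
     (\<forall>(M :: real \<Rightarrow> 'w measure) \<eta> \<delta> \<Sigma>.
        rips_limit_covariance W k \<alpha> M \<eta> \<delta> \<Sigma> \<longrightarrow>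
        filterlim (\<lambda>t. t * \<delta> t ^ CARD('d)) at_top at_top \<longrightarrow>
        rank \<Sigma> = 1)"
proof (intro conjI impI allI)
  fix M :: "real \<Rightarrow> 'w measure" and \<eta> \<delta> \<Sigma>
  assume single: "no_repeated_vertex_count k" and lim: "rips_limit_covariance W k \<alpha> M \<eta> \<delta> \<Sigma>"
    and sparse: "((\<lambda>t. t * \<delta> t ^ CARD('d)) \<longlongrightarrow> 0) at_top"
  show "rank \<Sigma> = CARD('n)" by (rule full_rank_of_bounded_intensity[OF assms lim single sparse order_refl])
next
  assume single: "no_repeated_vertex_count k"
  show "\<exists>C :: real set. finite C \<and>
         (\<forall>c. 0 < c \<longrightarrow> c \<notin> C \<longrightarrow>
           (\<forall>(M :: real \<Rightarrow> 'w measure) \<eta> \<delta> \<Sigma>.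
              rips_limit_covariance W k \<alpha> M \<eta> \<delta> \<Sigma> \<longrightarrow>
              ((\<lambda>t. t * \<delta> t ^ CARD('d)) \<longlongrightarrow> c) at_top \<longrightarrow>
              rank \<Sigma> = CARD('n)))"
  \<comment> \<open>The limit has full rank for every \<open>c > 0\<close>.\<close>
  proof (intro exI[of _ "{}"] conjI allI impI)
    fix c :: real and M :: "real \<Rightarrow> 'w measure" and \<eta> \<delta> \<Sigma>
    assume "0 < c" and lim: "rips_limit_covariance W k \<alpha> M \<eta> \<delta> \<Sigma>"
      and c: "((\<lambda>t. t * \<delta> t ^ CARD('d)) \<longlongrightarrow> c) at_top"
    show "rank \<Sigma> = CARD('n)"
      by (rule full_rank_of_bounded_intensity[OF assms lim single c less_imp_le[OF \<open>0 < c\<close>]])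
  qed simp
next
  fix M :: "real \<Rightarrow> 'w measure" and \<eta> \<delta> \<Sigma>
  assume "rips_limit_covariance W k \<alpha> M \<eta> \<delta> \<Sigma>"
    "filterlim (\<lambda>t. t * \<delta> t ^ CARD('d)) at_top at_top"
  then show "rank \<Sigma> = 1" by (rule rank_one_of_dense[OF assms])
qed

end
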